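(* Suppose that $\mathbb{P}$ is $\psi$-mixing and that $$\sum_{n=1}^\infty\psi_n\ln n<\infty.$$ Then for $\mathbb{P}$-almost all $\omega\in\Omega$, $$\lim_{n\to\infty}\frac1n\big(\ln\tau_{A^\omega_n}(\varpi)+\ell\ln\mathbb{P}(A^\omega_n)\big)=0\qquad\text{for }\mathbb{P}\text{-almost all }\varpi\in\Omega.$$ If, in addition, $-\sum_{a\in\mathcal{A}}\mathbb{P}([a])\ln\mathbb{P}([a])<\infty$, then for $\mathbb{P}$-almost all $\omega\in\Omega$, $$\lim_{n\to\infty}\frac1n\ln\tau_{A^\omega_n}(\varpi)=\ell\,h_{\mathbb{P}}(T)\qquad\text{for }\mathbb{P}\text{-almost all }\varpi\in\Omega,$$ where $h_{\mathbb{P}}(T)$ is the Kolmogorov–Sinai entropy of the shift $T$ with respect to its invariant measure $\mathbb{P}$.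
   Context: $\mathbb{N}=\{0,1,2,\dots\}$. $\mathcal{A}$ is a finite or countable alphabet with more than one element, $\Omega=\mathcal{A}^{\mathbb{N}}$, $\mathcal{F}$ is the $\sigma$-algebra generated by cylinder sets, $T$ is the left shift $(T\omega)_i=\omega_{i+1}$, and $\mathbb{P}$ is a $T$-invariant probability on $(\Omega,\mathcal{F})$ such that every cylinder $[a]=\{\omega:\omega_0=a\}$, $a\in\mathcal{A}$, has positive probability. For $0\le k\le n\le\infty$, $\mathcal{F}_{k,n}$ is the $\sigma$-algebra generated by the coordinates $\omega_i$ with $k\le i\le n$ (all $i\geq k$ if $n=\infty$). For $\sigma$-algebras $\mathcal{G},\mathcal{H}\subset\mathcal{F}$, $$\psi(\mathcal{G},\mathcal{H})=\sup\Big\{\Big|\frac{\mathbb{P}(B\cap C)}{\mathbb{P}(B)\mathbb{P}(C)}-1\Big|:B\in\mathcal{G},\,C\in\mathcal{H},\ \mathbb{P}(B)\mathbb{P}(C)\neq0\Big\},\qquad \psi_m=\sup_{n\in\mathbb{N}}\psi(\mathcal{F}_{0,n},\mathcal{F}_{n+m+1,\infty}).$$ $\mathbb{P}$ is called $\psi$-mixing if $\psi_0<\infty$ and $\psi_m\to0$ as $m\to\infty$. For $\omega\in\Omega$ and $n\ge1$, $A^\omega_n=[\omega_0,\dots,\omega_{n-1}]$ is the cylinder of all sequences whose first $n$ entries coincide with those of $\omega$. Let $\ell\ge1$ and $q_i(k)=d_ik$, $i=1,\dots,\ell$, with integers $1\le d_1<d_2<\cdots<d_\ell$. For a cylinder $A$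 and $\varpi\in\Omega$, $$\tau_A(\varpi)=\min\Big\{k\ge1:\prod_{i=1}^\ell\mathbb{I}_A(T^{d_ik}\varpi)=1\Big\}$$ (equal to $+\infty$ if there is no such $k$). *)

theory Defs
  imports "HOL-Probability.Probability"
begin

text \<open>
  The alphabet is a countable type \<open>'a\<close> and the sequence space is the whole type \<open>nat \<Rightarrow> 'a\<close>.
\<close>

definition cylinder :: "'a list \<Rightarrow> (nat \<Rightarrow> 'a) set" where
  "cylinder as = {\<omega>. \<forall>i<length as. \<omega> i = as ! i}"

definition init_cylinder :: "(nat \<Rightarrow> 'a) \<Rightarrow> nat \<Rightarrow> (nat \<Rightarrow> 'a) set" where
  "init_cylinder \<omega> n = cylinder (map \<omega> [0..<n])"

definition sequence_algebra :: "(nat \<Rightarrow> 'a) measure" where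
  "sequence_algebra = sigma UNIV (range cylinder)"

definition shift :: "(nat \<Rightarrow> 'a) \<Rightarrow> (nat \<Rightarrow> 'a)" where
  "shift \<omega> = (\<lambda>i. \<omega> (Suc i))"

definition measure_preserving :: "'b measure \<Rightarrow> ('b \<Rightarrow> 'b) \<Rightarrow> bool" where
  "measure_preserving M T \<longleftrightarrow> T \<in> measurable M M \<and> distr M M T = M"


subsection \<open>\<open>\<psi>\<close>-mixing\<close>

definition coord_algebra :: "nat \<Rightarrow> enat \<Rightarrow> (nat \<Rightarrow> 'a) set set" where
  "coord_algebra k n =
     sigma_sets UNIV {(\<lambda>\<omega>. \<omega> i) -` S | i S. k \<le> i \<and> enat i \<le> n}"

text \<open>The coefficients may be infinite, hence take values in \<open>ennreal\<close>.\<close>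

definition psi_dep :: "'b measure \<Rightarrow> 'b set set \<Rightarrow> 'b set set \<Rightarrow> ennreal" where
  "psi_dep M G H =
     Sup {ennreal \<bar>measure M (B \<inter> C) / (measure M B * measure M C) - 1\<bar> | B C.
            B \<in> G \<and> C \<in> H \<and> measure M B * measure M C \<noteq> 0}"

definition psi :: "(nat \<Rightarrow> 'a) measure \<Rightarrow> nat \<Rightarrow> ennreal" where
  "psi P m = (SUP n. psi_dep P (coord_algebra 0 (enat n)) (coord_algebra (n + m + 1) \<infinity>))"

definition psi_mixing :: "(nat \<Rightarrow> 'a) measure \<Rightarrow> bool" where
  "psi_mixing P \<longleftrightarrow> psi P 0 < \<infinity> \<and> psi P \<longlonglongrightarrow> 0"


subsection \<open>Multiple hitting times\<close>

text \<open>The infimum of the empty set in \<open>enat\<close> is \<open>\<infinity>\<close>.\<close>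

definition hitting_time ::
  "nat \<Rightarrow> (nat \<Rightarrow> nat) \<Rightarrow> (nat \<Rightarrow> 'a) set \<Rightarrow> (nat \<Rightarrow> 'a) \<Rightarrow> enat" where
  "hitting_time l d A \<eta> =
     Inf {enat k | k. 1 \<le> k \<and> (\<Prod>i=1..l. indicator A ((shift ^^ (d i * k)) \<eta>)) = (1::nat)}"

fun ln_enat :: "enat \<Rightarrow> ereal" where
  "ln_enat (enat k) = ereal (ln (real k))"
| "ln_enat \<infinity> = \<infinity>"


subsection \<open>Kolmogorov--Sinai entropy\<close>

text \<open>In \<open>partition_entropy\<close>, the convention \<open>0 ln 0 = 0\<close> holds automatically.\<close>

definition partition_entropy :: "'b measure \<Rightarrow> 'b set set \<Rightarrow> real" where
  "partition_entropy M \<xi> = - (\<Sum>A\<in>\<xi>. measure M A * ln (measure M A))"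

text \<open>The join of the partitions \<open>T\<^sup>-\<^sup>i \<xi>\<close>, \<open>i < n\<close>.\<close>

definition iterated_join :: "'b measure \<Rightarrow> ('b \<Rightarrow> 'b) \<Rightarrow> 'b set set \<Rightarrow> nat \<Rightarrow> 'b set set" where
  "iterated_join M T \<xi> n =
     {{x \<in> space M. \<forall>i<n. (T ^^ i) x \<in> C i} | C. \<forall>i<n. C i \<in> \<xi>} - {{}}"

text \<open>For a measure-preserving map and a finite measurable partition the following limit
  exists by subadditivity.\<close>

definition entropy_wrt :: "'b measure \<Rightarrow> ('b \<Rightarrow> 'b) \<Rightarrow> 'b set set \<Rightarrow> real" where
  "entropy_wrt M T \<xi> = lim (\<lambda>n. partition_entropy M (iterated_join M T \<xi> n) / real n)"

definition KS_entropy :: "'b measure \<Rightarrow> ('b \<Rightarrow> 'b) \<Rightarrow> ereal" where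
  "KS_entropy M T =
     (SUP \<xi> \<in> {\<xi>. partition_on (space M) \<xi> \<and> finite \<xi> \<and> \<xi> \<subseteq> sets M}. ereal (entropy_wrt M T \<xi>))"

end

theory Submission imports Defs
begin

text \<open>
  Write \<open>A\<close> for the cylinder of \<open>\<omega>\<close> of length \<open>n\<close>. Lower bound on the hitting time: for \<open>k \<ge> n\<close> the \<open>\<ell>\<close>
  windows starting at \<open>d\<^sub>i k\<close> are disjoint, so a simultaneous visit to \<open>A\<close> has probability at most a
  constant times \<open>P(A)\<^sup>\<ell>\<close>; for \<open>k < n\<close> the bound \<open>P(A)\<close> suffices because cylinders decay
  exponentially. Upper bound: along an arithmetic progression of values of \<open>k\<close> that is long but starts
  far out, all windows of any two of the values are separated by gaps of length \<open>n\<close>, so the number of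
  visits has relative variance of order \<open>\<psi>\<^sub>n\<close>. Chebyshev's inequality and the Borel--Cantelli lemma
  give the first limit.

  For the second limit, the \<open>\<psi>\<close>-mixing bound for adjacent blocks and a likelihood ratio argument
  against the product of block distributions squeeze \<open>- ln P(A) / n\<close>, by Birkhoff's theorem for the
  \<open>m\<close>-th power of the shift, between \<open>H\<^sub>m / m - c / m\<close> and \<open>H\<^sub>m / m\<close>, where \<open>H\<^sub>m\<close> is the entropy of the
  words of length \<open>m\<close>. That the limit is the Kolmogorov--Sinai entropy is the generator theorem; both
  halves of it follow from Gibbs' inequality with explicit conditional weights, so that no
  conditional entropies are required.
\<close>


subsection \<open>Ergodic averages\<close>

text \<open>Windows of two values k and k' can collide: d_i k = d_j k' may hold for i <> j, and then
  the visits are far from independent. Starting the progression at (d_l + 1) times its own span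
  forces both windows with index i to precede both with index i + 1. The price is a factor of order
  n in the hitting time, which disappears after taking ln and dividing by n. The progression has
  about exp(e n) / P(A)^l terms, so the expected number of visits grows exponentially; the remaining
  term of Chebyshev's bound is of order psi_n, and the assumption on the series makes it summable. A
  lower bound on probabilities from mixing requires a gap with psi at most 1. Adjacent blocks yield
  only an upper bound, with a factor 1 + psi_0 per block; this is why the other direction needs a
  likelihood ratio, and c is ln (1 + psi_0). Entropies are integrals of information functions, so
  countable alphabets and finite partitions are handled alike. \<open>KS_entropy\<close> refers to
  finite partitions only, and merging all but finitely many letters connects the two.\<close>

locale mps = prob_space M for M :: "'a measure" +
  fixes T :: "'a \<Rightarrow> 'a"
  assumes preserving: "measure_preserving M T"
begin

lemma measurable_T [measurable]: "T \<in> measurable M M"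
  using preserving by (simp add: measure_preserving_def)

lemma distr_T: "distr M M T = M"
  using preserving by (simp add: measure_preserving_def)

lemma measurable_iterate [measurable]: "T ^^ n \<in> measurable M M"
  by (induction n) (auto intro: measurable_comp measurable_T simp: id_def)

lemma iterate_space [simp]: "x \<in> space M \<Longrightarrow> (T ^^ n) x \<in> space M"
  using measurable_space[OF measurable_iterate] .

lemma distr_iterate: "distr M M (T ^^ n) = M"
proof (induction n)
  case 0
  show ?case by (simp add: id_def)
next
  case (Suc n)
  have "distr M M (T ^^ Suc n) = distr (distr M M (T ^^ n)) M T"
    by (subst distr_distr) (auto simp del: funpow.simps simp: funpow.simps(2))
  then show ?case unfolding Suc distr_T .
qed

lemma mps_iterate: "mps M (T ^^ n)"
  by unfold_locales (auto simp: measure_preserving_def distr_iterate)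

lemma measure_vimage:
  assumes "A \<in> sets M" shows "measure M ((T ^^ n) -` A \<inter> space M) = measure M A"
  using measure_distr[OF measurable_iterate assms, of n] by (simp add: distr_iterate)

lemma AE_iterate:
  assumes "AE x in M. Q x" shows "AE x in M. Q ((T ^^ n) x)"
proof -
  have "AE x in distr M M (T ^^ n). Q x" unfolding distr_iterate by (rule assms)
  then show ?thesis by (rule AE_distrD[OF measurable_iterate])
qed

lemma integrable_iterate:
  fixes f :: "'a \<Rightarrow> real"
  assumes "integrable M f" shows "integrable M (\<lambda>x. f ((T ^^ n) x))"
  by (rule integrable_distr[OF measurable_iterate]) (simp add: distr_iterate assms)

lemma integral_iterate:
  fixes f :: "'a \<Rightarrow> real"
  assumes "integrable M f" shows "(\<integral>x. f ((T ^^ n) x) \<partial>M) = integral\<^sup>L M f"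
  using integral_distr[OF measurable_iterate[of n], of f] borel_measurable_integrable[OF assms]
  by (simp add: distr_iterate)

lemma integral_T: "integrable M (f :: 'a \<Rightarrow> real) \<Longrightarrow> (\<integral>x. f (T x) \<partial>M) = integral\<^sup>L M f"
  using integral_iterate[of f 1] by simp

lemma integrable_T: "integrable M (f :: 'a \<Rightarrow> real) \<Longrightarrow> integrable M (\<lambda>x. f (T x))"
  using integrable_iterate[of f 1] by simp

end

locale ergodic_mps = mps +
  assumes ergodic: "A \<in> sets M \<Longrightarrow> T -` A \<inter> space M = A \<Longrightarrow> measure M A = 0 \<or> measure M A = 1"
begin

text \<open>The maximum of the first n + 1 nonempty partial sums along the orbit. In this recursive
  form \<open>run_max g (Suc n) x - max 0 (run_max g n (T x)) = g x\<close> holds by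
  definition.\<close>

fun run_max :: "('a \<Rightarrow> real) \<Rightarrow> nat \<Rightarrow> 'a \<Rightarrow> real" where
  "run_max g 0 x = g x"
| "run_max g (Suc n) x = g x + max 0 (run_max g n (T x))"

lemma sum_le_run_max: "(\<Sum>i\<le>n. g ((T ^^ i) x)) \<le> run_max g n x"
proof (induction n arbitrary: x)
  case (Suc n)
  have "(\<Sum>i\<le>Suc n. g ((T ^^ i) x)) = g x + (\<Sum>i\<le>n. g ((T ^^ i) (T x)))"
    by (subst sum.atMost_Suc_shift) (simp add: funpow_swap1)
  with Suc[of "T x"] show ?case by simp
qed simp

lemma run_max_Suc_ge: "run_max g n x \<le> run_max g (Suc n) x"
proof (induction n arbitrary: x)
  case (Suc n)
  show ?case using Suc[of "T x"] by simp
qed simp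

lemma integrable_run_max: "integrable M g \<Longrightarrow> integrable M (run_max g n)"
proof (induction n)
  case (Suc n)
  then have "integrable M (\<lambda>x. run_max g n (T x))" by (intro integrable_T) simp
  with Suc show ?case by simp
qed (simp add: run_max.simps(1)[abs_def])

text \<open>
  If the running maxima were unbounded almost surely, then \<open>run_max g (n + 1) - run_max g n \<circ> T\<close> would decrease
  to \<open>g\<close>, although its integral is nonnegative.
\<close>

lemma AE_sums_bounded:
  fixes g :: "'a \<Rightarrow> real"
  assumes g: "integrable M g" and neg: "integral\<^sup>L M g < 0"
  shows "AE x in M. \<exists>K. \<forall>n. (\<Sum>i<n. g ((T ^^ i) x)) \<le> K"
proof -
  let ?F = "run_max g"
  note intF = integrable_run_max[OF g]
  have [measurable]: "?F n \<in> borel_measurable M" for n using intF by auto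
  define A where "A = {x \<in> space M. \<forall>K::nat. \<exists>n. ?F n x > K}"
  have A[measurable]: "A \<in> sets M" unfolding A_def by measurable
  have mono: "m \<le> n \<Longrightarrow> ?F m x \<le> ?F n x" for m n x
    using lift_Suc_mono_le[of "\<lambda>n. ?F n x"] run_max_Suc_ge by blast
  have bdd: "(\<exists>K::nat. \<forall>n. ?F n x \<le> K) \<longleftrightarrow> (\<exists>K::nat. \<forall>n. ?F n (T x) \<le> K)" for x
  proof
    assume "\<exists>K::nat. \<forall>n. ?F n x \<le> K"
    then obtain K :: nat where K: "\<And>n. ?F n x \<le> K" by blast
    obtain K' :: nat where K': "K - g x \<le> K'" using real_arch_simple by blast
    have "?F n (T x) \<le> K'" for n using K[of "Suc n"] K' by simp
    then show "\<exists>K::nat. \<forall>n. ?F n (T x) \<le> K" by blast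
  next
    assume "\<exists>K::nat. \<forall>n. ?F n (T x) \<le> K"
    then obtain K :: nat where K: "\<And>n. ?F n (T x) \<le> K" by blast
    obtain K' :: nat where K': "g x + K \<le> K'" using real_arch_simple by blast
    have "?F n x \<le> K'" for n
    proof -
      have "?F n x \<le> ?F (Suc n) x" by (rule run_max_Suc_ge)
      also have "\<dots> \<le> K'" using K[of n] K' by simp
      finally show ?thesis .
    qed
    then show "\<exists>K::nat. \<forall>n. ?F n x \<le> K" by blast
  qed
  have A_alt: "A = {x \<in> space M. \<not> (\<exists>K::nat. \<forall>n. ?F n x \<le> K)}"
    by (auto simp: A_def not_le)
  have "T -` A \<inter> space M = A"
  proof (rule set_eqI)
    fix x
    show "x \<in> T -` A \<inter> space M \<longleftrightarrow> x \<in> A"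
      using measurable_space[OF measurable_T, of x] bdd[of x] unfolding A_alt by blast
  qed
  then have A01: "measure M A = 0 \<or> measure M A = 1" using A ergodic by blast
  have "measure M A \<noteq> 1"
  proof
    assume "measure M A = 1"
    then have AEA: "AE x in M. x \<in> A" using A by (simp add: prob_eq_1)
    have max_int: "integrable M (\<lambda>x. max 0 (?F n x))" for n
      by (intro integrable_max intF) simp
    have max_int': "integrable M (\<lambda>x. max 0 (- ?F n x))" for n
      using intF by (intro integrable_max) auto
    \<comment> \<open>Integrate \<open>run_max g n \<le> run_max g (Suc n)\<close>. Invariance
      removes \<open>T\<close>, and writing \<open>max 0 F = F + max 0 (- F)\<close> lets the
      integral of \<open>F\<close> cancel.\<close>
    have ge: "0 \<le> integral\<^sup>L M g + (\<integral>x. max 0 (- ?F n x) \<partial>M)" for n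
    proof -
      have "integral\<^sup>L M (?F n) \<le> integral\<^sup>L M (?F (Suc n))"
        by (intro integral_mono intF run_max_Suc_ge)
      also have "\<dots> = (\<integral>x. g x + max 0 (?F n (T x)) \<partial>M)"
        by (simp add: run_max.simps(2)[abs_def])
      also have "\<dots> = integral\<^sup>L M g + (\<integral>x. max 0 (?F n (T x)) \<partial>M)"
        by (intro Bochner_Integration.integral_add g integrable_T[OF max_int])
      also have "(\<integral>x. max 0 (?F n (T x)) \<partial>M) = (\<integral>x. max 0 (?F n x) \<partial>M)"
        by (rule integral_T[OF max_int])
      also have "(\<integral>x. max 0 (?F n x) \<partial>M) = (\<integral>x. ?F n x + max 0 (- ?F n x) \<partial>M)"
        by (intro Bochner_Integration.integral_cong) auto
      also have "\<dots> = integral\<^sup>L M (?F n) + (\<integral>x. max 0 (- ?F n x) \<partial>M)"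
        by (intro Bochner_Integration.integral_add intF max_int')
      finally show ?thesis by simp
    qed
    have "(\<lambda>n. \<integral>x. max 0 (- ?F n x) \<partial>M) \<longlonglongrightarrow> (\<integral>x. 0 \<partial>M)"
    proof (rule integral_dominated_convergence)
      \<comment> \<open>This function dominates because \<open>run_max g n\<close> is at least
        \<open>run_max g 0 = g\<close>.\<close>
      show "integrable M (\<lambda>x. \<bar>g x\<bar>)" using g by simp
      show "AE x in M. (\<lambda>n. max 0 (- ?F n x)) \<longlonglongrightarrow> 0"
        using AEA
      proof eventually_elim
        case (elim x)
        then obtain N where "?F N x > real 0" unfolding A_def by blast
        then have "max 0 (- ?F n x) = 0" if "n \<ge> N" for n
          using mono[OF that, of x] by simp
        then show ?case
          by (intro tendsto_eventually) (auto simp: eventually_sequentially)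
      qed
      show "AE x in M. norm (max 0 (- ?F n x)) \<le> \<bar>g x\<bar>" for n
        using mono[of 0 n] by (intro AE_I2) (auto simp: max_def, smt (verit))
    qed auto
    then have "(\<lambda>n. integral\<^sup>L M g + (\<integral>x. max 0 (- ?F n x) \<partial>M)) \<longlonglongrightarrow> integral\<^sup>L M g + 0"
      by (intro tendsto_add) auto
    then have "0 \<le> integral\<^sup>L M g + 0" using ge by (intro LIMSEQ_le_const) auto
    with neg show False by simp
  qed
  with A01 have "AE x in M. x \<notin> A" using A by (simp add: prob_eq_0)
  then show ?thesis
    using AE_space
  proof eventually_elim
    case (elim x)
    then obtain K :: nat where K: "\<And>n. ?F n x \<le> K"
      unfolding A_def by (auto simp: not_less)
    have "(\<Sum>i<n. g ((T ^^ i) x)) \<le> K" for n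
    proof (cases n)
      case (Suc m)
      then show ?thesis using sum_le_run_max[of g x m] K[of m]
        by (simp add: lessThan_Suc_atMost)
    qed simp
    then show ?case by blast
  qed
qed

text \<open>Lowering \<open>f\<close> by its mean plus \<open>e / 2\<close> makes the integral
  negative, and the constant that then bounds the sums is eventually below
  \<open>n * (e / 2)\<close>.\<close>

lemma birkhoff_upper:
  fixes f :: "'a \<Rightarrow> real" and e :: real
  assumes f: "integrable M f" and e: "e > 0"
  shows "AE x in M. eventually (\<lambda>n. (\<Sum>i<n. f ((T ^^ i) x)) \<le> n * (integral\<^sup>L M f + e)) sequentially"
proof -
  let ?g = "\<lambda>x. f x - (integral\<^sup>L M f + e / 2)"
  have "AE x in M. \<exists>K. \<forall>n. (\<Sum>i<n. ?g ((T ^^ i) x)) \<le> K"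
    by (rule AE_sums_bounded) (use f e in \<open>auto simp: prob_space\<close>)
  then show ?thesis
  proof eventually_elim
    case (elim x)
    then obtain K where K: "\<And>n. (\<Sum>i<n. ?g ((T ^^ i) x)) \<le> K" by blast
    obtain N :: nat where N: "K / (e/2) \<le> N" using real_arch_simple by blast
    have "(\<Sum>i<n. f ((T ^^ i) x)) \<le> n * (integral\<^sup>L M f + e)" if "n \<ge> N" for n
    proof -
      have "K \<le> N * (e/2)" using N e by (simp add: field_simps)
      also have "\<dots> \<le> n * (e/2)" using that e by (intro mult_right_mono) auto
      finally have "K \<le> n * (e/2)" .
      with K[of n] show ?thesis by (simp add: sum_subtractf algebra_simps)
    qed
    then show ?case by (auto simp: eventually_sequentially)
  qed
qed

lemma birkhoff:
  fixes f :: "'a \<Rightarrow> real" and e :: real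
  assumes f: "integrable M f" and e: "e > 0"
  shows "AE x in M. eventually (\<lambda>n. \<bar>(\<Sum>i<n. f ((T ^^ i) x)) - n * integral\<^sup>L M f\<bar> \<le> n * e) sequentially"
proof -
  have "AE x in M. eventually (\<lambda>n. (\<Sum>i<n. - f ((T ^^ i) x)) \<le> n * ((\<integral>x. - f x \<partial>M) + e)) sequentially"
    using f by (intro birkhoff_upper e) simp
  with birkhoff_upper[OF f e] show ?thesis
  proof eventually_elim
    case (elim x)
    from elim(1,2) show ?case
      by eventually_elim (simp add: sum_negf algebra_simps abs_le_iff)
  qed
qed

end


subsection \<open>Information and Gibbs inequality\<close>

text \<open>The information function of the partition into level sets of \<open>X\<close>; its
  integral is the Shannon entropy of \<open>X\<close>, also for countably many values.\<close>

definition info :: "'a measure \<Rightarrow> ('a \<Rightarrow> 'b) \<Rightarrow> 'a \<Rightarrow> real" where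
  "info M X x = - ln (measure M (X -` {X x} \<inter> space M))"


lemma measurable_countable2:
  fixes X :: "'a \<Rightarrow> 'b::countable" and Y :: "'a \<Rightarrow> 'c::countable"
  assumes X: "X \<in> measurable M (count_space UNIV)" and Y: "Y \<in> measurable M (count_space UNIV)"
    and f: "\<And>b c. f b c \<in> space N"
  shows "(\<lambda>x. f (X x) (Y x)) \<in> measurable M N"
  by (rule measurable_compose_countable[OF measurable_compose_countable[OF _ Y] X])
     (use f in auto)

context prob_space
begin

context
  fixes X :: "'a \<Rightarrow> 'b::countable"
  assumes X[measurable]: "X \<in> measurable M (count_space UNIV)"
begin

lemma cell_sets [measurable]: "X -` B \<inter> space M \<in> sets M"
  by (rule measurable_sets[OF X]) simp

lemma info_nonneg: "0 \<le> info M X x"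
  unfolding info_def using measure_nonneg[of M "X -` {X x} \<inter> space M"] prob_le_1[of "X -` {X x} \<inter> space M"]
  by (cases "measure M (X -` {X x} \<inter> space M) = 0") (auto simp: zero_less_measure_iff)

lemma measurable_info [measurable]: "info M X \<in> borel_measurable M"
proof -
  have "(\<lambda>x. (\<lambda>b. - ln (measure M (X -` {b} \<inter> space M))) (X x)) \<in> borel_measurable M"
    by (rule measurable_compose[OF X]) simp
  then show ?thesis by (simp add: info_def[abs_def])
qed

lemma AE_cell_pos: "AE x in M. 0 < measure M (X -` {X x} \<inter> space M)"
proof -
  have "AE x in M. X x = b \<longrightarrow> 0 < measure M (X -` {b} \<inter> space M)" for b
  proof (cases "measure M (X -` {b} \<inter> space M) = 0")
    case True
    then have "AE x in M. x \<notin> X -` {b} \<inter> space M" by (simp add: prob_eq_0)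
    then show ?thesis using AE_space by eventually_elim auto
  next
    case False
    then show ?thesis by (intro AE_I2) (simp add: zero_less_measure_iff)
  qed
  then have "AE x in M. \<forall>b. X x = b \<longrightarrow> 0 < measure M (X -` {b} \<inter> space M)"
    by (subst AE_all_countable) auto
  then show ?thesis by eventually_elim auto
qed

lemma sum_cells: "(\<integral>\<^sup>+b. ennreal (measure M (X -` {b} \<inter> space M)) \<partial>count_space UNIV) = 1"
proof -
  have "(\<integral>\<^sup>+b. emeasure M (X -` {b} \<inter> space M) \<partial>count_space UNIV) = emeasure M (\<Union>b. X -` {b} \<inter> space M)"
    by (rule emeasure_UN_countable[symmetric]) (auto simp: disjoint_family_on_def)
  also have "(\<Union>b. X -` {b} \<inter> space M) = space M" by auto
  finally show ?thesis by (simp add: emeasure_eq_measure prob_space)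
qed

text \<open>Integrating \<open>q b / p b\<close> over a cell of measure \<open>p b\<close> returns
  \<open>q b\<close>, but a null cell contributes 0 whatever \<open>q\<close> is there; hence only
  an inequality.\<close>

lemma nn_integral_density_le:
  "(\<integral>\<^sup>+x. q (X x) / ennreal (measure M (X -` {X x} \<inter> space M)) \<partial>M) \<le> (\<integral>\<^sup>+b. q b \<partial>count_space UNIV)"
proof -
  let ?p = "\<lambda>b. ennreal (measure M (X -` {b} \<inter> space M))"
  have "(\<integral>\<^sup>+x. q (X x) / ?p (X x) \<partial>M)
      = (\<integral>\<^sup>+x. (\<integral>\<^sup>+b. (q b / ?p b) * indicator (X -` {b} \<inter> space M) x \<partial>count_space UNIV) \<partial>M)"
  proof (rule nn_integral_cong)
    fix x assume "x \<in> space M"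
    then have "(\<integral>\<^sup>+b. (q b / ?p b) * indicator (X -` {b} \<inter> space M) x \<partial>count_space UNIV)
      = (\<integral>\<^sup>+b. (q b / ?p b) * indicator {X x} b \<partial>count_space UNIV)"
      by (intro nn_integral_cong) (auto simp: indicator_def)
    then show "q (X x) / ?p (X x) = (\<integral>\<^sup>+b. (q b / ?p b) * indicator (X -` {b} \<inter> space M) x \<partial>count_space UNIV)"
      by simp
  qed
  also have "\<dots> = (\<integral>\<^sup>+b. (\<integral>\<^sup>+x. (q b / ?p b) * indicator (X -` {b} \<inter> space M) x \<partial>M) \<partial>count_space UNIV)"
    by (rule nn_integral_count_space_nn_integral) auto
  also have "\<dots> = (\<integral>\<^sup>+b. (q b / ?p b) * ?p b \<partial>count_space UNIV)"
    by (intro nn_integral_cong, subst nn_integral_cmult_indicator) (auto simp: emeasure_eq_measure)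
  also have "\<dots> \<le> (\<integral>\<^sup>+b. q b \<partial>count_space UNIV)"
  proof (rule nn_integral_mono)
    fix b
    show "(q b / ?p b) * ?p b \<le> q b"
      by (cases "?p b = 0") (simp_all add: ennreal_divide_times)
  qed
  finally show ?thesis .
qed

text \<open>Apply \<open>ln r \<le> r - 1\<close> to the likelihood ratio r = q / p, whose integral
  is at most 1. The same estimate traps the information between 0 and \<open>- ln q + r - 1\<close>,
  so its integrability is a conclusion, not an assumption.\<close>

lemma gibbs:
  fixes q :: "'b \<Rightarrow> real"
  assumes sum: "(\<integral>\<^sup>+b. ennreal (q b) \<partial>count_space UNIV) \<le> 1"
    and pos: "AE x in M. 0 < q (X x)"
    and int: "integrable M (\<lambda>x. ln (q (X x)))"
  shows "integrable M (info M X)" "integral\<^sup>L M (info M X) \<le> (\<integral>x. - ln (q (X x)) \<partial>M)"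
proof -
  let ?p = "\<lambda>x. measure M (X -` {X x} \<inter> space M)"
  define r where "r x = q (X x) / ?p x" for x
  have [measurable]: "r \<in> borel_measurable M"
    using measurable_compose[OF X, of "\<lambda>b. q b / measure M (X -` {b} \<inter> space M)"] by (simp add: r_def[abs_def])
  have r0: "AE x in M. 0 < r x"
    using pos AE_cell_pos by eventually_elim (simp add: r_def)
  have "(\<integral>\<^sup>+x. ennreal (r x) \<partial>M) = (\<integral>\<^sup>+x. ennreal (q (X x)) / ennreal (?p x) \<partial>M)"
    using pos AE_cell_pos
    by (intro nn_integral_cong_AE, eventually_elim) (simp add: r_def divide_ennreal)
  also have "\<dots> \<le> 1" using nn_integral_density_le[of "\<lambda>b. ennreal (q b)"] sum by simp
  finally have r1: "(\<integral>\<^sup>+x. ennreal (r x) \<partial>M) \<le> 1" .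
  have intr: "integrable M r"
    using r0 r1 by (intro integrableI_nonneg) (auto elim!: eventually_mono intro: order.strict_implies_order le_less_trans)
  have "integral\<^sup>L M r \<le> 1"
    using r0 r1 by (subst integral_eq_nn_integral) (auto elim!: eventually_mono simp: enn2real_leI)
  have le: "AE x in M. info M X x \<le> - ln (q (X x)) + r x - 1"
    using pos AE_cell_pos r0
  proof eventually_elim
    case (elim x)
    then have "ln (r x) = ln (q (X x)) - ln (?p x)" by (simp add: r_def ln_div)
    with ln_le_minus_one[OF elim(3)] show ?case by (simp add: info_def)
  qed
  have int': "integrable M (\<lambda>x. - ln (q (X x)) + r x - 1)" using int intr by simp
  show I: "integrable M (info M X)"
    by (rule Bochner_Integration.integrable_bound[OF int'])
       (use le info_nonneg in \<open>auto elim!: eventually_mono\<close>)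
  have "integral\<^sup>L M (info M X) \<le> (\<integral>x. - ln (q (X x)) + r x - 1 \<partial>M)"
    by (rule integral_mono_AE[OF I int' le])
  also have "\<dots> = (\<integral>x. - ln (q (X x)) \<partial>M) + integral\<^sup>L M r - 1"
    using int intr by (simp add: prob_space)
  finally show "integral\<^sup>L M (info M X) \<le> (\<integral>x. - ln (q (X x)) \<partial>M)"
    using \<open>integral\<^sup>L M r \<le> 1\<close> by simp
qed

lemma info_mono:
  assumes "X' \<in> measurable M (count_space UNIV)" "\<And>x. x \<in> space M \<Longrightarrow> X' x = \<phi> (X x)"
  shows "AE x in M. info M X' x \<le> info M X x"
  using AE_cell_pos AE_space
proof eventually_elim
  case (elim x)
  have "measure M (X -` {X x} \<inter> space M) \<le> measure M (X' -` {X' x} \<inter> space M)"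
    using assms elim by (intro finite_measure_mono) (auto intro!: measurable_sets[OF assms(1)])
  with elim show ?case by (simp add: info_def)
qed

end

text \<open>
  Replaces the chain rule \<open>H(Y, Z) = H(Y) + H(Z | Y)\<close>: any sub-stochastic kernel \<open>k\<close> may stand in for the
  conditional distribution.
\<close>

lemma chain:
  fixes Y :: "'a \<Rightarrow> 'b::countable" and Z :: "'a \<Rightarrow> 'c::countable" and k :: "'b \<Rightarrow> 'c \<Rightarrow> real"
  assumes Y[measurable]: "Y \<in> measurable M (count_space UNIV)"
    and Z[measurable]: "Z \<in> measurable M (count_space UNIV)"
    and sum: "\<And>y. (\<integral>\<^sup>+z. ennreal (k y z) \<partial>count_space UNIV) \<le> 1"
    and pos: "AE x in M. 0 < k (Y x) (Z x)"
    and intk: "integrable M (\<lambda>x. ln (k (Y x) (Z x)))" and intY: "integrable M (info M Y)"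
  shows "integrable M (info M (\<lambda>x. (Y x, Z x)))"
    "integral\<^sup>L M (info M (\<lambda>x. (Y x, Z x))) \<le> integral\<^sup>L M (info M Y) + (\<integral>x. - ln (k (Y x) (Z x)) \<partial>M)"
proof -
  let ?p = "\<lambda>y. measure M (Y -` {y} \<inter> space M)"
  let ?q = "\<lambda>(y, z). ?p y * k y z"
  have YZ: "(\<lambda>x. (Y x, Z x)) \<in> measurable M (count_space UNIV)"
    by (rule measurable_countable2[OF Y Z]) simp
  have "(\<integral>\<^sup>+b. ennreal (?q b) \<partial>count_space UNIV)
      = (\<integral>\<^sup>+y. \<integral>\<^sup>+z. ennreal (?p y) * ennreal (k y z) \<partial>count_space UNIV \<partial>count_space UNIV)"
    by (subst nn_integral_fst_count_space[symmetric]) (simp add: ennreal_mult')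
  also have "\<dots> = (\<integral>\<^sup>+y. ennreal (?p y) * (\<integral>\<^sup>+z. ennreal (k y z) \<partial>count_space UNIV) \<partial>count_space UNIV)"
    by (simp add: nn_integral_cmult)
  also have "\<dots> \<le> (\<integral>\<^sup>+y. ennreal (?p y) * 1 \<partial>count_space UNIV)"
    by (intro nn_integral_mono mult_left_mono sum) auto
  also have "\<dots> = 1" using sum_cells[OF Y] by simp
  finally have q1: "(\<integral>\<^sup>+b. ennreal (?q b) \<partial>count_space UNIV) \<le> 1" .
  have qpos: "AE x in M. 0 < ?q (Y x, Z x)"
    using AE_cell_pos[OF Y] pos by eventually_elim simp
  have eq: "AE x in M. ln (?q (Y x, Z x)) = ln (k (Y x) (Z x)) - info M Y x"
    using AE_cell_pos[OF Y] pos by eventually_elim (simp add: info_def ln_mult)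
  have [measurable]: "(\<lambda>x. ln (?q (Y x, Z x))) \<in> borel_measurable M"
    using measurable_compose[OF YZ, of "\<lambda>b. ln (?q b)"] by simp
  have int: "integrable M (\<lambda>x. ln (?q (Y x, Z x)))"
    by (rule integrable_cong_AE_imp[OF Bochner_Integration.integrable_diff[OF intk intY]])
       (use eq in \<open>auto elim!: eventually_mono\<close>)
  have "(\<integral>x. ln (?q (Y x, Z x)) \<partial>M) = (\<integral>x. ln (k (Y x) (Z x)) - info M Y x \<partial>M)"
    by (rule integral_cong_AE) (use eq intk intY in auto)
  then have "(\<integral>x. - ln (?q (Y x, Z x)) \<partial>M) = integral\<^sup>L M (info M Y) + (\<integral>x. - ln (k (Y x) (Z x)) \<partial>M)"
    using intk intY by simp
  with gibbs[OF YZ q1 qpos int] show "integrable M (info M (\<lambda>x. (Y x, Z x)))"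
    "integral\<^sup>L M (info M (\<lambda>x. (Y x, Z x))) \<le> integral\<^sup>L M (info M Y) + (\<integral>x. - ln (k (Y x) (Z x)) \<partial>M)"
    by auto
qed

lemma info_cong:
  assumes "\<And>x y. x \<in> space M \<Longrightarrow> y \<in> space M \<Longrightarrow> X x = X y \<longleftrightarrow> X' x = X' y" "x \<in> space M"
  shows "info M X x = info M X' x"
proof -
  have "X -` {X x} \<inter> space M = X' -` {X' x} \<inter> space M" using assms by auto
  then show ?thesis by (simp add: info_def)
qed

end

section \<open>Words read along an orbit and their information\<close>

definition word :: "('a \<Rightarrow> 'a) \<Rightarrow> ('a \<Rightarrow> 'b) \<Rightarrow> nat \<Rightarrow> 'a \<Rightarrow> 'b list" where
  "word T g n x = map (\<lambda>i. g ((T ^^ i) x)) [0..<n]"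

lemma word_0 [simp]: "word T g 0 x = []"
  and word_Suc: "word T g (Suc n) x = word T g n x @ [g ((T ^^ n) x)]"
  and length_word [simp]: "length (word T g n x) = n"
  by (auto simp: word_def)

lemma word_add: "word T g (n + m) x = word T g n x @ word T g m ((T ^^ n) x)"
proof (induction m)
  case (Suc m)
  have "(T ^^ (n + m)) x = (T ^^ m) ((T ^^ n) x)"
    by (simp only: add.commute[of n] funpow_add comp_apply)
  with Suc show ?case by (simp add: word_Suc)
qed simp

context mps
begin

lemma measurable_word [measurable]:
  fixes g :: "'a \<Rightarrow> 'b::countable"
  assumes [measurable]: "g \<in> measurable M (count_space UNIV)"
  shows "word T g n \<in> measurable M (count_space UNIV)"
proof (induction n)
  case (Suc n)
  have "(\<lambda>x. g ((T ^^ n) x)) \<in> measurable M (count_space UNIV)" by measurable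
  from measurable_countable2[OF Suc this, of "\<lambda>w a. w @ [a]" "count_space UNIV"] show ?case
    by (simp add: word_Suc[abs_def])
qed (simp add: word_0[abs_def])

lemma info_iterate:
  fixes X :: "'a \<Rightarrow> 'b::countable"
  assumes X[measurable]: "X \<in> measurable M (count_space UNIV)" and x: "x \<in> space M"
  shows "info M (\<lambda>x. X ((T ^^ n) x)) x = info M X ((T ^^ n) x)"
proof -
  let ?b = "X ((T ^^ n) x)"
  have "(\<lambda>x. X ((T ^^ n) x)) -` {?b} \<inter> space M = (T ^^ n) -` (X -` {?b} \<inter> space M) \<inter> space M"
    by auto
  moreover have "X -` {?b} \<inter> space M \<in> sets M" by measurable
  ultimately show ?thesis using measure_vimage[of "X -` {?b} \<inter> space M" n] by (simp add: info_def)
qed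

text \<open>The n letters are appended one at a time. The letter at time i is predicted by the
  kernel from \<open>V\<close> at time i, which \<open>Y\<close> determines, and by invariance each
  prediction costs the same integral.\<close>

lemma chain_word:
  fixes Y :: "'a \<Rightarrow> 'b::countable" and V :: "'a \<Rightarrow> 'v::countable" and g :: "'a \<Rightarrow> 'c::countable"
    and k :: "'v \<Rightarrow> 'c \<Rightarrow> real"
  assumes Y[measurable]: "Y \<in> measurable M (count_space UNIV)"
    and V[measurable]: "V \<in> measurable M (count_space UNIV)"
    and g[measurable]: "g \<in> measurable M (count_space UNIV)"
    and V_Y: "\<And>i x. i < n \<Longrightarrow> V ((T ^^ i) x) = \<phi> i (Y x)"
    and sum: "\<And>v. (\<integral>\<^sup>+z. ennreal (k v z) \<partial>count_space UNIV) \<le> 1"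
    and pos: "AE x in M. 0 < k (V x) (g x)"
    and intk: "integrable M (\<lambda>x. ln (k (V x) (g x)))" and intY: "integrable M (info M Y)"
  shows "integrable M (info M (\<lambda>x. (Y x, word T g n x)))"
    "integral\<^sup>L M (info M (\<lambda>x. (Y x, word T g n x))) \<le>
       integral\<^sup>L M (info M Y) + n * (\<integral>x. - ln (k (V x) (g x)) \<partial>M)"
proof -
  have "integrable M (info M (\<lambda>x. (Y x, word T g m x))) \<and>
    integral\<^sup>L M (info M (\<lambda>x. (Y x, word T g m x))) \<le>
       integral\<^sup>L M (info M Y) + m * (\<integral>x. - ln (k (V x) (g x)) \<partial>M)" if "m \<le> n" for m
    using that
  proof (induction m)
    case 0
    have "info M (\<lambda>x. (Y x, word T g 0 x)) = info M Y"
      by (simp add: info_def[abs_def] vimage_def)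
    with intY show ?case by simp
  next
    case (Suc m)
    let ?Y = "\<lambda>x. (Y x, word T g m x)" and ?Z = "\<lambda>x. g ((T ^^ m) x)"
    let ?k = "\<lambda>y. k (\<phi> m (fst y))"
    have mY: "?Y \<in> measurable M (count_space UNIV)"
      by (rule measurable_countable2[OF Y measurable_word[OF g]]) simp
    have mZ: "?Z \<in> measurable M (count_space UNIV)" by measurable
    have keq: "?k (?Y x) (?Z x) = k (V ((T ^^ m) x)) (g ((T ^^ m) x))" for x
      using V_Y[of m x] Suc.prems by simp
    have "AE x in M. 0 < ?k (?Y x) (?Z x)"
      unfolding keq by (rule AE_iterate[OF pos])
    moreover have "integrable M (\<lambda>x. ln (?k (?Y x) (?Z x)))"
      unfolding keq by (rule integrable_iterate[OF intk])
    moreover have "(\<integral>x. - ln (?k (?Y x) (?Z x)) \<partial>M) = (\<integral>x. - ln (k (V x) (g x)) \<partial>M)"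
      unfolding keq using intk by (intro integral_iterate[of "\<lambda>x. - ln (k (V x) (g x))"]) simp
    ultimately have *: "integrable M (info M (\<lambda>x. (?Y x, ?Z x)))"
       "integral\<^sup>L M (info M (\<lambda>x. (?Y x, ?Z x)))
         \<le> integral\<^sup>L M (info M ?Y) + (\<integral>x. - ln (k (V x) (g x)) \<partial>M)"
      using chain[OF mY mZ, of ?k] sum Suc by auto
    have "info M (\<lambda>x. (Y x, word T g (Suc m) x)) = info M (\<lambda>x. (?Y x, ?Z x))"
      by (auto simp: info_def word_Suc vimage_def fun_eq_iff)
    then show ?case using * Suc by (simp add: algebra_simps)
  qed
  then show "integrable M (info M (\<lambda>x. (Y x, word T g n x)))"
    "integral\<^sup>L M (info M (\<lambda>x. (Y x, word T g n x))) \<le>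
       integral\<^sup>L M (info M Y) + n * (\<integral>x. - ln (k (V x) (g x)) \<partial>M)" by auto
qed

text \<open>The kernel handed to \<open>chain\<close> is the law of the second word, regardless of
  the first; by invariance its cost is the mean information of a word of length
  \<open>m\<close>.\<close>

lemma info_word_subadditive:
  fixes g :: "'a \<Rightarrow> 'b::countable"
  assumes g[measurable]: "g \<in> measurable M (count_space UNIV)"
    and n: "integrable M (info M (word T g n))" and m: "integrable M (info M (word T g m))"
  shows "integrable M (info M (word T g (n + m)))"
    "integral\<^sup>L M (info M (word T g (n + m))) \<le> integral\<^sup>L M (info M (word T g n)) + integral\<^sup>L M (info M (word T g m))"
proof -
  let ?Z = "\<lambda>x. word T g m ((T ^^ n) x)"
  let ?k = "\<lambda>z. measure M (?Z -` {z} \<inter> space M)"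
  have Z: "?Z \<in> measurable M (count_space UNIV)"
    by (rule measurable_compose[OF measurable_iterate measurable_word[OF g]])
  have ln: "ln (?k (?Z x)) = - info M ?Z x" for x by (simp add: info_def)
  have eq: "info M ?Z x = info M (word T g m) ((T ^^ n) x)" if "x \<in> space M" for x
    by (rule info_iterate[OF measurable_word[OF g] that])
  have "integrable M (info M ?Z) \<longleftrightarrow> integrable M (\<lambda>x. info M (word T g m) ((T ^^ n) x))"
    by (rule Bochner_Integration.integrable_cong[OF refl]) (rule eq)
  then have iZ: "integrable M (info M ?Z)" using integrable_iterate[OF m, of n] by (rule iffD2)
  have "integral\<^sup>L M (info M ?Z) = (\<integral>x. info M (word T g m) ((T ^^ n) x) \<partial>M)"
    by (rule Bochner_Integration.integral_cong[OF refl]) (rule eq)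
  then have eZ: "integral\<^sup>L M (info M ?Z) = integral\<^sup>L M (info M (word T g m))"
    using integral_iterate[OF m, of n] by (rule trans)
  have *: "info M (word T g (n + m)) = info M (\<lambda>x. (word T g n x, ?Z x))"
    by (auto simp: info_def word_add vimage_def fun_eq_iff)
  show "integrable M (info M (word T g (n + m)))"
    "integral\<^sup>L M (info M (word T g (n + m))) \<le> integral\<^sup>L M (info M (word T g n)) + integral\<^sup>L M (info M (word T g m))"
    using chain[OF measurable_word[OF g, of n] Z, of "\<lambda>_. ?k", unfolded ln] sum_cells[OF Z] AE_cell_pos[OF Z] n iZ
    unfolding * eZ[symmetric] by simp_all
qed

lemma integrable_info_word:
  fixes g :: "'a \<Rightarrow> 'b::countable"
  assumes g[measurable]: "g \<in> measurable M (count_space UNIV)" and int: "integrable M (info M g)"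
  shows "integrable M (info M (word T g n))"
proof (induction n)
  case 0
  have "info M (word T g 0) = (\<lambda>_. 0)" by (auto simp: info_def vimage_def prob_space)
  then show ?case by (simp only: integrable_zero)
next
  case (Suc n)
  have "info M (word T g 1) = info M g" by (auto simp: info_def vimage_def word_def)
  then show ?case using info_word_subadditive(1)[OF g Suc, of 1] int by simp
qed

end


subsection \<open>Entropy of finite partitions\<close>

lemma fekete:
  fixes a :: "nat \<Rightarrow> real"
  assumes sub: "\<And>m n. a (m + n) \<le> a m + a n" and nonneg: "\<And>n. 0 \<le> a n" and a0: "a 0 = 0"
  shows "convergent (\<lambda>n. a n / real n)"
proof -
  define S where "S = (\<lambda>n. a n / real n) ` {1..}"
  define L where "L = Inf S"
  have bdd: "bdd_below S" by (rule bdd_belowI[of _ 0]) (auto simp: S_def nonneg)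
  have ge: "L \<le> a n / real n" if "n \<ge> 1" for n
    unfolding L_def by (rule cInf_lower[OF _ bdd]) (use that in \<open>auto simp: S_def\<close>)
  have mult: "a (q * m) \<le> q * a m" for q m
  proof (induction q)
    case (Suc q)
    then show ?case using sub[of m "q * m"] by (simp add: algebra_simps)
  qed (simp add: a0)
  have "(\<lambda>n. a n / real n) \<longlonglongrightarrow> L"
  proof (rule LIMSEQ_I)
    fix e :: real assume e: "e > 0"
    have "S \<noteq> {}" by (auto simp: S_def)
    then have "\<exists>s\<in>S. s < L + e / 2" using e by (subst cInf_less_iff[symmetric, OF _ bdd]) (auto simp: L_def)
    then obtain m where m: "m \<ge> 1" "a m / real m < L + e / 2" by (auto simp: S_def)
    obtain N :: nat where N: "m * a 1 / (e / 2) < N" using reals_Archimedean2 by blast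
    have "norm (a n / real n - L) < e" if n: "n \<ge> max 1 N" for n
    proof -
      have n1: "n \<ge> 1" using n by simp
      have "a n \<le> a (n div m * m) + a (n mod m * 1)" using sub[of "n div m * m" "n mod m"] by simp
      also have "\<dots> \<le> (n div m) * a m + (n mod m) * a 1" using mult[of "n div m" m] mult[of "n mod m" 1] by simp
      also have "\<dots> \<le> (n div m * m) * (a m / m) + m * a 1"
        using m nonneg[of 1] nonneg[of "Suc 0"] by (intro add_mono mult_right_mono) (auto simp: less_imp_le)
      also have "\<dots> \<le> n * (a m / m) + m * a 1"
        using nonneg[of m] nonneg[of "Suc 0"] by (intro add_mono mult_right_mono) (auto simp del: of_nat_mult)
      also have "\<dots> < n * (L + e / 2) + n * (e / 2)"
      proof (rule add_less_le_mono)
        show "n * (a m / m) < n * (L + e / 2)" using m n1 by (intro mult_strict_left_mono) auto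
        have "m * a 1 \<le> N * (e / 2)" using N e by (simp add: field_simps)
        also have "\<dots> \<le> n * (e / 2)" using n e by (intro mult_right_mono) auto
        finally show "m * a 1 \<le> n * (e / 2)" .
      qed
      finally have "a n / n < L + e" using n1 by (simp add: field_simps)
      with ge[OF n1] show ?thesis by simp
    qed
    then show "\<exists>no. \<forall>n\<ge>no. norm (a n / real n - L) < e" by blast
  qed
  then show ?thesis by (rule convergentI)
qed

text \<open>Only values that occur are used, so no cell is empty, as \<open>partition_on\<close>
  demands.\<close>

definition cells :: "'a measure \<Rightarrow> ('a \<Rightarrow> 'b) \<Rightarrow> 'a set set" where
  "cells M X = (\<lambda>b. X -` {b} \<inter> space M) ` X ` space M"

lemma (in prob_space) partition_entropy_cells:
  fixes X :: "'a \<Rightarrow> 'b::countable"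
  assumes X[measurable]: "X \<in> measurable M (count_space UNIV)" and fin: "finite (X ` space M)"
  shows "partition_entropy M (cells M X) = integral\<^sup>L M (info M X)" "integrable M (info M X)"
proof -
  let ?C = "\<lambda>b. X -` {b} \<inter> space M"
  let ?B = "X ` space M"
  have eq: "info M X x = (\<Sum>b\<in>?B. - ln (measure M (?C b)) * indicator (?C b) x)" if "x \<in> space M" for x
  proof -
    have "(\<Sum>b\<in>?B. - ln (measure M (?C b)) * indicator (?C b) x)
        = (\<Sum>b\<in>?B. if b = X x then - ln (measure M (?C b)) else 0)"
      by (rule sum.cong) (use that in \<open>auto simp: indicator_def\<close>)
    also have "\<dots> = info M X x" using fin that by (simp add: info_def)
    finally show ?thesis by simp
  qed
  have ind: "integrable M (indicator (?C b) :: 'a \<Rightarrow> real)" for b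
    by (rule integrable_real_indicator[OF cell_sets[OF X]]) (simp add: emeasure_eq_measure)
  have int: "integrable M (\<lambda>x. - ln (measure M (?C b)) * indicator (?C b) x :: real)" for b
    by (intro integrable_mult_right ind)
  have "integrable M (info M X) \<longleftrightarrow> integrable M (\<lambda>x. (\<Sum>b\<in>?B. - ln (measure M (?C b)) * indicator (?C b) x))"
    by (rule Bochner_Integration.integrable_cong[OF refl eq])
  then show "integrable M (info M X)"
    by (rule iffD2) (rule Bochner_Integration.integrable_sum[OF int])
  have "integral\<^sup>L M (info M X) = (\<integral>x. (\<Sum>b\<in>?B. - ln (measure M (?C b)) * indicator (?C b) x) \<partial>M)"
    by (rule Bochner_Integration.integral_cong[OF refl eq])
  also have "\<dots> = (\<Sum>b\<in>?B. \<integral>x. - ln (measure M (?C b)) * indicator (?C b) x \<partial>M)"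
    using int by (intro Bochner_Integration.integral_sum) auto
  also have "\<dots> = (\<Sum>b\<in>?B. - ln (measure M (?C b)) * measure M (?C b))"
    by (intro sum.cong refl, subst Bochner_Integration.integral_mult_right) (auto intro!: ind)
  also have "\<dots> = partition_entropy M (cells M X)"
    unfolding partition_entropy_def cells_def
    by (subst sum.reindex) (auto simp: inj_on_def sum_negf mult.commute)
  finally show "partition_entropy M (cells M X) = integral\<^sup>L M (info M X)" ..
qed

context mps
begin

text \<open>A point of a nonempty member of the join supplies the word that names this member;
  discarding the empty set corresponds to keeping only words that occur.\<close>

lemma iterated_join_cells: "iterated_join M T (cells M g) n = cells M (word T g n)"
proof -
  have w: "word T g n x = word T g n y \<longleftrightarrow> (\<forall>i<n. g ((T ^^ i) x) = g ((T ^^ i) y))" for x y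
    by (auto simp: word_def)
  show ?thesis
  proof (intro set_eqI iffI)
    fix A assume "A \<in> iterated_join M T (cells M g) n"
    then obtain C x0 where C: "\<And>i. i < n \<Longrightarrow> C i \<in> cells M g"
      and A: "A = {x \<in> space M. \<forall>i<n. (T ^^ i) x \<in> C i}" and x0: "x0 \<in> A"
      by (auto simp: iterated_join_def)
    have C_iff: "(T ^^ i) x \<in> C i \<longleftrightarrow> g ((T ^^ i) x) = g ((T ^^ i) x0)" if i: "i < n" and x: "x \<in> space M" for i x
    proof -
      obtain b where b: "C i = g -` {b} \<inter> space M" using C[OF i] by (auto simp: cells_def)
      have "(T ^^ i) x0 \<in> C i" using x0 i unfolding A by blast
      then show ?thesis using iterate_space[OF x, of i] unfolding b by (simp add: eq_commute)
    qed
    have "A = word T g n -` {word T g n x0} \<inter> space M"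
    proof (intro set_eqI)
      fix x
      show "x \<in> A \<longleftrightarrow> x \<in> word T g n -` {word T g n x0} \<inter> space M"
        unfolding A vimage_def Int_iff mem_Collect_eq singleton_iff w using C_iff by blast
    qed
    moreover have "x0 \<in> space M" using x0 by (simp add: A)
    ultimately show "A \<in> cells M (word T g n)" by (auto simp: cells_def)
  next
    fix A assume "A \<in> cells M (word T g n)"
    then obtain x0 where x0: "x0 \<in> space M" and A: "A = word T g n -` {word T g n x0} \<inter> space M"
      by (auto simp: cells_def)
    have "A = {x \<in> space M. \<forall>i<n. (T ^^ i) x \<in> g -` {g ((T ^^ i) x0)} \<inter> space M}"
      unfolding A vimage_def Int_iff mem_Collect_eq singleton_iff w using iterate_space by blast
    moreover have "x0 \<in> A" using x0 by (simp add: A)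
    moreover have "\<forall>i<n. g -` {g ((T ^^ i) x0)} \<inter> space M \<in> cells M g"
      using x0 by (auto simp: cells_def)
    ultimately show "A \<in> iterated_join M T (cells M g) n"
      unfolding iterated_join_def Diff_iff mem_Collect_eq singleton_iff
      by (intro conjI exI[of _ "\<lambda>i. g -` {g ((T ^^ i) x0)} \<inter> space M"]) blast+
  qed
qed

lemma finite_word_range:
  assumes "finite (g ` space M)" shows "finite (word T g n ` space M)"
proof (rule finite_subset)
  show "word T g n ` space M \<subseteq> {w. set w \<subseteq> g ` space M \<and> length w = n}"
    by (auto simp: word_def)
qed (use assms in \<open>rule finite_lists_length_eq\<close>)

text \<open>Subadditivity and Fekete's lemma turn the \<open>lim\<close> of the definition into a
  genuine limit.\<close>

lemma entropy_wrt_cells: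
  fixes g :: "'a \<Rightarrow> 'b::countable"
  assumes g[measurable]: "g \<in> measurable M (count_space UNIV)" and fin: "finite (g ` space M)"
  shows "(\<lambda>n. integral\<^sup>L M (info M (word T g n)) / real n) \<longlonglongrightarrow> entropy_wrt M T (cells M g)"
proof -
  let ?H = "\<lambda>n. integral\<^sup>L M (info M (word T g n))"
  note fw = finite_word_range[OF fin]
  note pe = partition_entropy_cells[OF measurable_word[OF g] fw]
  have "info M (word T g 0) = (\<lambda>_. 0)" by (auto simp: info_def vimage_def prob_space)
  then have "?H 0 = 0" by simp
  moreover have "0 \<le> ?H n" for n
    by (rule Bochner_Integration.integral_nonneg) (rule info_nonneg[OF measurable_word[OF g]])
  ultimately have "convergent (\<lambda>n. ?H n / real n)"
    using info_word_subadditive(2)[OF g pe(2) pe(2)] by (intro fekete) auto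
  then show ?thesis
    by (simp add: entropy_wrt_def iterated_join_cells pe(1) convergent_LIMSEQ_iff)
qed

lemma partition_eq_cells:
  assumes part: "partition_on (space M) \<xi>" and fin: "finite \<xi>" and sets: "\<xi> \<subseteq> sets M"
  obtains g :: "'a \<Rightarrow> nat" where "g \<in> measurable M (count_space UNIV)" "\<And>x. g x < card \<xi>" "cells M g = \<xi>"
proof -
  obtain f where f: "bij_betw f \<xi> {..<card \<xi>}"
    using ex_bij_betw_finite_nat[OF fin] by (auto simp: atLeast0LessThan)
  obtain x0 where x0: "x0 \<in> space M" using not_empty by blast
  have ex1: "\<exists>!A. A \<in> \<xi> \<and> x \<in> A" if "x \<in> space M" for x
    using part that unfolding partition_on_def disjoint_def by auto
  define c where "c x = (THE A. A \<in> \<xi> \<and> x \<in> A)" for x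
  have c: "c x \<in> \<xi>" "x \<in> c x" if "x \<in> space M" for x
    using theI'[OF ex1[OF that]] by (auto simp: c_def)
  have c_eq: "c x = A" if "A \<in> \<xi>" "x \<in> A" for x A
  proof -
    have "x \<in> space M" using that part by (auto simp: partition_on_def)
    then show ?thesis using c[of x] that ex1[of x] by blast
  qed
  \<comment> \<open>Off the space the value at \<open>x0\<close> is taken, so that
    \<open>g x < card \<xi>\<close> holds for every \<open>x\<close>.\<close>
  define g where "g x = f (c (if x \<in> space M then x else x0))" for x
  have cell: "g -` {f A} \<inter> space M = A" if "A \<in> \<xi>" for A
  proof -
    have "A \<subseteq> space M" using that part by (auto simp: partition_on_def)
    moreover have "f (c x) = f A \<longleftrightarrow> x \<in> A" if "x \<in> space M" for x
      using f c[OF that] \<open>A \<in> \<xi>\<close> c_eq[of A x] by (auto simp: bij_betw_def inj_on_eq_iff)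
    ultimately show ?thesis by (auto simp: g_def)
  qed
  have lt: "g x < card \<xi>" for x
    using f c x0 by (auto simp: g_def bij_betw_def)
  have "g \<in> measurable M (count_space UNIV)"
  proof (rule measurableI)
    fix B :: "nat set"
    have "g -` B \<inter> space M = (\<Union>A\<in>{A\<in>\<xi>. f A \<in> B}. A)"
    proof (intro set_eqI iffI)
      fix x assume "x \<in> g -` B \<inter> space M"
      then show "x \<in> (\<Union>A\<in>{A\<in>\<xi>. f A \<in> B}. A)" using c[of x] by (auto simp: g_def)
    next
      fix x assume "x \<in> (\<Union>A\<in>{A\<in>\<xi>. f A \<in> B}. A)"
      then obtain A where A: "A \<in> \<xi>" "f A \<in> B" "x \<in> A" by blast
      then show "x \<in> g -` B \<inter> space M" using cell[OF A(1)] by blast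
    qed
    also have "\<dots> \<in> sets M" using fin sets by (intro sets.finite_UN) auto
    finally show "g -` B \<inter> space M \<in> sets M" .
  qed simp
  moreover have "cells M g = \<xi>"
  proof (intro set_eqI iffI)
    fix A assume "A \<in> cells M g"
    then obtain x where x: "x \<in> space M" "A = g -` {g x} \<inter> space M" by (auto simp: cells_def)
    then have "A = c x" using cell[OF c(1)[OF x(1)]] by (simp add: g_def)
    then show "A \<in> \<xi>" using c x by simp
  next
    fix A assume A: "A \<in> \<xi>"
    then have "A \<noteq> {}" using part by (auto simp: partition_on_def)
    then obtain x where x: "x \<in> A" by blast
    have xs: "x \<in> space M" using cell[OF A] x by blast
    have "g x = f A" using cell[OF A] x by blast
    then have "A = g -` {g x} \<inter> space M" using cell[OF A] by simp
    with xs show "A \<in> cells M g" by (auto simp: cells_def)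
  qed
  ultimately show ?thesis using lt that by blast
qed

lemma cells_partition:
  assumes g: "g \<in> measurable M (count_space UNIV)" and fin: "finite (g ` space M)"
  shows "partition_on (space M) (cells M g)" "finite (cells M g)" "cells M g \<subseteq> sets M"
proof -
  show "partition_on (space M) (cells M g)"
    by (auto simp: partition_on_def cells_def disjoint_def)
  show "finite (cells M g)" using fin by (simp add: cells_def)
  show "cells M g \<subseteq> sets M" using measurable_sets[OF g] by (auto simp: cells_def)
qed

end


subsection \<open>The generator theorem\<close>

lemma take_drop_word:
  assumes "i + N \<le> m" shows "take N (drop i (word T Z m x)) = word T Z N ((T ^^ i) x)"
proof -
  have "word T Z m x = word T Z i x @ word T Z N ((T ^^ i) x) @ word T Z (m - i - N) ((T ^^ N) ((T ^^ i) x))"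
    using assms by (simp flip: word_add)
  then show ?thesis by simp
qed

lemma take_word: "N \<le> m \<Longrightarrow> take N (word T Z m x) = word T Z N x"
  using take_drop_word[of 0 N m T Z x] by simp

context mps
begin

text \<open>The sets that can be approximated by conditions on finitely many symbols form a
  sigma-algebra containing the generators. For a union, finitely many members exhaust it up to
  \<open>\<delta> / 2\<close>, and their approximations share the other half; \<open>W'\<close>
  tests them on prefixes of words of one common length.\<close>

lemma generator_approx:
  fixes Z :: "'a \<Rightarrow> 'c::countable"
  assumes Z[measurable]: "Z \<in> measurable M (count_space UNIV)"
    and gen: "sets M = sigma_sets (space M) (range (\<lambda>w. {x \<in> space M. word T Z (length w) x = w}))"
    and A: "A \<in> sets M" and "\<delta> > 0"
  shows "\<exists>N W. measure M {x \<in> space M. (word T Z N x \<in> W) \<noteq> (x \<in> A)} \<le> \<delta>"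
proof -
  let ?D = "\<lambda>N W A. {x \<in> space M. (word T Z N x \<in> W) \<noteq> (x \<in> A)}"
  have D[measurable]: "?D N W A \<in> sets M" if "A \<in> sets M" for N W A
  proof -
    have "?D N W A = (word T Z N -` W \<inter> space M - A) \<union> (A - (word T Z N -` W \<inter> space M))"
      using sets.sets_into_space[OF that] by auto
    also have "\<dots> \<in> sets M"
      using that by (intro sets.Un sets.Diff cell_sets[OF measurable_word[OF Z]]) auto
    finally show ?thesis .
  qed
  have "A \<in> sigma_sets (space M) (range (\<lambda>w. {x \<in> space M. word T Z (length w) x = w}))"
    using A gen by simp
  then show ?thesis using \<open>\<delta> > 0\<close>
  proof (induction arbitrary: \<delta>)
    case (Basic A)
    then obtain w where w: "A = {x \<in> space M. word T Z (length w) x = w}" by auto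
    have "?D (length w) {w} A = {}" by (auto simp: w)
    then have "measure M (?D (length w) {w} A) = 0" by (simp only: measure_empty)
    then have "measure M (?D (length w) {w} A) \<le> \<delta>" using Basic(2) by linarith
    then show ?case by blast
  next
    case Empty
    have "?D 0 {} {} = {}" by auto
    then have "measure M (?D 0 {} {}) = 0" by (simp only: measure_empty)
    then have "measure M (?D 0 {} {}) \<le> \<delta>" using Empty by linarith
    then show ?case by blast
  next
    case (Compl A)
    then obtain N W where NW: "measure M (?D N W A) \<le> \<delta>" by blast
    have "?D N (- W) (space M - A) = ?D N W A" by auto
    with NW have "measure M (?D N (- W) (space M - A)) \<le> \<delta>" by (simp only:)
    then show ?case by blast
  next
    case (Union A)
    have As: "A i \<in> sets M" for i using Union(1) gen by simp
    have "(\<lambda>m. measure M (\<Union>i<m. A i)) \<longlonglongrightarrow> measure M (\<Union>m. \<Union>i<m. A i)"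
    proof (rule finite_Lim_measure_incseq)
      show "range (\<lambda>m. \<Union>i<m. A i) \<subseteq> sets M" using As by (auto intro!: sets.finite_UN)
      show "incseq (\<lambda>m. \<Union>i<m. A i)" unfolding incseq_def by (intro allI impI UN_mono) auto
    qed
    moreover have U: "(\<Union>m. \<Union>i<m. A i) = (\<Union>i. A i)" by auto
    ultimately have "\<forall>\<^sub>F m in sequentially. measure M (\<Union>i. A i) - \<delta> / 2 < measure M (\<Union>i<m. A i)"
      using Union(3) by (intro order_tendstoD(1)[of _ "measure M (\<Union>i. A i)"]) auto
    then obtain m where m: "measure M (\<Union>i. A i) - \<delta> / 2 < measure M (\<Union>i<m. A i)"
      by (auto simp: eventually_sequentially)
    have dpos: "0 < \<delta> / 2 / (m + 1)" using Union(3) by simp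
    have "\<forall>i. \<exists>N W. measure M (?D N W (A i)) \<le> \<delta> / 2 / (m + 1)" using Union(2)[OF dpos] by blast
    from choice[OF this] obtain N where "\<forall>i. \<exists>W. measure M (?D (N i) W (A i)) \<le> \<delta> / 2 / (m + 1)" ..
    from choice[OF this] obtain W where NW: "\<forall>i. measure M (?D (N i) (W i) (A i)) \<le> \<delta> / 2 / (m + 1)" ..
    define N' where "N' = (\<Sum>i<m. N i)"
    define W' where "W' = {w. \<exists>i<m. take (N i) w \<in> W i}"
    have N': "N i \<le> N'" if "i < m" for i unfolding N'_def using that by (intro member_le_sum) auto
    have "?D N' W' (\<Union>i. A i) \<subseteq> ((\<Union>i. A i) - (\<Union>i<m. A i)) \<union> (\<Union>i<m. ?D (N i) (W i) (A i))"
      unfolding W'_def using N' by (auto simp: take_word)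
    then have "measure M (?D N' W' (\<Union>i. A i))
        \<le> measure M (((\<Union>i. A i) - (\<Union>i<m. A i)) \<union> (\<Union>i<m. ?D (N i) (W i) (A i)))"
      using As D by (intro finite_measure_mono) auto
    also have "\<dots> \<le> measure M ((\<Union>i. A i) - (\<Union>i<m. A i)) + measure M (\<Union>i<m. ?D (N i) (W i) (A i))"
      using As D by (intro measure_Un_le) auto
    also have "\<dots> \<le> \<delta> / 2 + (\<Sum>i<m. \<delta> / 2 / (m + 1))"
    proof (rule add_mono)
      show "measure M ((\<Union>i. A i) - (\<Union>i<m. A i)) \<le> \<delta> / 2"
        using m As by (subst finite_measure_Diff) auto
      have "measure M (\<Union>i<m. ?D (N i) (W i) (A i)) \<le> (\<Sum>i<m. measure M (?D (N i) (W i) (A i)))"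
        using As D by (intro measure_UNION_le) auto
      also have "\<dots> \<le> (\<Sum>i<m. \<delta> / 2 / (m + 1))" by (intro sum_mono NW[rule_format])
      finally show "measure M (\<Union>i<m. ?D (N i) (W i) (A i)) \<le> (\<Sum>i<m. \<delta> / 2 / (m + 1))" .
    qed
    also have "\<dots> \<le> \<delta>" using Union(3) by (simp add: field_simps)
    finally show ?case by blast
  qed
qed

text \<open>Each of the \<open>r\<close> cells of \<open>g\<close> has an approximate test on words.
  Where all tests are correct, exactly the index \<open>g x\<close> passes, so the least passing
  index is the right guess.\<close>

lemma generator_guess:
  fixes Z :: "'a \<Rightarrow> 'c::countable" and g :: "'a \<Rightarrow> nat"
  assumes Z[measurable]: "Z \<in> measurable M (count_space UNIV)"
    and gen: "sets M = sigma_sets (space M) (range (\<lambda>w. {x \<in> space M. word T Z (length w) x = w}))"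
    and g[measurable]: "g \<in> measurable M (count_space UNIV)" and r: "\<And>x. g x < r" and "\<delta> > 0"
  obtains N c where "measure M {x \<in> space M. c (word T Z N x) \<noteq> g x} \<le> \<delta>"
proof -
  let ?D = "\<lambda>N W A. {x \<in> space M. (word T Z N x \<in> W) \<noteq> (x \<in> A)}"
  let ?A = "\<lambda>j. g -` {j} \<inter> space M"
  have dpos: "0 < \<delta> / (r + 1)" using \<open>\<delta> > 0\<close> by simp
  have "\<forall>j. \<exists>N W. measure M (?D N W (?A j)) \<le> \<delta> / (r + 1)"
    using generator_approx[OF Z gen cell_sets[OF g] dpos] by blast
  from choice[OF this] obtain N where "\<forall>j. \<exists>W. measure M (?D (N j) W (?A j)) \<le> \<delta> / (r + 1)" ..
  from choice[OF this] obtain W where NW: "\<forall>j. measure M (?D (N j) (W j) (?A j)) \<le> \<delta> / (r + 1)" ..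
  define N' where "N' = (\<Sum>i<r. N i)"
  define c where "c w = (LEAST j. j < r \<and> take (N j) w \<in> W j)" for w
  have N': "N i \<le> N'" if "i < r" for i unfolding N'_def using that by (intro member_le_sum) auto
  have sD: "?D N W (?A j) \<in> sets M" for N W j
  proof -
    have "?D N W (?A j) = (word T Z N -` W \<inter> space M - ?A j) \<union> (?A j - (word T Z N -` W \<inter> space M))"
      by auto
    also have "\<dots> \<in> sets M"
      by (intro sets.Un sets.Diff cell_sets[OF measurable_word[OF Z]] cell_sets[OF g])
    finally show ?thesis .
  qed
  have "{x \<in> space M. c (word T Z N' x) \<noteq> g x} \<subseteq> (\<Union>j<r. ?D (N j) (W j) (?A j))"
  proof (rule subsetI, rule ccontr)
    fix x assume x: "x \<in> {x \<in> space M. c (word T Z N' x) \<noteq> g x}" "x \<notin> (\<Union>j<r. ?D (N j) (W j) (?A j))"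
    then have "take (N j) (word T Z N' x) \<in> W j \<longleftrightarrow> j = g x" if "j < r" for j
      using that N'[OF that] by (auto simp: take_word)
    then have "c (word T Z N' x) = g x"
      unfolding c_def using r[of x] by (intro Least_equality) auto
    with x show False by simp
  qed
  then have "measure M {x \<in> space M. c (word T Z N' x) \<noteq> g x} \<le> measure M (\<Union>j<r. ?D (N j) (W j) (?A j))"
    using sD by (intro finite_measure_mono) auto
  also have "\<dots> \<le> (\<Sum>j<r. measure M (?D (N j) (W j) (?A j)))"
    using sD by (intro measure_UNION_le) auto
  also have "\<dots> \<le> (\<Sum>j<r. \<delta> / (r + 1))" by (intro sum_mono NW[rule_format])
  also have "\<dots> \<le> \<delta>" using \<open>\<delta> > 0\<close> by (simp add: field_simps)
  finally show ?thesis by (rule that)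
qed

text \<open>A Fano-type estimate. The kernel puts mass \<open>1 - \<delta>\<close> on the guess and
  spreads \<open>\<delta>\<close> evenly over the \<open>r\<close> values, so a letter costs
  \<open>- ln (1 - \<delta>)\<close> after a right guess and at most
  \<open>ln (r / \<delta>)\<close> more after a wrong one. A word of length \<open>n + N\<close> in
  \<open>Z\<close> determines all \<open>n\<close> guesses.\<close>

lemma entropy_wrt_le_of_guess:
  fixes Z :: "'a \<Rightarrow> 'c::countable" and g :: "'a \<Rightarrow> nat"
  assumes Z[measurable]: "Z \<in> measurable M (count_space UNIV)" and intZ: "integrable M (info M Z)"
    and h: "(\<lambda>n. integral\<^sup>L M (info M (word T Z n)) / real n) \<longlonglongrightarrow> h"
    and g[measurable]: "g \<in> measurable M (count_space UNIV)" and r: "\<And>x. g x < r"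
    and d: "0 < \<delta>" "\<delta> < 1"
    and c: "measure M {x \<in> space M. c (word T Z N x) \<noteq> g x} \<le> \<epsilon>"
  shows "entropy_wrt M T (cells M g) \<le> h - ln (1 - \<delta>) + ln (r / \<delta>) * \<epsilon>"
proof -
  let ?V = "word T Z N"
  define k :: "'c list \<Rightarrow> nat \<Rightarrow> real" where
    "k v z = (if z = c v then 1 - \<delta> else if z < r then \<delta> / r else 0)" for v z
  have r0: "0 < r" using r[of undefined] by simp
  have lnr: "0 \<le> ln (r / \<delta>)" using d r0 by (intro ln_ge_zero) (simp add: field_simps)
  have V[measurable]: "?V \<in> measurable M (count_space UNIV)" by (rule measurable_word[OF Z])
  have fin: "finite (g ` space M)" by (rule finite_subset[of _ "{..<r}"]) (use r in auto)
  have sum: "(\<integral>\<^sup>+z. ennreal (k v z) \<partial>count_space UNIV) \<le> 1" for v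
  proof -
    have "(\<integral>\<^sup>+z. ennreal (k v z) \<partial>count_space UNIV)
       \<le> (\<integral>\<^sup>+z. ennreal (1 - \<delta>) * indicator {c v} z + ennreal (\<delta> / r) * indicator {..<r} z \<partial>count_space UNIV)"
      by (intro nn_integral_mono) (auto simp: k_def indicator_def)
    also have "\<dots> = ennreal (1 - \<delta>) + ennreal (\<delta> / r) * of_nat r"
      by (subst nn_integral_add) (auto simp: nn_integral_cmult_indicator emeasure_count_space)
    also have "\<dots> = ennreal (1 - \<delta> + \<delta> / r * r)"
      using d by (simp add: ennreal_of_nat_eq_real_of_nat ennreal_mult'[symmetric] ennreal_plus[symmetric] del: ennreal_plus)
    also have "\<dots> = 1" using r0 by simp
    finally show ?thesis .
  qed
  have pos: "0 < k (?V x) (g x)" for x using r r0 d by (simp add: k_def)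
  let ?E = "{x \<in> space M. c (?V x) \<noteq> g x}"
  have "(\<lambda>x. (c (?V x), g x)) \<in> measurable M (count_space UNIV)"
    by (rule measurable_countable2[OF V g, of "\<lambda>v z. (c v, z)"]) simp
  from measurable_sets[OF this, of "{(a, b). a \<noteq> b}"] have E[measurable]: "?E \<in> sets M"
    by (simp add: vimage_def Int_def conj_commute)
  have [measurable]: "(\<lambda>x. ln (k (?V x) (g x))) \<in> borel_measurable M"
    by (rule measurable_countable2[OF V g, of "\<lambda>v z. ln (k v z)"]) simp
  have lnk: "- ln (k (?V x) (g x)) \<le> - ln (1 - \<delta>) + ln (r / \<delta>) * indicator ?E x"
    "- ln (k (?V x) (g x)) \<ge> 0" if "x \<in> space M" for x
    using that r[of x] r0 d lnr by (auto simp: k_def indicator_def ln_div divide_le_eq)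
  have intR: "integrable M (\<lambda>x. - ln (1 - \<delta>) + ln (r / \<delta>) * indicator ?E x)"
    by (intro Bochner_Integration.integrable_add integrable_mult_right integrable_real_indicator E)
       (auto simp: emeasure_eq_measure)
  have intk: "integrable M (\<lambda>x. ln (k (?V x) (g x)))"
  proof (rule Bochner_Integration.integrable_bound[OF intR])
    show "AE x in M. norm (ln (k (?V x) (g x))) \<le> norm (- ln (1 - \<delta>) + ln (r / \<delta>) * indicator ?E x)"
    proof (rule AE_I2)
      fix x assume "x \<in> space M"
      from lnk[OF this] show "norm (ln (k (?V x) (g x))) \<le> norm (- ln (1 - \<delta>) + ln (r / \<delta>) * indicator ?E x)"
        unfolding real_norm_def by linarith
    qed
  qed simp
  have "(\<integral>x. - ln (k (?V x) (g x)) \<partial>M) \<le> (\<integral>x. - ln (1 - \<delta>) + ln (r / \<delta>) * indicator ?E x \<partial>M)"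
    using lnk intk intR by (intro integral_mono) auto
  also have "\<dots> = - ln (1 - \<delta>) + ln (r / \<delta>) * measure M ?E"
    using E by (subst Bochner_Integration.integral_add)
      (auto simp: prob_space emeasure_eq_measure)
  also have "\<dots> \<le> - ln (1 - \<delta>) + ln (r / \<delta>) * \<epsilon>"
    using c lnr by (intro add_left_mono mult_left_mono) auto
  finally have \<kappa>: "(\<integral>x. - ln (k (?V x) (g x)) \<partial>M) \<le> - ln (1 - \<delta>) + ln (r / \<delta>) * \<epsilon>" (is "?\<kappa> \<le> _") .
  have bound: "integral\<^sup>L M (info M (word T g n)) \<le> integral\<^sup>L M (info M (word T Z (n + N))) + n * ?\<kappa>" for n
  proof -
    let ?Y = "word T Z (n + N)"
    have Y: "?Y \<in> measurable M (count_space UNIV)" by (rule measurable_word[OF Z])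
    have phi: "?V ((T ^^ i) x) = take N (drop i (?Y x))" if "i < n" for i x
      using that by (simp add: take_drop_word)
    note ch = chain_word[OF Y V g phi sum AE_I2[OF pos] intk integrable_info_word[OF Z intZ]]
    have YW: "(\<lambda>x. (?Y x, word T g n x)) \<in> measurable M (count_space UNIV)"
      by (rule measurable_countable2[OF Y measurable_word[OF g]]) simp
    have "AE x in M. info M (word T g n) x \<le> info M (\<lambda>x. (?Y x, word T g n x)) x"
      by (rule info_mono[OF YW measurable_word[OF g], of _ snd]) simp
    then have "integral\<^sup>L M (info M (word T g n)) \<le> integral\<^sup>L M (info M (\<lambda>x. (?Y x, word T g n x)))"
      by (intro integral_mono_AE ch(1) partition_entropy_cells(2)[OF measurable_word[OF g] finite_word_range[OF fin]])
    with ch(2)[of n] show ?thesis by simp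
  qed
  \<comment> \<open>The \<open>N\<close> extra letters are harmless since \<open>(n + N) / n\<close>
    tends to 1.\<close>
  have "(\<lambda>n. integral\<^sup>L M (info M (word T Z (n + N))) / real (n + N) * (real (n + N) / real n) + ?\<kappa>) \<longlonglongrightarrow> h * 1 + ?\<kappa>"
  proof (intro tendsto_add tendsto_mult tendsto_const)
    show "(\<lambda>n. integral\<^sup>L M (info M (word T Z (n + N))) / real (n + N)) \<longlonglongrightarrow> h"
      using LIMSEQ_ignore_initial_segment[OF h, of N] .
    have "(\<lambda>n. 1 + real N * (1 / real n)) \<longlonglongrightarrow> 1 + real N * 0"
      by (intro tendsto_intros lim_1_over_n)
    then have "(\<lambda>n. 1 + real N * (1 / real n)) \<longlonglongrightarrow> 1" by simp
    then show "(\<lambda>n. real (n + N) / real n) \<longlonglongrightarrow> 1"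
      by (rule Lim_transform_eventually)
         (auto simp: eventually_sequentially field_simps intro!: exI[of _ 1])
  qed
  moreover have "\<forall>\<^sub>F n in sequentially. integral\<^sup>L M (info M (word T g n)) / real n
      \<le> integral\<^sup>L M (info M (word T Z (n + N))) / real (n + N) * (real (n + N) / real n) + ?\<kappa>"
    unfolding eventually_sequentially
  proof (intro exI[of _ 1] allI impI)
    fix n :: nat assume n: "1 \<le> n"
    have "integral\<^sup>L M (info M (word T g n)) / n \<le> (integral\<^sup>L M (info M (word T Z (n + N))) + n * ?\<kappa>) / n"
      by (rule divide_right_mono[OF bound]) simp
    also have "\<dots> = integral\<^sup>L M (info M (word T Z (n + N))) / real (n + N) * (real (n + N) / real n) + ?\<kappa>"
    proof -
      have "(a + real n * b) / real n = a / real (n + N) * (real (n + N) / real n) + b" for a b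
        using n by (simp add: add_divide_distrib del: of_nat_add)
      then show ?thesis .
    qed
    finally show "integral\<^sup>L M (info M (word T g n)) / real n
      \<le> integral\<^sup>L M (info M (word T Z (n + N))) / real (n + N) * (real (n + N) / real n) + ?\<kappa>" .
  qed
  ultimately have "entropy_wrt M T (cells M g) \<le> h * 1 + ?\<kappa>"
    by (intro tendsto_le[OF _ _ entropy_wrt_cells[OF g fin]]) auto
  with \<kappa> show ?thesis by simp
qed

lemma entropy_wrt_le:
  fixes Z :: "'a \<Rightarrow> 'c::countable" and g :: "'a \<Rightarrow> nat"
  assumes Z[measurable]: "Z \<in> measurable M (count_space UNIV)" and intZ: "integrable M (info M Z)"
    and gen: "sets M = sigma_sets (space M) (range (\<lambda>w. {x \<in> space M. word T Z (length w) x = w}))"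
    and h: "(\<lambda>n. integral\<^sup>L M (info M (word T Z n)) / real n) \<longlonglongrightarrow> h"
    and g[measurable]: "g \<in> measurable M (count_space UNIV)" and r: "\<And>x. g x < r"
  shows "entropy_wrt M T (cells M g) \<le> h"
proof (rule field_le_epsilon)
  fix e :: real assume e: "0 < e"
  \<comment> \<open>Chosen so that \<open>- ln (1 - \<delta>) = e / 2\<close>. Only afterwards is
    the error probability made small compared with \<open>ln (r / \<delta>)\<close>, which depends
    on this choice.\<close>
  define \<delta> where "\<delta> = 1 - exp (- e / 2)"
  have d: "0 < \<delta>" "\<delta> < 1" using e by (auto simp: \<delta>_def)
  have r0: "0 < r" using r[of undefined] by simp
  define L where "L = ln (r / \<delta>)"
  have L: "0 \<le> L" unfolding L_def using d r0 by (intro ln_ge_zero) (simp add: field_simps)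
  have "0 < e / 2 / (L + 1)" using e L by simp
  then obtain N c where "measure M {x \<in> space M. c (word T Z N x) \<noteq> g x} \<le> e / 2 / (L + 1)"
    by (rule generator_guess[OF Z gen g r])
  from entropy_wrt_le_of_guess[OF Z intZ h g r d this]
  have "entropy_wrt M T (cells M g) \<le> h + e / 2 + L * (e / 2 / (L + 1))"
    by (simp add: \<delta>_def L_def)
  also have "L * (e / 2 / (L + 1)) \<le> e / 2" using L e by (simp add: field_simps)
  finally show "entropy_wrt M T (cells M g) \<le> h + e" by simp
qed

end

section \<open>Finite alphabets obtained by merging letters\<close>

context mps
begin

text \<open>All letters numbered \<open>K\<close> or higher become one symbol. The kernel is the
  conditional probability of the letter given its merged symbol, and its cost is the information
  lost by merging, which is zero unless the letter was among the merged ones.\<close>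

lemma entropy_merge_letters:
  fixes Z :: "'a \<Rightarrow> 'c::countable"
  assumes Z[measurable]: "Z \<in> measurable M (count_space UNIV)" and intZ: "integrable M (info M Z)"
    and h: "(\<lambda>n. integral\<^sup>L M (info M (word T Z n)) / real n) \<longlonglongrightarrow> h"
    and g_def: "g = (\<lambda>x. min K (to_nat (Z x)))"
  shows "h \<le> entropy_wrt M T (cells M g) + (\<integral>x. info M Z x * indicator {x. K \<le> to_nat (Z x)} x \<partial>M)"
proof -
  let ?p = "\<lambda>a. measure M (Z -` {a} \<inter> space M)" and ?r = "\<lambda>b. measure M (g -` {b} \<inter> space M)"
  have g[measurable]: "g \<in> measurable M (count_space UNIV)"
    unfolding g_def by (rule measurable_compose[OF Z]) simp
  have fin: "finite (g ` space M)" by (rule finite_subset[of _ "{..K}"]) (auto simp: g_def)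
  define k where "k b a = (if min K (to_nat a) = b then ?p a / ?r b else 0)" for b a
  have sum: "(\<integral>\<^sup>+a. ennreal (k b a) \<partial>count_space UNIV) \<le> 1" for b
  proof (cases "?r b = 0")
    case True
    then have "k b a = 0" for a by (simp add: k_def)
    then show ?thesis by simp
  next
    case False
    let ?X = "\<lambda>a. if min K (to_nat a) = b then Z -` {a} \<inter> space M else {}"
    have "(\<integral>\<^sup>+a. ennreal (k b a) \<partial>count_space UNIV) = (\<integral>\<^sup>+a. emeasure M (?X a) / ennreal (?r b) \<partial>count_space UNIV)"
      using False by (intro nn_integral_cong)
        (auto simp: k_def emeasure_eq_measure divide_ennreal zero_less_measure_iff)
    also have "\<dots> = (\<integral>\<^sup>+a. emeasure M (?X a) \<partial>count_space UNIV) / ennreal (?r b)"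
      by (rule nn_integral_divide) simp
    also have "(\<integral>\<^sup>+a. emeasure M (?X a) \<partial>count_space UNIV) = emeasure M (\<Union>a. ?X a)"
      by (rule emeasure_UN_countable[symmetric]) (auto simp: disjoint_family_on_def)
    also have "(\<Union>a. ?X a) = g -` {b} \<inter> space M" by (auto simp: g_def split: if_splits)
    finally show ?thesis using False by (simp add: emeasure_eq_measure zero_less_measure_iff)
  qed
  have pos: "AE x in M. 0 < k (g x) (Z x)"
    using AE_cell_pos[OF Z] AE_cell_pos[OF g] by eventually_elim (simp add: k_def g_def)
  have lnk: "AE x in M. ln (k (g x) (Z x)) = info M g x - info M Z x"
    using AE_cell_pos[OF Z] AE_cell_pos[OF g]
    by eventually_elim (simp add: k_def info_def ln_div, simp add: g_def)
  have intg: "integrable M (info M g)" by (rule partition_entropy_cells(2)[OF g fin])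
  have mk: "(\<lambda>x. ln (k (g x) (Z x))) \<in> borel_measurable M"
    by (rule measurable_countable2[OF g Z, of "\<lambda>b a. ln (k b a)"]) simp
  have intd: "integrable M (\<lambda>x. info M g x - info M Z x)" using intg intZ by simp
  have intk: "integrable M (\<lambda>x. ln (k (g x) (Z x)))"
    by (rule integrable_cong_AE_imp[OF intd mk]) (use lnk in \<open>simp add: eq_commute\<close>)
  let ?tail = "\<integral>x. info M Z x * indicator {x. K \<le> to_nat (Z x)} x \<partial>M"
  have "{x \<in> space M. K \<le> to_nat (Z x)} = Z -` {a. K \<le> to_nat a} \<inter> space M" by auto
  then have sK: "{x \<in> space M. K \<le> to_nat (Z x)} \<in> sets M" by (simp only: cell_sets[OF Z])
  have "(\<integral>x. - ln (k (g x) (Z x)) \<partial>M) = (\<integral>x. info M Z x - info M g x \<partial>M)"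
    by (rule integral_cong_AE) (use mk intg intZ lnk in auto)
  also have "\<dots> \<le> ?tail"
  proof (rule integral_mono)
    show "integrable M (\<lambda>x. info M Z x - info M g x)" using intg intZ by simp
    have "integrable M (\<lambda>x. info M Z x * indicator {x \<in> space M. K \<le> to_nat (Z x)} x)"
      by (rule integrable_real_mult_indicator[OF sK intZ])
    then show "integrable M (\<lambda>x. info M Z x * indicator {x. K \<le> to_nat (Z x)} x)"
      by (rule iffD1[OF Bochner_Integration.integrable_cong[OF refl], rotated]) (simp add: indicator_def)
  next
    fix x assume x: "x \<in> space M"
    show "info M Z x - info M g x \<le> info M Z x * indicator {x. K \<le> to_nat (Z x)} x"
    proof (cases "K \<le> to_nat (Z x)")
      case True
      then show ?thesis using info_nonneg[OF g, of x] by simp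
    next
      case False
      \<comment> \<open>A letter numbered below \<open>K\<close> is alone in its class, so both
        informations agree.\<close>
      then have "g -` {g x} \<inter> space M = Z -` {Z x} \<inter> space M"
        by (auto simp: g_def min_def split: if_splits)
      with False show ?thesis by (simp add: info_def)
    qed
  qed
  finally have tail: "(\<integral>x. - ln (k (g x) (Z x)) \<partial>M) \<le> ?tail" .
  have bound: "integral\<^sup>L M (info M (word T Z n)) / n \<le> integral\<^sup>L M (info M (word T g n)) / n + ?tail"
    if "n \<ge> 1" for n
  proof -
    let ?Y = "word T g n"
    have Y: "?Y \<in> measurable M (count_space UNIV)" by (rule measurable_word[OF g])
    have phi: "g ((T ^^ i) x) = ?Y x ! i" if "i < n" for i x
      using that by (simp add: word_def)
    note ch = chain_word[OF Y g Z phi sum pos intk integrable_info_word[OF g intg]]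
    have YW: "(\<lambda>x. (?Y x, word T Z n x)) \<in> measurable M (count_space UNIV)"
      by (rule measurable_countable2[OF Y measurable_word[OF Z]]) simp
    have "AE x in M. info M (word T Z n) x \<le> info M (\<lambda>x. (?Y x, word T Z n x)) x"
      by (rule info_mono[OF YW measurable_word[OF Z], of _ snd]) simp
    then have "integral\<^sup>L M (info M (word T Z n)) \<le> integral\<^sup>L M (info M (\<lambda>x. (?Y x, word T Z n x)))"
      by (intro integral_mono_AE ch(1) integrable_info_word[OF Z intZ])
    also have "\<dots> \<le> integral\<^sup>L M (info M ?Y) + n * (\<integral>x. - ln (k (g x) (Z x)) \<partial>M)"
      using ch(2)[of n] by simp
    also have "\<dots> \<le> integral\<^sup>L M (info M ?Y) + n * ?tail"
      using tail by (intro add_left_mono mult_left_mono) auto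
    finally have "integral\<^sup>L M (info M (word T Z n)) / n \<le> (integral\<^sup>L M (info M ?Y) + n * ?tail) / n"
      by (rule divide_right_mono) simp
    then show ?thesis using that by (simp add: add_divide_distrib)
  qed
  show ?thesis
    by (rule tendsto_le[OF _ tendsto_add[OF entropy_wrt_cells[OF g fin] tendsto_const] h])
       (use bound in \<open>auto simp: eventually_sequentially\<close>)
qed

text \<open>The upper half compares each finite partition with guesses from \<open>Z\<close>. For
  the lower half \<open>Z\<close> itself may have infinitely many values and be no competitor in the
  supremum; its merged versions are, and what they miss tends to 0 by dominated convergence.\<close>

theorem KS_entropy_generator:
  fixes Z :: "'a \<Rightarrow> 'c::countable"
  assumes Z[measurable]: "Z \<in> measurable M (count_space UNIV)" and intZ: "integrable M (info M Z)"
    and gen: "sets M = sigma_sets (space M) (range (\<lambda>w. {x \<in> space M. word T Z (length w) x = w}))"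
    and h: "(\<lambda>n. integral\<^sup>L M (info M (word T Z n)) / real n) \<longlonglongrightarrow> h"
  shows "KS_entropy M T = ereal h"
proof (rule antisym)
  show "KS_entropy M T \<le> ereal h"
    unfolding KS_entropy_def
  proof (rule SUP_least)
    fix \<xi> assume xi: "\<xi> \<in> {\<xi>. partition_on (space M) \<xi> \<and> finite \<xi> \<and> \<xi> \<subseteq> sets M}"
    then obtain g :: "'a \<Rightarrow> nat" where g: "g \<in> measurable M (count_space UNIV)" "\<And>x. g x < card \<xi>" "cells M g = \<xi>"
      using partition_eq_cells by blast
    from entropy_wrt_le[OF Z intZ gen h g(1,2)] show "ereal (entropy_wrt M T \<xi>) \<le> ereal h" by (simp add: g(3))
  qed
  let ?tail = "\<lambda>K. \<integral>x. info M Z x * indicator {x. K \<le> to_nat (Z x)} x \<partial>M"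
  have le: "ereal (h - ?tail K) \<le> KS_entropy M T" for K
  proof -
    define g where "g = (\<lambda>x. min K (to_nat (Z x)))"
    have g: "g \<in> measurable M (count_space UNIV)"
      unfolding g_def by (rule measurable_compose[OF Z]) simp
    have fin: "finite (g ` space M)" by (rule finite_subset[of _ "{..K}"]) (auto simp: g_def)
    have "ereal (h - ?tail K) \<le> ereal (entropy_wrt M T (cells M g))"
      using entropy_merge_letters[OF Z intZ h g_def] by simp
    also have "\<dots> \<le> KS_entropy M T"
      unfolding KS_entropy_def using cells_partition[OF g fin] by (intro SUP_upper) simp
    finally show ?thesis .
  qed
  have "?tail \<longlonglongrightarrow> (\<integral>x. 0 \<partial>M)"
  proof (rule integral_dominated_convergence[where w = "info M Z"])
    show "(\<lambda>x. info M Z x * indicator {x. K \<le> to_nat (Z x)} x) \<in> borel_measurable M" for K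
    proof -
      have "(\<lambda>x. indicator {x. K \<le> to_nat (Z x)} x :: real) \<in> borel_measurable M"
        using measurable_compose[OF Z, of "\<lambda>a. indicator {a. K \<le> to_nat a} a :: real"] by (simp add: indicator_def)
      then show ?thesis using measurable_info[OF Z] by simp
    qed
    show "AE x in M. (\<lambda>K. info M Z x * indicator {x. K \<le> to_nat (Z x)} x) \<longlonglongrightarrow> 0"
    proof (rule AE_I2)
      fix x
      have "info M Z x * indicator {x. K \<le> to_nat (Z x)} x = 0" if "K \<ge> Suc (to_nat (Z x))" for K
        using that by simp
      then show "(\<lambda>K. info M Z x * indicator {x. K \<le> to_nat (Z x)} x) \<longlonglongrightarrow> 0"
        by (intro tendsto_eventually) (unfold eventually_sequentially, blast)
    qed
    show "AE x in M. norm (info M Z x * indicator {x. K \<le> to_nat (Z x)} x) \<le> info M Z x" for K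
      using info_nonneg[OF Z] by (intro AE_I2) (auto simp: indicator_def)
  qed (use intZ in auto)
  then have "(\<lambda>K. ereal (h - ?tail K)) \<longlonglongrightarrow> ereal (h - 0)"
    by (intro tendsto_intros) simp
  then show "ereal h \<le> KS_entropy M T"
    using le by (intro LIMSEQ_le_const2[of "\<lambda>K. ereal (h - ?tail K)"]) auto
qed

end


subsection \<open>Mixing of cylinders under the shift\<close>

lemma shift_iterate: "(shift ^^ n) \<omega> i = \<omega> (n + i)"
  by (induction n arbitrary: i) (auto simp: shift_def)

lemma word_shift: "word shift (\<lambda>\<omega>. \<omega> 0) n \<omega> = map \<omega> [0..<n]"
  by (simp add: word_def shift_iterate)

lemma cylinder_word: "cylinder w = {\<omega>. word shift (\<lambda>\<omega>. \<omega> 0) (length w) \<omega> = w}"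
proof -
  have "map \<omega> [0..<length w] = w \<longleftrightarrow> (\<forall>i<length w. \<omega> i = w ! i)" for \<omega>
    by (subst list_eq_iff_nth_eq) simp
  then show ?thesis by (simp add: cylinder_def word_shift)
qed

lemma init_cylinder_word:
  "init_cylinder \<omega> n = word shift (\<lambda>\<omega>. \<omega> 0) n -` {word shift (\<lambda>\<omega>. \<omega> 0) n \<omega>}"
  by (auto simp: init_cylinder_def cylinder_word word_shift)

text \<open>Written as \<open>sets\<close> of a measure, the coordinate algebra inherits the closure
  rules for measurable sets.\<close>

lemma coord_algebra_eq:
  "coord_algebra k n = sets (sigma UNIV {(\<lambda>\<omega>. \<omega> i) -` S | i S. k \<le> i \<and> enat i \<le> n})"
  by (simp add: coord_algebra_def)

lemma coord_algebra_mono: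
  assumes "k' \<le> k" "n \<le> n'" shows "(coord_algebra k n :: (nat \<Rightarrow> 'a) set set) \<subseteq> coord_algebra k' n'"
  unfolding coord_algebra_def
proof (rule sigma_sets_mono', rule subsetI)
  fix A :: "(nat \<Rightarrow> 'a) set" assume "A \<in> {(\<lambda>\<omega>. \<omega> i) -` S | i S. k \<le> i \<and> enat i \<le> n}"
  then obtain i S where A: "A = (\<lambda>\<omega>. \<omega> i) -` S" "k \<le> i" "enat i \<le> n" by blast
  have "k' \<le> i" "enat i \<le> n'" using A assms by (auto intro: order_trans)
  with A(1) show "A \<in> {(\<lambda>\<omega>. \<omega> i) -` S | i S. k' \<le> i \<and> enat i \<le> n'}" by blast
qed

lemma shift_cylinder_coord:
  assumes "\<And>i. i < length w \<Longrightarrow> enat (p + i) \<le> n"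
  shows "(shift ^^ p) -` cylinder w \<in> coord_algebra p n"
proof -
  let ?S = "sigma UNIV {(\<lambda>\<omega>. \<omega> i) -` S | i S. p \<le> i \<and> enat i \<le> n}"
  have "{\<omega> \<in> space ?S. \<forall>i\<in>{..<length w}. \<omega> (p + i) = w ! i} \<in> sets ?S"
  proof (rule sets.sets_Collect_finite_All)
    fix i assume "i \<in> {..<length w}"
    with assms[of i] have "(\<lambda>\<omega>. \<omega> (p + i)) -` {w ! i} \<in> {(\<lambda>\<omega>. \<omega> i) -` S | i S. p \<le> i \<and> enat i \<le> n}"
      by (intro CollectI exI[of _ "p + i"] exI[of _ "{w ! i}"]) auto
    then have "(\<lambda>\<omega>. \<omega> (p + i)) -` {w ! i} \<in> sets ?S" by auto
    then show "{\<omega> \<in> space ?S. \<omega> (p + i) = w ! i} \<in> sets ?S"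
      by (simp add: vimage_def)
  qed simp
  moreover have "{\<omega> \<in> space ?S. \<forall>i\<in>{..<length w}. \<omega> (p + i) = w ! i} = (shift ^^ p) -` cylinder w"
    by (auto simp: cylinder_def shift_iterate)
  ultimately show ?thesis by (simp add: coord_algebra_eq)
qed

lemma psi_Suc_le: "psi P (Suc m) \<le> psi P m"
  unfolding psi_def psi_dep_def
proof (rule SUP_mono, rule bexI)
  fix n
  show "Sup {ennreal \<bar>measure P (B \<inter> C) / (measure P B * measure P C) - 1\<bar> |B C.
              B \<in> coord_algebra 0 (enat n) \<and> C \<in> coord_algebra (n + Suc m + 1) \<infinity> \<and> measure P B * measure P C \<noteq> 0}
        \<le> Sup {ennreal \<bar>measure P (B \<inter> C) / (measure P B * measure P C) - 1\<bar> |B C.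
              B \<in> coord_algebra 0 (enat n) \<and> C \<in> coord_algebra (n + m + 1) \<infinity> \<and> measure P B * measure P C \<noteq> 0}"
    using coord_algebra_mono[of "n + m + 1" "n + Suc m + 1" \<infinity> \<infinity>] by (intro Sup_subset_mono) auto
qed simp

lemma psi_antimono: "m \<le> m' \<Longrightarrow> psi P m' \<le> psi P m"
  using lift_Suc_antimono_le[of "psi P"] psi_Suc_le by blast

section \<open>The mixing shift: coefficients as real numbers and the basic product estimate\<close>

locale psi_mixing_shift =
  fixes P :: "(nat \<Rightarrow> 'a::countable) measure"
  assumes alphabet: "\<exists>a b :: 'a. a \<noteq> b"
    and prob: "prob_space P"
    and sets_P: "sets P = sets sequence_algebra"
    and invariant: "measure_preserving P shift"
    and positive: "measure P (cylinder [a]) > 0"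
    and mixing: "psi_mixing P"
begin

sublocale mps P shift
  by (intro mps.intro mps_axioms.intro prob invariant)

abbreviation "letter \<equiv> (\<lambda>\<omega> :: nat \<Rightarrow> 'a. \<omega> 0)"

lemma space_P [simp]: "space P = UNIV"
  using sets_eq_imp_space_eq[OF sets_P] by (simp add: sequence_algebra_def space_measure_of_conv)

lemma sets_P_sigma: "sets P = sigma_sets UNIV (range cylinder)"
  by (simp add: sets_P sequence_algebra_def sets_measure_of_conv)

lemma cylinder_sets [measurable, simp]: "cylinder w \<in> sets P"
  by (auto simp: sets_P_sigma)

lemma generating:
  "sets P = sigma_sets (space P) (range (\<lambda>w. {x \<in> space P. word shift letter (length w) x = w}))"
  by (simp add: sets_P_sigma cylinder_word)

lemma measurable_letter [measurable]: "letter \<in> measurable P (count_space UNIV)"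
proof (rule measurableI)
  fix S :: "'a set"
  have "letter -` S \<inter> space P = (\<Union>a\<in>S. cylinder [a])" by (auto simp: cylinder_def)
  also have "\<dots> \<in> sets P" by (intro sets.countable_UN') auto
  finally show "letter -` S \<inter> space P \<in> sets P" .
qed simp

lemma measurable_coord [measurable]: "(\<lambda>\<omega>. \<omega> i) \<in> measurable P (count_space UNIV)"
  using measurable_compose[OF measurable_iterate[of i] measurable_letter] by (simp add: shift_iterate)

lemma coord_algebra_sets: "coord_algebra k n \<subseteq> sets P"
proof -
  have "{(\<lambda>\<omega>. \<omega> i) -` S | i S. k \<le> i \<and> enat i \<le> n} \<subseteq> sets P"
    using measurable_sets[OF measurable_coord] by auto
  from sets.sigma_sets_subset[OF this] show ?thesis by (simp add: coord_algebra_def)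
qed

lemma shift_vimage_coord:
  assumes "A \<in> sets P" shows "(shift ^^ p) -` A \<in> coord_algebra p \<infinity>"
proof -
  have "A \<in> sigma_sets UNIV (range cylinder)" using assms by (simp add: sets_P_sigma)
  then show ?thesis
  proof induction
    case (Basic a)
    then obtain w where "a = cylinder w" by blast
    then show ?case using shift_cylinder_coord[of w p \<infinity>] by simp
  next
    case Empty
    show ?case by (simp add: coord_algebra_def sigma_sets.Empty)
  next
    case (Compl A)
    have "(shift ^^ p) -` (UNIV - A) = UNIV - (shift ^^ p) -` A" by auto
    with Compl show ?case unfolding coord_algebra_def by (simp add: sigma_sets.Compl)
  next
    case (Union A)
    then show ?case unfolding coord_algebra_def by (auto simp: vimage_UN intro: sigma_sets.Union)
  qed
qed

text \<open>The coefficients decrease and the first is finite, so nothing is lost in passing to real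
  numbers; see \<open>psi_eq_rate\<close>.\<close>

definition rate :: "nat \<Rightarrow> real" where "rate m = enn2real (psi P m)"

lemma psi_eq_rate: "psi P m = ennreal (rate m)"
proof -
  have "psi P m \<le> psi P 0" by (rule psi_antimono) simp
  also have "\<dots> < \<infinity>" using mixing by (simp add: psi_mixing_def)
  finally show ?thesis by (simp add: rate_def ennreal_enn2real_if less_top)
qed

lemma rate_nonneg [simp]: "0 \<le> rate m" by (simp add: rate_def)

lemma rate_tendsto: "rate \<longlonglongrightarrow> 0"
proof -
  have "(\<lambda>m. ennreal (rate m)) \<longlonglongrightarrow> ennreal 0"
    using mixing by (simp add: psi_mixing_def psi_eq_rate[symmetric])
  then show ?thesis by (rule tendsto_ennrealD) auto
qed

text \<open>In product form the estimate survives for null events, where both sides are 0. A wider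
  gap than required is allowed because coordinate algebras shrink as their first index
  grows.\<close>

lemma mixing_bound:
  assumes B: "B \<in> coord_algebra 0 (enat n)" and C: "C \<in> coord_algebra k \<infinity>" and k: "n + m + 1 \<le> k"
  shows "\<bar>measure P (B \<inter> C) - measure P B * measure P C\<bar> \<le> rate m * (measure P B * measure P C)"
proof (cases "measure P B * measure P C = 0")
  case True
  have "B \<in> sets P" "C \<in> sets P" using B C coord_algebra_sets by auto
  then have "measure P (B \<inter> C) \<le> measure P B" "measure P (B \<inter> C) \<le> measure P C"
    by (auto intro!: finite_measure_mono)
  with True show ?thesis using measure_nonneg[of P "B \<inter> C"] by auto
next
  case False
  have C': "C \<in> coord_algebra (n + m + 1) \<infinity>" using C coord_algebra_mono[OF k, of \<infinity> \<infinity>] by auto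
  have "ennreal \<bar>measure P (B \<inter> C) / (measure P B * measure P C) - 1\<bar>
      \<le> psi_dep P (coord_algebra 0 (enat n)) (coord_algebra (n + m + 1) \<infinity>)"
    unfolding psi_dep_def using B C' False by (intro Sup_upper) blast
  also have "\<dots> \<le> ennreal (rate m)"
    unfolding psi_eq_rate[symmetric] psi_def by (rule SUP_upper) simp
  finally have *: "\<bar>measure P (B \<inter> C) / (measure P B * measure P C) - 1\<bar> \<le> rate m" by simp
  have pos: "0 < measure P B * measure P C" using False by (simp add: less_le)
  have "\<bar>measure P (B \<inter> C) - measure P B * measure P C\<bar>
      = \<bar>measure P (B \<inter> C) / (measure P B * measure P C) - 1\<bar> * (measure P B * measure P C)"
  proof -
    have "x - c = (x / c - 1) * c" if "0 < c" for x c :: real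
      using that by (simp add: field_simps)
    from arg_cong[OF this[OF pos], of abs] show ?thesis
      using abs_of_pos[OF pos] by (simp add: abs_mult)
  qed
  also have "\<dots> \<le> rate m * (measure P B * measure P C)"
    using * pos by (intro mult_right_mono) auto
  finally show ?thesis .
qed

section \<open>Words prescribed at separated positions\<close>

definition hits :: "(nat \<times> 'a list) list \<Rightarrow> (nat \<Rightarrow> 'a) set" where
  "hits xs = {\<omega>. \<forall>(p, w)\<in>set xs. (shift ^^ p) \<omega> \<in> cylinder w}"

text \<open>\<open>g\<close> is the number of free coordinates guaranteed between two windows, that
  is, the index of the mixing coefficient to be used. Words are nonempty so that each window has a
  last coordinate.\<close>

definition separated :: "nat \<Rightarrow> (nat \<times> 'a list) list \<Rightarrow> bool" where
  "separated g xs \<longleftrightarrow> sorted_wrt (\<lambda>(p, w) (p', w'). p + length w + g \<le> p') xs \<and> (\<forall>(p, w)\<in>set xs. w \<noteq> [])"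

text \<open>The probability that \<open>hits xs\<close> would have if the windows were
  independent.\<close>

definition weight :: "(nat \<times> 'a list) list \<Rightarrow> real" where
  "weight xs = prod_list (map (\<lambda>(p, w). measure P (cylinder w)) xs)"

lemma hits_Nil [simp]: "hits [] = UNIV"
  and hits_Cons: "hits ((p, w) # xs) = (shift ^^ p) -` cylinder w \<inter> hits xs"
  by (auto simp: hits_def)

lemma weight_nonneg: "0 \<le> weight xs"
  unfolding weight_def by (intro prod_list_nonneg) auto

lemma hits_coord: "(\<And>p w. (p, w) \<in> set xs \<Longrightarrow> k \<le> p) \<Longrightarrow> hits xs \<in> coord_algebra k \<infinity>"
proof (induction xs)
  case Nil
  show ?case using sets.top[of "sigma UNIV {(\<lambda>\<omega>. \<omega> i) -` S | i S. k \<le> i \<and> enat i \<le> \<infinity>}"]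
    by (simp add: coord_algebra_eq)
next
  case (Cons a xs)
  obtain p w where a: "a = (p, w)" by force
  have "(shift ^^ p) -` cylinder w \<in> coord_algebra k \<infinity>"
    using shift_cylinder_coord[of w p \<infinity>] coord_algebra_mono[of k p \<infinity> \<infinity>] Cons.prems a by auto
  moreover have "hits xs \<in> coord_algebra k \<infinity>" using Cons by auto
  ultimately show ?case unfolding a hits_Cons coord_algebra_eq by (rule sets.Int)
qed

lemma hits_sets [measurable]: "hits xs \<in> sets P"
  using hits_coord[of xs 0] coord_algebra_sets by auto

lemma measure_shift_cylinder: "measure P ((shift ^^ p) -` cylinder w) = measure P (cylinder w)"
  using measure_vimage[OF cylinder_sets, of p w] by simp

text \<open>The leftmost window depends on an initial segment of coordinates and the others on
  coordinates beyond the gap, so one application of \<open>mixing_bound\<close> splits it off. The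
  bounds for whole lists iterate this.\<close>

lemma hits_Cons_bound:
  assumes sep: "separated g ((p, w) # xs)"
  shows "\<bar>measure P (hits ((p, w) # xs)) - measure P (cylinder w) * measure P (hits xs)\<bar>
    \<le> rate g * (measure P (cylinder w) * measure P (hits xs))"
proof -
  have w: "w \<noteq> []" and gap: "\<And>p' w'. (p', w') \<in> set xs \<Longrightarrow> p + length w + g \<le> p'"
    using sep by (auto simp: separated_def)
  have "(shift ^^ p) -` cylinder w \<in> coord_algebra p (enat (p + length w - 1))"
    by (rule shift_cylinder_coord) auto
  then have B: "(shift ^^ p) -` cylinder w \<in> coord_algebra 0 (enat (p + length w - 1))"
    using coord_algebra_mono[of 0 p "enat (p + length w - 1)" "enat (p + length w - 1)"] by auto
  have C: "hits xs \<in> coord_algebra (p + length w + g) \<infinity>" by (rule hits_coord) (rule gap)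
  \<comment> \<open>The window ends at \<open>p + length w - 1\<close>; since \<open>w\<close> is
    nonempty the subtraction is exact and the gap is \<open>g\<close> without loss.\<close>
  have "p + length w - 1 + g + 1 \<le> p + length w + g" using w by (cases w) auto
  from mixing_bound[OF B C this] show ?thesis by (simp add: hits_Cons measure_shift_cylinder)
qed

lemma hits_upper: "separated g xs \<Longrightarrow> measure P (hits xs) \<le> (1 + rate g) ^ length xs * weight xs"
proof (induction xs)
  case Nil
  then show ?case using prob_space by (simp add: weight_def)
next
  case (Cons a xs)
  obtain p w where a: "a = (p, w)" by force
  have sep: "separated g xs" using Cons.prems by (auto simp: separated_def)
  have "measure P (hits (a # xs)) \<le> (1 + rate g) * measure P (cylinder w) * measure P (hits xs)"
    using hits_Cons_bound[of g p w xs] Cons.prems unfolding a by (auto simp: algebra_simps)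
  also have "\<dots> \<le> (1 + rate g) * measure P (cylinder w) * ((1 + rate g) ^ length xs * weight xs)"
    by (intro mult_left_mono Cons.IH sep) auto
  finally show ?case by (simp add: a weight_def mult_ac)
qed

text \<open>\<open>rate g \<le> 1\<close> keeps the factor \<open>1 - rate g\<close> nonnegative, so
  that the induction hypothesis may be multiplied by it.\<close>

lemma hits_lower:
  "separated g xs \<Longrightarrow> rate g \<le> 1 \<Longrightarrow> (1 - rate g) ^ length xs * weight xs \<le> measure P (hits xs)"
proof (induction xs)
  case Nil
  then show ?case using prob_space by (simp add: weight_def)
next
  case (Cons a xs)
  obtain p w where a: "a = (p, w)" by force
  have sep: "separated g xs" using Cons.prems by (auto simp: separated_def)
  have "(1 - rate g) ^ length (a # xs) * weight (a # xs)
      = (1 - rate g) * measure P (cylinder w) * ((1 - rate g) ^ length xs * weight xs)"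
    by (simp add: a weight_def mult_ac)
  also have "\<dots> \<le> (1 - rate g) * measure P (cylinder w) * measure P (hits xs)"
    using Cons sep by (intro mult_left_mono) auto
  also have "\<dots> \<le> measure P (hits (a # xs))"
    using hits_Cons_bound[of g p w xs] Cons.prems unfolding a by (auto simp: algebra_simps)
  finally show ?case .
qed

text \<open>Fix two letters. Every letter differs from at least one of them, whose positive
  probability it must leave free; this gives a uniform bound even for infinitely many
  letters.\<close>

lemma letter_prob_bounded: "\<exists>p<1. \<forall>a. measure P (cylinder [a]) \<le> p"
proof -
  obtain a b :: 'a where ab: "a \<noteq> b" using alphabet by blast
  have disj: "measure P (cylinder [c]) \<le> 1 - measure P (cylinder [e])" if "c \<noteq> e" for c e
  proof -
    have "measure P (cylinder [c]) + measure P (cylinder [e]) = measure P (cylinder [c] \<union> cylinder [e])"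
      using that by (subst finite_measure_Union[OF cylinder_sets cylinder_sets]) (auto simp: cylinder_def)
    also have "\<dots> \<le> 1" by (rule prob_le_1)
    finally show ?thesis by simp
  qed
  let ?p = "max (1 - measure P (cylinder [a])) (1 - measure P (cylinder [b]))"
  have "measure P (cylinder [c]) \<le> ?p" for c
    using disj[of c a] disj[of c b] ab by (cases "c = a") auto
  moreover have "?p < 1" using positive[of a] positive[of b] by auto
  ultimately show ?thesis by blast
qed

text \<open>Reading only every \<open>L\<close>-th letter, with \<open>L = Suc m\<close>, leaves
  gaps of length \<open>m\<close>. Each letter read then costs a factor
  \<open>\<theta> = (1 + rate m) * p\<close>, and \<open>m\<close> is taken so large that this is
  below 1.\<close>

lemma cylinder_decay:
  "\<exists>C \<rho>. 0 < C \<and> 0 < \<rho> \<and> \<rho> < 1 \<and> (\<forall>w. measure P (cylinder w) \<le> C * \<rho> ^ length w)"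
proof -
  obtain p where p: "p < 1" "\<And>a. measure P (cylinder [a]) \<le> p" using letter_prob_bounded by blast
  have p0: "0 < p" using positive p(2) less_le_trans by blast
  have "0 < 1 / p - 1" using p p0 by simp
  then have "\<forall>\<^sub>F m in sequentially. rate m < 1 / p - 1" by (rule order_tendstoD(2)[OF rate_tendsto])
  then obtain m where m: "rate m < 1 / p - 1" by (auto simp: eventually_sequentially)
  define \<theta> where "\<theta> = (1 + rate m) * p"
  have \<theta>: "0 < \<theta>" "\<theta> < 1"
    using m p0 rate_nonneg[of m] by (auto simp: \<theta>_def field_simps intro!: mult_pos_pos add_pos_nonneg)
  define L where "L = Suc m"
  define \<rho> where "\<rho> = root L \<theta>"
  have \<rho>: "0 < \<rho>" "\<rho> < 1" "\<rho> ^ L = \<theta>"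
    using \<theta> real_root_pow_pos2[of "Suc m" \<theta>] by (auto simp: \<rho>_def L_def simp del: power_Suc)
  have "measure P (cylinder w) \<le> (1 / \<theta>) * \<rho> ^ length w" for w
  proof -
    define J where "J = length w div L"
    define xs where "xs = map (\<lambda>j. (j * L, [w ! (j * L)])) [0..<J]"
    have pos: "j * L < length w" if "j < J" for j
    proof -
      have "Suc j * L \<le> J * L" using that by (intro mult_right_mono) auto
      also have "\<dots> \<le> length w" by (simp add: J_def)
      finally show ?thesis by (simp add: L_def)
    qed
    have "separated m xs"
    proof -
      have "j * L + 1 + m \<le> j' * L" if "j < j'" for j j'
        using mult_right_mono[of "Suc j" j' L] that by (simp add: L_def)
      then show ?thesis
        by (auto simp: separated_def xs_def sorted_wrt_map sorted_wrt_iff_nth_less)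
    qed
    have "cylinder w \<subseteq> hits xs"
      using pos by (auto simp: hits_def xs_def cylinder_def shift_iterate)
    then have "measure P (cylinder w) \<le> measure P (hits xs)" by (rule finite_measure_mono) simp
    also have "\<dots> \<le> (1 + rate m) ^ length xs * weight xs" by (rule hits_upper) fact
    also have "\<dots> \<le> (1 + rate m) ^ J * p ^ J"
    proof (rule mult_mono)
      have "weight xs = (\<Prod>j<J. measure P (cylinder [w ! (j * L)]))"
        by (simp add: weight_def xs_def comp_def prod.list_conv_set_nth flip: atLeast0LessThan)
      also have "\<dots> \<le> (\<Prod>j<J. p)" by (intro prod_mono) (use p in auto)
      finally show "weight xs \<le> p ^ J" by simp
    qed (auto simp: xs_def weight_nonneg)
    also have "\<dots> = \<theta> ^ J" by (simp add: \<theta>_def power_mult_distrib)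
    \<comment> \<open>The constant \<open>1 / \<theta>\<close> absorbs rounding:
      \<open>J + 1\<close> steps of length \<open>L\<close> cover the whole word, \<open>J\<close>
      steps need not.\<close>
    also have "\<theta> ^ J = (1 / \<theta>) * \<rho> ^ (L * Suc J)" using \<theta> \<rho> by (simp add: power_mult del: mult_Suc_right)
    also have "\<dots> \<le> (1 / \<theta>) * \<rho> ^ length w"
    proof (intro mult_left_mono power_decreasing)
      have "length w < Suc J * L" using dividend_less_div_times[of L "length w"] by (simp add: J_def L_def)
      then show "length w \<le> L * Suc J" by (simp add: mult.commute)
    qed (use \<theta> \<rho> in auto)
    finally show ?thesis .
  qed
  then show ?thesis using \<theta> \<rho> by (intro exI[of _ "1 / \<theta>"] exI[of _ \<rho>]) auto
qed

text \<open>The factor \<open>n\<close> counts the times below the word length, each of which costs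
  one cylinder probability in \<open>prob_early_hit_le\<close>.\<close>

lemma init_cylinder_summable: "summable (\<lambda>n. real n * measure P (init_cylinder \<omega> n))"
proof -
  obtain C \<rho> where C: "0 < C" "0 < \<rho>" "\<rho> < 1" "\<And>w. measure P (cylinder w) \<le> C * \<rho> ^ length w"
    using cylinder_decay by blast
  have "summable (\<lambda>n. of_nat (Suc n) * \<rho> ^ n)"
    using geometric_deriv_sums[of \<rho>] C by (auto simp: sums_iff)
  then have "summable (\<lambda>n. C * (of_nat (Suc n) * \<rho> ^ n))" by (rule summable_mult)
  then show ?thesis
  proof (rule summable_comparison_test'[where N = 0])
    fix n
    have "norm (real n * measure P (init_cylinder \<omega> n)) = real n * measure P (init_cylinder \<omega> n)" by simp
    also have "\<dots> \<le> real (Suc n) * (C * \<rho> ^ n)"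
      using C(4)[of "map \<omega> [0..<n]"] by (intro mult_mono) (auto simp: init_cylinder_def)
    finally show "norm (real n * measure P (init_cylinder \<omega> n)) \<le> C * (of_nat (Suc n) * \<rho> ^ n)"
      by (simp add: mult_ac)
  qed
qed

text \<open>An invariant set equals its preimages under all powers, so it depends only on
  coordinates arbitrarily far out. As the gap grows, \<open>rate\<close> tends to 0 and the set is
  independent of every event in finitely many coordinates. Approximating it by such events makes it
  independent of itself.\<close>

lemma ergodic_iterate:
  assumes "1 \<le> m" shows "ergodic_mps P (shift ^^ m)"
proof (intro ergodic_mps.intro mps_iterate ergodic_mps_axioms.intro)
  fix A assume A: "A \<in> sets P" and inv: "(shift ^^ m) -` A \<inter> space P = A"
  have iter: "(shift ^^ (m * j)) -` A = A" for j
  proof (induction j)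
    case (Suc j)
    have "(shift ^^ (m * Suc j)) -` A = (shift ^^ (m * j)) -` ((shift ^^ m) -` A)"
      by (simp add: funpow_add vimage_comp)
    then show ?case using inv Suc by simp
  qed simp
  have indep: "measure P (B \<inter> A) = measure P B * measure P A" if B: "B \<in> coord_algebra 0 (enat n)" for B n
  proof -
    have "\<bar>measure P (B \<inter> A) - measure P B * measure P A\<bar> \<le> rate g * (measure P B * measure P A)" for g
    proof (rule mixing_bound[OF B])
      show "A \<in> coord_algebra (m * (n + g + 1)) \<infinity>"
        using shift_vimage_coord[OF A, of "m * (n + g + 1)"] by (simp only: iter)
      show "n + g + 1 \<le> m * (n + g + 1)" using mult_le_mono1[OF assms, of "n + g + 1"] by simp
    qed
    moreover have "(\<lambda>g. rate g * (measure P B * measure P A)) \<longlonglongrightarrow> 0 * (measure P B * measure P A)"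
      by (intro tendsto_intros rate_tendsto)
    ultimately have "\<bar>measure P (B \<inter> A) - measure P B * measure P A\<bar> \<le> 0 * (measure P B * measure P A)"
      by (intro LIMSEQ_le_const) auto
    then show ?thesis by simp
  qed
  have "measure P A - measure P A * measure P A \<le> 0"
  proof (rule field_le_epsilon)
    fix e :: real assume "0 < e"
    then have e: "0 < e / 2" by simp
    obtain N W where NW: "measure P {x \<in> space P. (word shift letter N x \<in> W) \<noteq> (x \<in> A)} \<le> e / 2"
      using generator_approx[OF measurable_letter generating A e] by blast
    define B where "B = word shift letter N -` W"
    have "B = (\<Union>w\<in>{w\<in>W. length w = N}. (shift ^^ 0) -` cylinder w)"
      by (auto simp: B_def cylinder_word)
    also have "\<dots> \<in> coord_algebra 0 (enat N)"
      unfolding coord_algebra_eq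
    proof (rule sets.countable_UN'[OF countableI_type], rule image_subsetI)
      fix w assume "w \<in> {w\<in>W. length w = N}"
      then show "(shift ^^ 0) -` cylinder w \<in> sets (sigma UNIV {(\<lambda>\<omega>. \<omega> i) -` S | i S. 0 \<le> i \<and> enat i \<le> enat N})"
        unfolding coord_algebra_eq[symmetric] by (intro shift_cylinder_coord) auto
    qed
    finally have BN: "B \<in> coord_algebra 0 (enat N)" .
    have Bs: "B \<in> sets P" using BN coord_algebra_sets by auto
    have D: "{x \<in> space P. (word shift letter N x \<in> W) \<noteq> (x \<in> A)} = (B - A) \<union> (A - B)"
      by (auto simp: B_def)
    have "measure P A \<le> measure P ((B \<inter> A) \<union> ((B - A) \<union> (A - B)))"
      using A Bs by (intro finite_measure_mono) auto
    also have "\<dots> \<le> measure P (B \<inter> A) + e / 2"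
      using A Bs NW measure_Un_le[of "B \<inter> A" P "(B - A) \<union> (A - B)"] unfolding D by auto
    finally have 1: "measure P A \<le> measure P B * measure P A + e / 2" by (simp add: indep[OF BN])
    have "measure P B \<le> measure P (A \<union> ((B - A) \<union> (A - B)))"
      using A Bs by (intro finite_measure_mono) auto
    also have "\<dots> \<le> measure P A + e / 2"
      using A Bs NW measure_Un_le[of A P "(B - A) \<union> (A - B)"] unfolding D by auto
    finally have "measure P B * measure P A \<le> (measure P A + e / 2) * measure P A"
      by (intro mult_right_mono) auto
    also have "\<dots> \<le> measure P A * measure P A + e / 2"
      using e prob_le_1[of A] by (simp add: distrib_right mult_left_le)
    finally show "measure P A - measure P A * measure P A \<le> 0 + e" using 1 by simp
  qed
  then have "measure P A * (1 - measure P A) \<le> 0" by (simp add: algebra_simps)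
  then show "measure P A = 0 \<or> measure P A = 1"
    using prob_le_1[of A] measure_nonneg[of P A] by (auto simp: mult_le_0_iff)
qed

end


subsection \<open>The Shannon--McMillan--Breiman theorem\<close>

text \<open>The law of \<open>n\<close> independent blocks, viewed as a sub-probability on all
  lists; it is the competitor for \<open>AE_info_le\<close>.\<close>

lemma nn_integral_lists_prod_le:
  fixes p :: "'b::countable \<Rightarrow> ennreal"
  assumes p: "(\<integral>\<^sup>+b. p b \<partial>count_space UNIV) \<le> 1"
  shows "(\<integral>\<^sup>+bs. (if length bs = n then prod_list (map p bs) else 0) \<partial>count_space UNIV) \<le> 1"
proof (induction n)
  case 0
  have "(\<integral>\<^sup>+bs. (if length bs = 0 then prod_list (map p bs) else 0) \<partial>count_space UNIV)
      = (\<integral>\<^sup>+(bs :: 'b list). 1 * indicator {[]} bs \<partial>count_space UNIV)"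
    by (intro nn_integral_cong) (auto simp: indicator_def)
  also have "\<dots> = 1" by (subst nn_integral_indicator_singleton) auto
  finally show ?case by simp
next
  case (Suc n)
  let ?f = "\<lambda>n bs. if length bs = n then prod_list (map p bs) else 0"
  let ?N = "{bs :: 'b list. bs \<noteq> []}"
  have bij: "bij_betw (\<lambda>(b, bs). b # bs) UNIV ?N"
    by (rule bij_betwI[where g = "\<lambda>bs. (hd bs, tl bs)"]) auto
  have "(\<integral>\<^sup>+bs. ?f (Suc n) bs \<partial>count_space UNIV) = (\<integral>\<^sup>+bs. ?f (Suc n) bs * indicator ?N bs \<partial>count_space UNIV)"
    by (intro nn_integral_cong) (auto simp: indicator_def)
  also have "\<dots> = (\<integral>\<^sup>+bs. ?f (Suc n) bs \<partial>count_space ?N)"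
    by (subst nn_integral_count_space_indicator) auto
  also have "\<dots> = (\<integral>\<^sup>+x. ?f (Suc n) (case x of (b, bs) \<Rightarrow> b # bs) \<partial>count_space UNIV)"
    by (rule nn_integral_bij_count_space[OF bij, symmetric])
  also have "\<dots> = (\<integral>\<^sup>+x. (case x of (b, bs) \<Rightarrow> p b * ?f n bs) \<partial>count_space UNIV)"
    by (intro nn_integral_cong) (auto split: prod.splits)
  also have "\<dots> = (\<integral>\<^sup>+b. \<integral>\<^sup>+bs. p b * ?f n bs \<partial>count_space UNIV \<partial>count_space UNIV)"
    by (subst nn_integral_fst_count_space[symmetric]) simp
  also have "\<dots> = (\<integral>\<^sup>+b. p b * (\<integral>\<^sup>+bs. ?f n bs \<partial>count_space UNIV) \<partial>count_space UNIV)"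
    by (intro nn_integral_cong nn_integral_cmult) simp
  also have "\<dots> \<le> (\<integral>\<^sup>+b. p b * 1 \<partial>count_space UNIV)"
    by (intro nn_integral_mono mult_left_mono Suc) simp
  also have "\<dots> \<le> 1" using p by simp
  finally show ?case .
qed

lemma (in prob_space) AE_info_le:
  fixes X :: "nat \<Rightarrow> 'a \<Rightarrow> 'b::countable" and q :: "nat \<Rightarrow> 'b \<Rightarrow> real" and e :: real
  assumes X: "\<And>n. X n \<in> measurable M (count_space UNIV)"
    and sum: "\<And>n. (\<integral>\<^sup>+b. ennreal (q n b) \<partial>count_space UNIV) \<le> 1"
    and pos: "\<And>n. AE x in M. 0 < q n (X n x)" and e: "e > 0"
  shows "AE x in M. \<forall>\<^sub>F n in sequentially. info M (X n) x \<le> - ln (q n (X n x)) + e * n"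
proof -
  let ?p = "\<lambda>n b. measure M (X n -` {b} \<inter> space M)"
  define u where "u n x = ennreal (q n (X n x)) / ennreal (?p n (X n x))" for n x
  define A where "A n = {x \<in> space M. 1 \<le> ennreal (exp (- e * n)) * u n x}" for n
  have u[measurable]: "u n \<in> borel_measurable M" for n
    using measurable_compose[OF X[of n], of "\<lambda>b. ennreal (q n b) / ennreal (?p n b)"] by (simp add: u_def[abs_def])
  have A[measurable]: "A n \<in> sets M" for n unfolding A_def by measurable
  have mA: "measure M (A n) \<le> exp (- e) ^ n" for n
  proof -
    have "emeasure M (A n) = (\<integral>\<^sup>+x. indicator (A n) x \<partial>M)" by simp
    also have "\<dots> \<le> (\<integral>\<^sup>+x. ennreal (exp (- e * n)) * u n x \<partial>M)"
      by (intro nn_integral_mono) (auto simp: A_def indicator_def)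
    also have "\<dots> = ennreal (exp (- e * n)) * (\<integral>\<^sup>+x. u n x \<partial>M)"
      by (rule nn_integral_cmult) measurable
    also have "\<dots> \<le> ennreal (exp (- e * n)) * 1"
    proof (rule mult_left_mono)
      have "(\<integral>\<^sup>+x. u n x \<partial>M) \<le> (\<integral>\<^sup>+b. ennreal (q n b) \<partial>count_space UNIV)"
        unfolding u_def by (rule nn_integral_density_le[OF X])
      then show "(\<integral>\<^sup>+x. u n x \<partial>M) \<le> 1" using sum[of n] by simp
    qed simp
    also have "exp (- e * n) = exp (- e) ^ n" by (simp add: exp_of_nat_mult[symmetric] mult.commute)
    finally show ?thesis by (simp add: emeasure_eq_measure)
  qed
  have "summable (\<lambda>n. measure M (A n))"
    by (rule summable_comparison_test'[OF summable_geometric[of "exp (- e)"], where N = 0])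
       (use e mA in auto)
  then have "AE x in M. \<forall>\<^sub>F n in sequentially. x \<in> space M - A n"
    by (intro borel_cantelli_AE1) (auto simp: emeasure_eq_measure)
  moreover have "AE x in M. \<forall>n. 0 < q n (X n x) \<and> 0 < ?p n (X n x)"
    unfolding AE_all_countable using pos AE_cell_pos[OF X] by auto
  ultimately show ?thesis
  proof eventually_elim
    case (elim x)
    from elim(1) show ?case
    proof eventually_elim
      case (elim n)
      let ?q = "q n (X n x)" and ?c = "?p n (X n x)"
      have pos': "0 < ?q" "0 < ?c" using \<open>\<forall>n. 0 < q n (X n x) \<and> 0 < ?p n (X n x)\<close> by auto
      have "\<not> 1 \<le> ennreal (exp (- e * n)) * u n x" using elim by (simp add: A_def)
      then have "exp (- e * n) * (?q / ?c) < 1"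
        using pos' by (simp add: u_def divide_ennreal ennreal_mult'[symmetric] not_le)
      then have "ln (exp (- e * n) * (?q / ?c)) < 0" using pos' by (subst ln_less_zero_iff) auto
      then show ?case using pos' by (simp add: ln_mult ln_div info_def)
    qed
  qed
qed

section \<open>Blocks of length m as letters of the m-th power\<close>

lemma concat_word_blocks: "concat (word (T ^^ m) (word T Z m) n x) = word T Z (n * m) x"
proof (induction n)
  case (Suc n)
  have "word T Z (Suc n * m) x = word T Z (n * m) x @ word T Z m ((T ^^ (n * m)) x)"
    by (simp add: word_add[symmetric] add.commute)
  then show ?case using Suc by (simp add: word_Suc funpow_mult mult.commute)
qed simp

text \<open>Cutting a word into blocks neither loses nor adds data; by \<open>info_cong\<close> both
  forms therefore have the same information.\<close>

lemma word_blocks_eq_iff: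
  "word (T ^^ m) (word T Z m) n x = word (T ^^ m) (word T Z m) n y \<longleftrightarrow> word T Z (n * m) x = word T Z (n * m) y"
proof
  assume "word (T ^^ m) (word T Z m) n x = word (T ^^ m) (word T Z m) n y"
  then show "word T Z (n * m) x = word T Z (n * m) y" by (metis concat_word_blocks)
next
  assume eq: "word T Z (n * m) x = word T Z (n * m) y"
  have "word T Z m (((T ^^ m) ^^ j) x) = word T Z m (((T ^^ m) ^^ j) y)" if "j < n" for j
  proof -
    have "Suc j * m \<le> n * m" using that by (intro mult_right_mono) auto
    then have le: "m * j + m \<le> n * m" by (simp add: algebra_simps)
    show ?thesis
      using take_drop_word[OF le, of T Z x] take_drop_word[OF le, of T Z y] eq by (simp add: funpow_mult)
  qed
  then show "word (T ^^ m) (word T Z m) n x = word (T ^^ m) (word T Z m) n y" by (simp add: word_def[of "T ^^ m"])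
qed

context psi_mixing_shift
begin

abbreviation letter_info :: "nat \<Rightarrow> (nat \<Rightarrow> 'a) \<Rightarrow> real" where
  "letter_info n \<equiv> info P (word shift letter n)"

lemma letter_info_eq: "letter_info n \<omega> = - ln (measure P (init_cylinder \<omega> n))"
  by (simp add: info_def init_cylinder_word)

lemma init_cylinder_antimono: "m \<le> n \<Longrightarrow> init_cylinder \<omega> n \<subseteq> init_cylinder \<omega> m"
  by (auto simp: init_cylinder_def cylinder_def)

lemma AE_init_cylinder_pos: "AE \<omega> in P. \<forall>n. 0 < measure P (init_cylinder \<omega> n)"
  unfolding AE_all_countable using AE_cell_pos[OF measurable_word[OF measurable_letter]]
  by (simp add: init_cylinder_word)

lemma letter_info_mono:
  assumes "\<And>n. 0 < measure P (init_cylinder \<omega> n)" "m \<le> n"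
  shows "letter_info m \<omega> \<le> letter_info n \<omega>"
proof -
  have "measure P (init_cylinder \<omega> n) \<le> measure P (init_cylinder \<omega> m)"
    by (rule finite_measure_mono[OF init_cylinder_antimono[OF assms(2)]]) (simp add: init_cylinder_def)
  with assms(1) show ?thesis by (simp add: letter_info_eq)
qed

text \<open>The word consists of \<open>J\<close> adjacent blocks, which are separated with gap 0.
  Each costs a factor \<open>1 + rate 0\<close> in \<open>hits_upper\<close>; take
  logarithms.\<close>

lemma letter_info_lower:
  assumes pos: "\<And>n. 0 < measure P (init_cylinder \<omega> n)" and m: "1 \<le> m"
  shows "(\<Sum>j<J. letter_info m (((shift ^^ m) ^^ j) \<omega>)) - J * ln (1 + rate 0) \<le> letter_info (J * m) \<omega>"
proof -
  define b where "b j = map (\<lambda>i. \<omega> (j * m + i)) [0..<m]" for j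
  define xs where "xs = map (\<lambda>j. (j * m, b j)) [0..<J]"
  have b: "init_cylinder (((shift ^^ m) ^^ j) \<omega>) m = cylinder (b j)" for j
  proof -
    have "map (((shift ^^ m) ^^ j) \<omega>) [0..<m] = b j"
      by (rule nth_equalityI) (auto simp: b_def funpow_mult shift_iterate mult.commute)
    then show ?thesis by (simp add: init_cylinder_def)
  qed
  have "separated 0 xs"
  proof -
    have "j * m + m \<le> j' * m" if "j < j'" for j j'
      using mult_right_mono[of "Suc j" j' m] that by simp
    moreover have "b j \<noteq> []" for j using m by (simp add: b_def)
    ultimately show ?thesis
      by (auto simp: separated_def xs_def sorted_wrt_map sorted_wrt_iff_nth_less b_def)
  qed
  note up = hits_upper[OF this]
  have "init_cylinder \<omega> (J * m) \<subseteq> hits xs"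
  proof -
    have "j * m + i < J * m" if "j < J" "i < m" for i j
    proof -
      have "Suc j * m \<le> J * m" using that by (intro mult_right_mono) auto
      with that show ?thesis by simp
    qed
    then show ?thesis
      by (auto simp: hits_def xs_def cylinder_def shift_iterate init_cylinder_def b_def)
  qed
  then have "measure P (init_cylinder \<omega> (J * m)) \<le> measure P (hits xs)" by (rule finite_measure_mono) simp
  also have "\<dots> \<le> (1 + rate 0) ^ J * (\<Prod>j<J. measure P (cylinder (b j)))"
    using up by (simp add: weight_def xs_def comp_def prod.list_conv_set_nth flip: atLeast0LessThan)
  finally have le: "measure P (init_cylinder \<omega> (J * m)) \<le> (1 + rate 0) ^ J * (\<Prod>j<J. measure P (cylinder (b j)))" .
  \<comment> \<open>The block probabilities must be positive before \<open>ln\<close> can be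
    distributed over the product; this is inherited from the long cylinder.\<close>
  have "0 < (1 + rate 0) ^ J * (\<Prod>j<J. measure P (cylinder (b j)))" using le pos[of "J * m"] by linarith
  moreover have r1: "0 < 1 + rate 0" using rate_nonneg[of 0] by linarith
  ultimately have prod: "0 < (\<Prod>j<J. measure P (cylinder (b j)))"
    using zero_less_mult_pos zero_less_power by blast
  have bpos: "0 < measure P (cylinder (b j))" if "j < J" for j
  proof -
    have "measure P (cylinder (b j)) \<noteq> 0"
    proof
      assume "measure P (cylinder (b j)) = 0"
      then have "(\<Prod>j<J. measure P (cylinder (b j))) = 0" using that by (intro prod_zero) auto
      with prod show False by simp
    qed
    then show ?thesis by (simp add: zero_less_measure_iff)
  qed
  have "ln (measure P (init_cylinder \<omega> (J * m))) \<le> ln ((1 + rate 0) ^ J * (\<Prod>j<J. measure P (cylinder (b j))))"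
    by (rule ln_mono[OF le pos])
  also have "\<dots> = ln ((1 + rate 0) ^ J) + ln (\<Prod>j<J. measure P (cylinder (b j)))"
    by (rule ln_mult_pos[OF zero_less_power[OF r1] prod])
  also have "ln ((1 + rate 0) ^ J) = J * ln (1 + rate 0)" by (rule ln_realpow)
  also have "ln (\<Prod>j<J. measure P (cylinder (b j))) = (\<Sum>j<J. ln (measure P (cylinder (b j))))"
    by (rule ln_prod) (use bpos in \<open>auto simp: less_le\<close>)
  finally show ?thesis by (simp add: letter_info_eq b sum_negf)
qed

text \<open>\<open>1 - rate 0\<close> may be negative, so adjacent blocks give no useful lower bound
  on the probability. Instead the true law is compared with that of independent blocks having the
  correct distribution, which wins by at most a subexponential factor almost surely.\<close>

lemma letter_info_upper:
  fixes e :: real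
  assumes m: "1 \<le> m" and e: "e > 0"
  shows "AE \<omega> in P. \<forall>\<^sub>F J in sequentially.
    letter_info (J * m) \<omega> \<le> (\<Sum>j<J. letter_info m (((shift ^^ m) ^^ j) \<omega>)) + e * J"
proof -
  interpret S: mps P "shift ^^ m" by (rule mps_iterate)
  let ?Z = "word shift letter m"
  have Z: "?Z \<in> measurable P (count_space UNIV)" by (rule measurable_word[OF measurable_letter])
  let ?p = "\<lambda>b. measure P (?Z -` {b} \<inter> space P)"
  let ?X = "word (shift ^^ m) ?Z"
  define q where "q J bs = (if length bs = J then prod_list (map ?p bs) else 0)" for J :: nat and bs
  have pl: "ennreal (prod_list (map ?p bs)) = prod_list (map (\<lambda>b. ennreal (?p b)) bs)" for bs
    by (induction bs) (auto simp: ennreal_mult')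
  have "(\<integral>\<^sup>+bs. ennreal (q J bs) \<partial>count_space UNIV) \<le> 1" for J
  proof -
    have "(\<integral>\<^sup>+bs. ennreal (q J bs) \<partial>count_space UNIV)
       = (\<integral>\<^sup>+bs. (if length bs = J then prod_list (map (\<lambda>b. ennreal (?p b)) bs) else 0) \<partial>count_space UNIV)"
    proof (rule nn_integral_cong)
      fix bs
      show "ennreal (q J bs) = (if length bs = J then prod_list (map (\<lambda>b. ennreal (?p b)) bs) else 0)"
        unfolding q_def by (cases "length bs = J") (simp_all only: pl if_True if_False ennreal_0 simp_thms)
    qed
    also have "\<dots> \<le> 1" by (rule nn_integral_lists_prod_le) (simp only: sum_cells[OF Z])
    finally show ?thesis .
  qed
  moreover have q: "q J (?X J \<omega>) = (\<Prod>j<J. ?p (?Z (((shift ^^ m) ^^ j) \<omega>)))" for J \<omega>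
    unfolding q_def by (simp add: word_def[of "shift ^^ m"] comp_def prod.list_conv_set_nth flip: atLeast0LessThan)
  moreover have qpos: "AE \<omega> in P. \<forall>j. 0 < ?p (?Z (((shift ^^ m) ^^ j) \<omega>))"
    unfolding AE_all_countable using S.AE_iterate[OF AE_cell_pos[OF Z]] by blast
  ultimately have "AE \<omega> in P. \<forall>\<^sub>F J in sequentially. info P (?X J) \<omega> \<le> - ln (q J (?X J \<omega>)) + e * J"
    by (intro AE_info_le S.measurable_word Z e) (auto elim!: eventually_mono intro: prod_pos)
  then show ?thesis using qpos
  proof eventually_elim
    case (elim \<omega>)
    have "info P (?X J) \<omega> = letter_info (J * m) \<omega>" for J
      by (rule info_cong) (simp_all only: word_blocks_eq_iff space_P UNIV_I)
    moreover have "- ln (q J (?X J \<omega>)) = (\<Sum>j<J. letter_info m (((shift ^^ m) ^^ j) \<omega>))" for J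
      unfolding q by (subst ln_prod) (use elim(2) in \<open>simp_all add: info_def sum_negf zero_less_measure_iff\<close>)
    ultimately show ?case using elim(1) by simp
  qed
qed

text \<open>Multiples of \<open>m\<close> are settled by the two preceding lemmas and Birkhoff's
  theorem for the \<open>m\<close>-th power. Other lengths lie between \<open>(n div m) * m\<close>
  and the next multiple, and information grows with the length.\<close>

lemma AE_letter_info_bounds:
  assumes m: "1 \<le> m" and int: "integrable P (info P letter)" and d: "\<delta> > 0"
  defines "a \<equiv> integral\<^sup>L P (letter_info m) / m"
  shows "AE \<omega> in P. \<forall>\<^sub>F n in sequentially.
    a - ln (1 + rate 0) / m - \<delta> \<le> letter_info n \<omega> / n \<and> letter_info n \<omega> / n \<le> a + \<delta>"
proof -
  interpret S: ergodic_mps P "shift ^^ m" by (rule ergodic_iterate[OF m])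
  let ?H = "integral\<^sup>L P (letter_info m)"
  \<comment> \<open>Three errors occur in the upper bound: Birkhoff's theorem, the likelihood ratio,
    and rounding \<open>n\<close> to a multiple of \<open>m\<close>.\<close>
  define \<epsilon> where "\<epsilon> = \<delta> / 3"
  have e: "\<epsilon> > 0" using d by (simp add: \<epsilon>_def)
  have im: "integrable P (letter_info m)" by (rule integrable_info_word[OF measurable_letter int])
  define D1 where "D1 = ?H - ln (1 + rate 0) - \<epsilon>"
  define D2 where "D2 = ?H + 2 * \<epsilon>"
  have m0: "real m \<ge> 1" using m by simp
  have em: "\<epsilon> / m \<le> \<epsilon>" using m0 e by (simp add: divide_le_eq)
  have "(\<lambda>n. \<bar>D1\<bar> * (1 / real n)) \<longlonglongrightarrow> \<bar>D1\<bar> * 0" "(\<lambda>n. \<bar>D2\<bar> * (1 / real n)) \<longlonglongrightarrow> \<bar>D2\<bar> * 0"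
    by (intro tendsto_intros lim_1_over_n)+
  then have small: "\<forall>\<^sub>F n in sequentially. \<bar>D1\<bar> * (1 / real n) < \<epsilon>" "\<forall>\<^sub>F n in sequentially. \<bar>D2\<bar> * (1 / real n) < \<epsilon>"
    using e by (auto elim!: order_tendstoD(2))
  have divlim: "filterlim (\<lambda>n. n div m) sequentially sequentially"
    unfolding filterlim_at_top
  proof
    fix Z
    show "\<forall>\<^sub>F n in sequentially. Z \<le> n div m"
      using eventually_ge_at_top[of "Z * m"]
      by eventually_elim (use m in \<open>simp add: less_eq_div_iff_mult_less_eq\<close>)
  qed
  show ?thesis
    using S.birkhoff[OF im e] letter_info_upper[OF m e] AE_init_cylinder_pos
  proof eventually_elim
    case (elim \<omega>)
    then have pos: "\<And>n. 0 < measure P (init_cylinder \<omega> n)" by blast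
    have J: "\<forall>\<^sub>F J in sequentially. J * D1 \<le> letter_info (J * m) \<omega> \<and> letter_info (J * m) \<omega> \<le> J * D2"
      using elim(1,2)
    proof eventually_elim
      case (elim J)
      with letter_info_lower[OF pos m, of J] show ?case
        unfolding D1_def D2_def by (auto simp: algebra_simps abs_le_iff)
    qed
    then obtain N where N: "\<And>J. J \<ge> N \<Longrightarrow> J * D1 \<le> letter_info (J * m) \<omega>"
      "\<And>J. J \<ge> N \<Longrightarrow> letter_info (J * m) \<omega> \<le> J * D2" by (auto simp: eventually_sequentially)
    show ?case
      using small filterlim_at_top[THEN iffD1, OF divlim, rule_format, of N] eventually_ge_at_top[of 1]
    proof eventually_elim
      case (elim n)
      define J where "J = n div m"
      have n0: "real n > 0" using elim(4) by simp
      have "J * m \<le> n" by (simp add: J_def)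
      then have "real (J * m) \<le> real n" by (rule of_nat_mono)
      then have J1: "real J \<le> n / m" using m0 by (simp add: field_simps)
      have "n < Suc J * m" using dividend_less_div_times[of m n] m by (simp add: J_def)
      then have "real n < real (Suc J * m)" by (rule of_nat_less_iff[THEN iffD2])
      then have J2: "n / m - 1 \<le> real J" using m0 by (simp add: field_simps)
      \<comment> \<open>The sign of \<open>D1\<close> is unknown. Rounding changes
        \<open>n / m\<close> by at most 1, hence the product by at most
        \<open>\<bar>D1\<bar>\<close>.\<close>
      have "(n / m) * D1 - \<bar>D1\<bar> \<le> J * D1"
      proof (cases "D1 \<ge> 0")
        case True
        with mult_right_mono[OF J2, of D1] show ?thesis by (simp add: left_diff_distrib)
      next
        case False
        with mult_right_mono_neg[OF J1, of D1] show ?thesis by simp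
      qed
      also have "\<dots> \<le> letter_info (J * m) \<omega>" using N elim(3) by (simp add: J_def)
      also have "\<dots> \<le> letter_info n \<omega>" by (rule letter_info_mono[OF pos \<open>J * m \<le> n\<close>])
      finally have "((n / m) * D1 - \<bar>D1\<bar>) / n \<le> letter_info n \<omega> / n" by (rule divide_right_mono) simp
      then have lo: "D1 / m - \<bar>D1\<bar> * (1 / n) \<le> letter_info n \<omega> / n" using n0 by (simp add: diff_divide_distrib)
      have "letter_info n \<omega> \<le> letter_info (Suc J * m) \<omega>"
        by (rule letter_info_mono[OF pos]) (use \<open>n < Suc J * m\<close> in simp)
      also have "\<dots> \<le> Suc J * D2" using N(2)[of "Suc J"] elim(3) by (simp add: J_def)
      also have "\<dots> \<le> (n / m) * D2 + \<bar>D2\<bar>"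
      proof (cases "D2 \<ge> 0")
        case True
        with mult_right_mono[OF J1, of D2] show ?thesis by (simp add: distrib_right)
      next
        case False
        have "n / m \<le> real (Suc J)" using J2 by simp
        from mult_right_mono_neg[OF this, of D2] False show ?thesis by simp
      qed
      finally have "letter_info n \<omega> / n \<le> ((n / m) * D2 + \<bar>D2\<bar>) / n" by (rule divide_right_mono) simp
      then have hi: "letter_info n \<omega> / n \<le> D2 / m + \<bar>D2\<bar> * (1 / n)" using n0 by (simp add: add_divide_distrib)
      have "D1 / m = a - ln (1 + rate 0) / m - \<epsilon> / m" "D2 / m = a + 2 * (\<epsilon> / m)"
        by (simp_all add: D1_def D2_def a_def diff_divide_distrib add_divide_distrib)
      moreover have "\<delta> = 3 * \<epsilon>" by (simp add: \<epsilon>_def)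
      moreover have "a - c - \<delta> \<le> f \<and> f \<le> a + \<delta>"
        if "d1 - x1 \<le> f" "f \<le> d2 + x2" "x1 < \<epsilon>" "x2 < \<epsilon>" "y \<le> \<epsilon>" "d1 = a - c - y" "d2 = a + 2 * y"
          "\<delta> = 3 * \<epsilon>" "0 < \<epsilon>" for c d1 d2 x1 x2 y f using that by linarith
      ultimately show ?case using lo hi elim(1,2) em e by blast
    qed
  qed
qed

text \<open>The bounds for two block lengths hold at a common point, and comparing them there bounds
  each \<open>?a m - ?c / m\<close> by every other \<open>?a m'\<close>. So \<open>?a m\<close> is
  within \<open>?c / m\<close> of the infimum \<open>h\<close>, which gives both limits.\<close>

theorem shannon_mcmillan_breiman:
  assumes int: "integrable P (info P letter)"
  obtains h where "(\<lambda>n. integral\<^sup>L P (letter_info n) / real n) \<longlonglongrightarrow> h"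
    "AE \<omega> in P. (\<lambda>n. letter_info n \<omega> / real n) \<longlonglongrightarrow> h"
proof -
  let ?a = "\<lambda>m. integral\<^sup>L P (letter_info m) / real m"
  let ?c = "ln (1 + rate 0)"
  let ?Q = "\<lambda>\<omega> m d. \<forall>\<^sub>F n in sequentially. ?a m - ?c / m - d \<le> letter_info n \<omega> / n \<and> letter_info n \<omega> / n \<le> ?a m + d"
  \<comment> \<open>Only countably many tolerances may enter an almost sure statement;
    \<open>Q2\<close> recovers the rest by monotonicity.\<close>
  have Q1: "AE \<omega> in P. \<forall>m k. ?Q \<omega> (Suc m) (1 / Suc k)"
    unfolding AE_all_countable by (intro allI AE_letter_info_bounds int) auto
  have Q2: "?Q \<omega> m d" if all: "\<forall>m k. ?Q \<omega> (Suc m) (1 / Suc k)" and m: "1 \<le> m" and d: "0 < d" for \<omega> m and d :: real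
  proof -
    obtain k where k: "1 / Suc k < d" using reals_Archimedean[OF d] by (auto simp: inverse_eq_divide)
    have "?Q \<omega> m (1 / Suc k)" using all[rule_format, of "m - 1" k] m by simp
    then show ?thesis by eventually_elim (use k in auto)
  qed
  have Q: "AE \<omega> in P. \<forall>m d. 1 \<le> m \<longrightarrow> 0 < d \<longrightarrow> ?Q \<omega> m d"
    using Q1
  proof eventually_elim
    case (elim \<omega>)
    show ?case
    proof (intro allI impI)
      fix m :: nat and d :: real
      assume "1 \<le> m" "0 < d"
      from Q2[OF elim this] show "?Q \<omega> m d" .
    qed
  qed
  have ne: "\<exists>\<omega>. R \<omega>" if "AE \<omega> in P. R \<omega>" for R
    using that eventually_happens[of R "ae_filter P"] AE_False by (auto simp: trivial_limit_def)
  have cross: "?a m - ?c / m \<le> ?a m'" if "1 \<le> m" "1 \<le> m'" for m m'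
  proof (rule field_le_epsilon)
    fix e :: real assume e: "0 < e"
    have "AE \<omega> in P. ?Q \<omega> m (e / 2) \<and> ?Q \<omega> m' (e / 2)"
      using Q by eventually_elim (use that e in auto)
    from ne[OF this] obtain \<omega> where "?Q \<omega> m (e / 2)" "?Q \<omega> m' (e / 2)" by blast
    then have "\<forall>\<^sub>F n in sequentially. ?a m - ?c / m \<le> ?a m' + e" by eventually_elim auto
    then show "?a m - ?c / m \<le> ?a m' + e" by simp
  qed
  define h where "h = Inf (?a ` {1..})"
  have c0: "0 \<le> ?c" by simp
  have h1: "?a m - ?c / m \<le> h" if "1 \<le> m" for m
    unfolding h_def by (intro cInf_greatest) (use cross that in auto)
  have h2: "h \<le> ?a m" if "1 \<le> m" for m
    unfolding h_def
    by (intro cInf_lower bdd_belowI2[of _ "?a 1 - ?c / real 1"]) (use cross[of 1] that in auto)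
  have cm: "\<exists>m\<ge>1. \<forall>n\<ge>m. ?c / real n < e" if "0 < e" for e
  proof -
    have "(\<lambda>n. ?c * (1 / real n)) \<longlonglongrightarrow> ?c * 0" by (intro tendsto_intros lim_1_over_n)
    then have "\<forall>\<^sub>F n in sequentially. ?c / real n < e" using that by (auto dest: order_tendstoD(2))
    then obtain N where "\<And>n. n \<ge> N \<Longrightarrow> ?c / real n < e" by (auto simp: eventually_sequentially)
    then show ?thesis by (intro exI[of _ "max 1 N"]) auto
  qed
  have "?a \<longlonglongrightarrow> h"
  proof (rule LIMSEQ_I)
    fix e :: real assume "0 < e"
    then obtain m where m: "1 \<le> m" "\<And>n. m \<le> n \<Longrightarrow> ?c / real n < e" using cm by blast
    have "norm (?a n - h) < e" if "m \<le> n" for n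
      using h1[of n] h2[of n] m(1) m(2)[OF that] that by (auto simp: abs_less_iff)
    then show "\<exists>no. \<forall>n\<ge>no. norm (?a n - h) < e" by blast
  qed
  moreover have "AE \<omega> in P. (\<lambda>n. letter_info n \<omega> / real n) \<longlonglongrightarrow> h"
    using Q
  proof eventually_elim
    case (elim \<omega>)
    show ?case
    proof (rule tendstoI)
      fix e :: real assume "0 < e"
      then have e: "0 < e / 2" by simp
      then obtain m where m: "1 \<le> m" "?c / real m < e / 2" using cm[OF e] by auto
      have "?Q \<omega> m (e / 2)" using elim m(1) e by blast
      then show "\<forall>\<^sub>F n in sequentially. dist (letter_info n \<omega> / real n) h < e"
        by eventually_elim (use h1[OF m(1)] h2[OF m(1)] m(2) in \<open>auto simp: dist_real_def abs_less_iff\<close>)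
    qed
  qed
  ultimately show ?thesis by (rule that)
qed

end


subsection \<open>Multiple hitting times\<close>

text \<open>The right side is the chord over [0, 1] of a convex function; it makes the variance
  bound linear in the mixing coefficient.\<close>

lemma one_plus_power_le:
  fixes x :: real
  assumes "0 \<le> x" "x \<le> 1" shows "(1 + x) ^ k \<le> 1 + (2 ^ k - 1) * x"
proof (induction k)
  case (Suc k)
  have "(1 + x) ^ Suc k \<le> (1 + x) * (1 + (2 ^ k - 1) * x)"
    using assms Suc by (simp add: mult_left_mono)
  also have "\<dots> = 1 + x + (2 ^ k - 1) * x + (2 ^ k - 1) * (x * x)" by (simp add: algebra_simps)
  also have "\<dots> \<le> 1 + x + (2 ^ k - 1) * x + (2 ^ k - 1) * x"
    using assms by (intro add_left_mono mult_left_mono) (auto simp: mult_left_le)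
  also have "\<dots> = 1 + (2 ^ Suc k - 1) * x" by (simp add: algebra_simps)
  finally show ?case .
qed simp

text \<open>Where no \<open>F j\<close> occurs the counting sum is 0 and its squared distance from
  \<open>J * q\<close> is \<open>(J * q)\<^sup>2\<close>. The centre is a free parameter rather than
  the exact mean, so one-sided bounds on the probabilities suffice.\<close>

lemma (in prob_space) second_moment_bound:
  fixes F :: "nat \<Rightarrow> 'a set"
  assumes F: "\<And>j. F j \<in> sets M"
    and up: "\<And>j. j < J \<Longrightarrow> measure M (F j) \<le> \<beta>" and lo: "\<And>j. j < J \<Longrightarrow> \<alpha> \<le> measure M (F j)"
    and pair: "\<And>i j. i < J \<Longrightarrow> j < J \<Longrightarrow> i \<noteq> j \<Longrightarrow> measure M (F i \<inter> F j) \<le> \<gamma>"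
    and q: "0 \<le> q" and \<gamma>: "0 \<le> \<gamma>"
  shows "(real J * q)\<^sup>2 * measure M (space M - (\<Union>j<J. F j))
    \<le> real J * \<beta> + (real J)\<^sup>2 * \<gamma> - 2 * (real J)\<^sup>2 * q * \<alpha> + (real J * q)\<^sup>2"
proof -
  let ?S = "\<lambda>x. \<Sum>j<J. indicator (F j) x :: real"
  let ?N = "space M - (\<Union>j<J. F j)"
  have iF: "integrable M (indicator A :: 'a \<Rightarrow> real)" if "A \<in> sets M" for A
    using that by (intro integrable_real_indicator) (auto simp: emeasure_eq_measure)
  have eF: "(\<integral>x. indicator A x \<partial>M) = measure M A" if "A \<in> sets M" for A
    using sets.sets_into_space[OF that] by (simp add: Int_absorb2)
  have sq: "(?S x)\<^sup>2 = (\<Sum>i<J. \<Sum>j<J. indicator (F i \<inter> F j) x)" for x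
    by (simp add: power2_eq_square sum_product indicator_inter_arith)
  have iS: "integrable M ?S" by (intro Bochner_Integration.integrable_sum iF F)
  have iS2: "integrable M (\<lambda>x. (?S x)\<^sup>2)"
    unfolding sq by (intro Bochner_Integration.integrable_sum iF sets.Int F)
  have ES: "J * \<alpha> \<le> (\<integral>x. ?S x \<partial>M)"
  proof -
    have "(\<integral>x. ?S x \<partial>M) = (\<Sum>j<J. measure M (F j))"
      by (subst Bochner_Integration.integral_sum) (auto intro!: iF F simp: eF F)
    also have "\<dots> \<ge> (\<Sum>j<J. \<alpha>)" by (intro sum_mono) (simp add: lo)
    finally show ?thesis by simp
  qed
  have ES2: "(\<integral>x. (?S x)\<^sup>2 \<partial>M) \<le> real J * \<beta> + (real J)\<^sup>2 * \<gamma>"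
  proof -
    have "(\<integral>x. (?S x)\<^sup>2 \<partial>M) = (\<Sum>i<J. \<Sum>j<J. measure M (F i \<inter> F j))"
      unfolding sq by (simp add: Bochner_Integration.integral_sum iF eF F sets.Int)
    also have "\<dots> \<le> (\<Sum>i<J. \<Sum>j<J. (if j = i then \<beta> else 0) + \<gamma>)"
    proof (intro sum_mono)
      fix i j assume "i \<in> {..<J}" "j \<in> {..<J}"
      then show "measure M (F i \<inter> F j) \<le> (if j = i then \<beta> else 0) + \<gamma>"
        using up[of i] pair[of i j] \<gamma> by auto
    qed
    also have "\<dots> = real J * \<beta> + (real J)\<^sup>2 * \<gamma>" by (simp add: sum.distrib power2_eq_square algebra_simps)
    finally show ?thesis .
  qed
  have "(J * q)\<^sup>2 * measure M ?N = (\<integral>x. (J * q)\<^sup>2 * indicator ?N x \<partial>M)"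
    using F by (subst Bochner_Integration.integral_mult_right_zero) (auto simp: eF)
  also have "\<dots> \<le> (\<integral>x. (?S x)\<^sup>2 - 2 * (J * q) * ?S x + (J * q)\<^sup>2 \<partial>M)"
  proof (rule integral_mono)
    show "integrable M (\<lambda>x. (J * q)\<^sup>2 * indicator ?N x :: real)"
      using F by (intro integrable_mult_right iF) auto
    show "integrable M (\<lambda>x. (?S x)\<^sup>2 - 2 * (J * q) * ?S x + (J * q)\<^sup>2)"
      using iS iS2 by simp
    fix x
    have "0 \<le> (?S x - J * q)\<^sup>2" by simp
    then have sq0: "0 \<le> (?S x)\<^sup>2 - 2 * (J * q) * ?S x + (J * q)\<^sup>2" by (simp add: power2_diff algebra_simps)
    show "(J * q)\<^sup>2 * indicator ?N x \<le> (?S x)\<^sup>2 - 2 * (J * q) * ?S x + (J * q)\<^sup>2"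
    proof (cases "x \<in> ?N")
      case True
      then have "?S x = 0" by (intro sum.neutral) (auto simp: indicator_def)
      with True show ?thesis by simp
    next
      case False
      then have "indicator ?N x = (0::real)" by (rule indicator_simps(2))
      with sq0 show ?thesis by simp
    qed
  qed
  also have "\<dots> = (\<integral>x. (?S x)\<^sup>2 \<partial>M) - 2 * (J * q) * (\<integral>x. ?S x \<partial>M) + (J * q)\<^sup>2"
    using iS iS2 by (simp add: prob_space)
  also have "\<dots> \<le> (real J * \<beta> + (real J)\<^sup>2 * \<gamma>) - 2 * (J * q) * (J * \<alpha>) + (J * q)\<^sup>2"
    using ES2 mult_left_mono[OF ES, of "2 * (J * q)"] q by auto
  finally show ?thesis by (simp add: power2_eq_square mult_ac)
qed

section \<open>Simultaneous visits to a cylinder\<close>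

definition multi_hit :: "nat \<Rightarrow> (nat \<Rightarrow> nat) \<Rightarrow> (nat \<Rightarrow> 'a) set \<Rightarrow> nat \<Rightarrow> (nat \<Rightarrow> 'a) set" where
  "multi_hit l d A k = {\<eta>. \<forall>i\<in>{1..l}. (shift ^^ (d i * k)) \<eta> \<in> A}"

lemma hitting_time_multi_hit: "hitting_time l d A \<eta> = Inf {enat k | k. 1 \<le> k \<and> \<eta> \<in> multi_hit l d A k}"
  unfolding hitting_time_def multi_hit_def
  by (simp only: prod_eq_1_iff[OF finite_atLeastAtMost] indicator_eq_1_iff mem_Collect_eq)

lemma hitting_time_le:
  assumes "1 \<le> k" "\<eta> \<in> multi_hit l d A k"
  obtains j where "hitting_time l d A \<eta> = enat j" "1 \<le> j" "j \<le> k" "\<eta> \<in> multi_hit l d A j"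
proof -
  let ?S = "{enat k | k. 1 \<le> k \<and> \<eta> \<in> multi_hit l d A k}"
  have S: "?S \<noteq> {}" using assms by blast
  then have "Inf ?S \<in> ?S" unfolding Inf_enat_def by (simp only: if_False) (rule LeastI_ex, blast)
  then obtain j where j: "Inf ?S = enat j" "1 \<le> j" "\<eta> \<in> multi_hit l d A j" by blast
  have "Inf ?S \<le> enat k" by (rule Inf_lower) (use assms in blast)
  then show ?thesis using j that[of j] by (simp add: hitting_time_multi_hit)
qed

lemma ln_of_scaled:
  fixes e p :: real
  assumes "0 < p" shows "ln (exp e / p ^ l) = e - l * ln p"
  using assms by (simp add: ln_div ln_realpow)

locale multiple_hitting = psi_mixing_shift P for P :: "(nat \<Rightarrow> 'a::countable) measure" +
  fixes l :: nat and d :: "nat \<Rightarrow> nat"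
  assumes l: "1 \<le> l" and d1: "1 \<le> d 1" and d_mono: "strict_mono_on {1..l} d"
begin

lemma d_less: "i \<in> {1..l} \<Longrightarrow> j \<in> {1..l} \<Longrightarrow> i < j \<Longrightarrow> d i + 1 \<le> d j"
  using strict_mono_onD[OF d_mono, of i j] by simp

lemma d_pos: "i \<in> {1..l} \<Longrightarrow> 1 \<le> d i"
  using d1 strict_mono_onD[OF d_mono, of 1 i] l by (cases "i = 1") auto

lemma d_max: "i \<in> {1..l} \<Longrightarrow> d i \<le> d l"
  using strict_mono_onD[OF d_mono, of i l] l by (cases "i = l") auto

definition single :: "'a list \<Rightarrow> nat \<Rightarrow> (nat \<times> 'a list) list" where
  "single w k = map (\<lambda>i. (d i * k, w)) [1..<Suc l]"

text \<open>The windows of \<open>k\<close> and \<open>k'\<close> are interleaved because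
  \<open>separated\<close> requires increasing positions. The number \<open>m\<close> of indices is
  a parameter for the induction in \<open>separated_double\<close>.\<close>

definition double :: "'a list \<Rightarrow> nat \<Rightarrow> nat \<Rightarrow> nat \<Rightarrow> (nat \<times> 'a list) list" where
  "double w k k' m = concat (map (\<lambda>i. [(d i * k, w), (d i * k', w)]) [1..<Suc m])"

lemma multi_hit_single: "multi_hit l d (cylinder w) k = hits (single w k)"
  by (auto simp: multi_hit_def hits_def single_def)

lemma multi_hit_double: "multi_hit l d (cylinder w) k \<inter> multi_hit l d (cylinder w) k' = hits (double w k k' l)"
  by (auto simp: multi_hit_def hits_def double_def simp del: upt_Suc)

lemma multi_hit_sets: "multi_hit l d (cylinder w) k \<in> sets P"
  by (simp add: multi_hit_single hits_sets)

lemma weight_single: "weight (single w k) = measure P (cylinder w) ^ l" "length (single w k) = l"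
  by (auto simp: weight_def single_def comp_def map_replicate_const simp del: upt_Suc)

lemma length_double: "length (double w k k' m) = 2 * m"
  by (induction m) (auto simp: double_def)

lemma weight_double: "weight (double w k k' m) = measure P (cylinder w) ^ (2 * m)"
  by (induction m) (auto simp: double_def weight_def power2_eq_square)

text \<open>The \<open>d i\<close> are distinct integers, so consecutive windows start at least
  \<open>k\<close> apart.\<close>

lemma separated_single:
  assumes w: "w \<noteq> []" and k: "length w + g \<le> k"
  shows "separated g (single w k)"
proof -
  have "d i * k + length w + g \<le> d j * k" if "i \<in> {1..l}" "j \<in> {1..l}" "i < j" for i j
    using mult_right_mono[OF d_less[OF that], of k] k by (simp add: distrib_right)
  then show ?thesis
    using w by (auto simp: separated_def single_def sorted_wrt_map sorted_wrt_iff_nth_less simp del: upt_Suc)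
qed

text \<open>For one index the two windows start \<open>d i * t\<close> apart, at least
  \<open>t\<close>. For different indices the later time moves a window by at most
  \<open>d l * t\<close>, while the next index starts at least \<open>k\<close> further on.\<close>

lemma separated_double:
  assumes w: "w \<noteq> []" and t: "length w + g \<le> t" and k: "d l * t + length w + g \<le> k"
  shows "m \<le> l \<Longrightarrow> separated g (double w k (k + t) m)"
proof (induction m)
  case 0
  show ?case by (simp add: double_def separated_def)
next
  case (Suc m)
  have new: "d i * k' + length w + g \<le> d (Suc m) * k''"
    if i: "i \<in> {1..m}" and k': "k' = k \<or> k' = k + t" and k'': "k'' = k \<or> k'' = k + t" for i k' k''
  proof -
    have il: "i \<in> {1..l}" "Suc m \<in> {1..l}" "i < Suc m" using i Suc.prems by auto
    have "d i * k' \<le> d i * (k + t)" using k' by auto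
    also have "\<dots> \<le> d i * k + d l * t" using d_max[OF il(1)] by (simp add: distrib_left mult_right_mono)
    finally have "d i * k' + length w + g \<le> d i * k + k" using k by simp
    also have "\<dots> = (d i + 1) * k" by simp
    also have "\<dots> \<le> d (Suc m) * k" using d_less[OF il] by (rule mult_right_mono) simp
    also have "\<dots> \<le> d (Suc m) * k''" using k'' by auto
    finally show ?thesis .
  qed
  have "1 \<le> d (Suc m)" using Suc.prems by (intro d_pos) auto
  then have "t \<le> d (Suc m) * t" by simp
  with t have "length w + g \<le> d (Suc m) * t" by (rule order_trans)
  then have own: "d (Suc m) * k + length w + g \<le> d (Suc m) * (k + t)" by (simp add: distrib_left)
  have eq: "double w k (k + t) (Suc m) = double w k (k + t) m @ [(d (Suc m) * k, w), (d (Suc m) * (k + t), w)]"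
    by (simp add: double_def)
  have old: "p + length w' + g \<le> d (Suc m) * k'' \<and> w' \<noteq> []"
    if pw: "(p, w') \<in> set (double w k (k + t) m)" and k'': "k'' = k \<or> k'' = k + t" for p w' k''
  proof -
    have "\<exists>i\<in>{1..m}. (p = d i * k \<or> p = d i * (k + t)) \<and> w' = w"
      using pw by (fastforce simp: double_def simp del: upt_Suc)
    then obtain i where "i \<in> {1..m}" "p = d i * k \<or> p = d i * (k + t)" "w' = w" by blast
    then show ?thesis using new[of i k k''] new[of i "k + t" k''] k'' w by auto
  qed
  show ?case
    using Suc old[of _ _ k] old[of _ _ "k + t"] own w
    unfolding eq separated_def sorted_wrt_append by auto
qed

lemma prob_multi_hit_le:
  assumes w: "w \<noteq> []" and k: "length w + g \<le> k"
  shows "measure P (multi_hit l d (cylinder w) k) \<le> (1 + rate g) ^ l * measure P (cylinder w) ^ l"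
  using hits_upper[OF separated_single[OF w k]] by (simp add: multi_hit_single weight_single)

lemma prob_multi_hit_ge:
  assumes w: "w \<noteq> []" and k: "length w + g \<le> k" and g: "rate g \<le> 1"
  shows "(1 - rate g) ^ l * measure P (cylinder w) ^ l \<le> measure P (multi_hit l d (cylinder w) k)"
  using hits_lower[OF separated_single[OF w k] g] by (simp add: multi_hit_single weight_single)

lemma prob_multi_hit_Int_le:
  assumes w: "w \<noteq> []" and t: "length w + g \<le> t" and k: "d l * t + length w + g \<le> k"
  shows "measure P (multi_hit l d (cylinder w) k \<inter> multi_hit l d (cylinder w) (k + t))
    \<le> (1 + rate g) ^ (2 * l) * measure P (cylinder w) ^ (2 * l)"
  using hits_upper[OF separated_double[OF w t k order_refl]]
  by (simp add: multi_hit_double weight_double length_double)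

lemma prob_early_hit_le:
  assumes w: "w \<noteq> []"
  shows "measure P (\<Union>k\<in>{1..K}. multi_hit l d (cylinder w) k)
    \<le> length w * measure P (cylinder w) + K * ((1 + rate 0) ^ l * measure P (cylinder w) ^ l)"
proof -
  let ?E = "multi_hit l d (cylinder w)" and ?c = "(1 + rate 0) ^ l * measure P (cylinder w) ^ l"
  have c: "0 \<le> ?c" by (intro mult_nonneg_nonneg zero_le_power add_nonneg_nonneg) auto
  have "measure P (\<Union>k\<in>{1..K}. ?E k) \<le> (\<Sum>k\<in>{1..K}. measure P (?E k))"
    by (intro measure_UNION_le multi_hit_sets) auto
  also have "\<dots> \<le> (\<Sum>k\<in>{1..K}. (if k < length w then measure P (cylinder w) else 0) + ?c)"
  proof (rule sum_mono)
    fix k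
    show "measure P (?E k) \<le> (if k < length w then measure P (cylinder w) else 0) + ?c"
    proof (cases "k < length w")
      case True
      \<comment> \<open>Windows may overlap here, so only the one with index 1 is kept.\<close>
      have "?E k \<subseteq> (shift ^^ (d 1 * k)) -` cylinder w" using l by (auto simp: multi_hit_def)
      moreover have "(shift ^^ (d 1 * k)) -` cylinder w \<in> sets P"
        using measurable_sets[OF measurable_iterate cylinder_sets, of "d 1 * k" w] by simp
      ultimately have "measure P (?E k) \<le> measure P ((shift ^^ (d 1 * k)) -` cylinder w)"
        by (rule finite_measure_mono)
      with c have "measure P (?E k) \<le> measure P (cylinder w) + ?c"
        unfolding measure_shift_cylinder by linarith
      with True show ?thesis by (simp only: if_True)
    next
      case False
      then show ?thesis using prob_multi_hit_le[OF w, of 0 k] by simp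
    qed
  qed
  also have "\<dots> = (\<Sum>k\<in>{1..K}. if k < length w then measure P (cylinder w) else 0) + K * ?c"
    by (simp add: sum.distrib)
  also have "(\<Sum>k\<in>{1..K}. if k < length w then measure P (cylinder w) else 0)
      = (\<Sum>k\<in>{1..K} \<inter> {..<length w}. measure P (cylinder w))"
    by (subst sum.inter_restrict) (auto intro: sum.cong)
  also have "\<dots> \<le> (\<Sum>k\<in>{..<length w}. measure P (cylinder w))"
    by (rule sum_mono2) auto
  finally show ?thesis by simp
qed

text \<open>Stated for every visit, not only the first, so that it can be applied to whichever visit
  realises the hitting time.\<close>

lemma AE_hit_late:
  fixes e :: real
  assumes pos: "\<And>n. 0 < measure P (init_cylinder \<omega> n)" and e: "0 < e"
  shows "AE \<eta> in P. \<forall>\<^sub>F n in sequentially. \<forall>k\<ge>1. \<eta> \<in> multi_hit l d (init_cylinder \<omega> n) k \<longrightarrow>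
    - e * n \<le> ln k + l * ln (measure P (init_cylinder \<omega> n))"
proof -
  define p where "p n = measure P (init_cylinder \<omega> n)" for n
  have p0: "0 < p n" for n using pos by (simp add: p_def)
  \<comment> \<open>The largest number of times for which the union bound still gives
    \<open>K n * p n ^ l \<le> exp (- e * n)\<close>; it may be 0.\<close>
  define K where "K n = nat \<lfloor>exp (- e * n) / p n ^ l\<rfloor>" for n
  have Kle: "K n \<le> exp (- e * n) / p n ^ l" for n
    unfolding K_def using p0[of n] by (intro of_nat_floor) (simp add: less_imp_le)
  define B where "B n = (\<Union>k\<in>{1..K n}. multi_hit l d (init_cylinder \<omega> n) k)" for n
  have B: "B n \<in> sets P" for n
    unfolding B_def init_cylinder_def by (intro sets.finite_UN multi_hit_sets) auto
  have mB: "measure P (B n) \<le> n * p n + (1 + rate 0) ^ l * exp (- e) ^ n" if "1 \<le> n" for n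
  proof -
    have "map \<omega> [0..<n] \<noteq> []" using that by simp
    from prob_early_hit_le[OF this, of "K n"]
    have "measure P (B n) \<le> n * p n + K n * ((1 + rate 0) ^ l * p n ^ l)"
      by (simp add: B_def p_def init_cylinder_def)
    also have "K n * ((1 + rate 0) ^ l * p n ^ l) \<le> exp (- e * n) / p n ^ l * ((1 + rate 0) ^ l * p n ^ l)"
      using Kle[of n] p0[of n] by (intro mult_right_mono) (auto intro!: mult_nonneg_nonneg add_nonneg_nonneg)
    also have "\<dots> = (1 + rate 0) ^ l * exp (- e * n)" using p0[of n] by (simp add: less_imp_neq[symmetric])
    also have "exp (- e * n) = exp (- e) ^ n" by (simp add: exp_of_nat_mult[symmetric] mult.commute)
    finally show ?thesis by simp
  qed
  have "summable (\<lambda>n. n * p n + (1 + rate 0) ^ l * exp (- e) ^ n)"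
    using e init_cylinder_summable[of \<omega>] unfolding p_def
    by (intro summable_add summable_mult summable_geometric) auto
  then have "summable (\<lambda>n. measure P (B n))"
    by (rule summable_comparison_test'[where N = 1]) (use mB in auto)
  then have "AE \<eta> in P. \<forall>\<^sub>F n in sequentially. \<eta> \<in> space P - B n"
    using B by (intro borel_cantelli_AE1) (auto simp: emeasure_eq_measure)
  then show ?thesis
  proof eventually_elim
    case (elim \<eta>)
    then show ?case
    proof eventually_elim
      case (elim n)
      show ?case
      proof (intro allI impI)
        fix k assume k: "1 \<le> k" "\<eta> \<in> multi_hit l d (init_cylinder \<omega> n) k"
        have "K n < k" using elim k by (auto simp: B_def not_le[symmetric])
        then have "exp (- e * n) / p n ^ l < k" unfolding K_def by linarith
        moreover have "0 < exp (- e * n) / p n ^ l" using p0[of n] by simp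
        ultimately have "ln (exp (- e * n) / p n ^ l) \<le> ln k" by (intro ln_mono) auto
        then show "- e * n \<le> ln k + l * ln (measure P (init_cylinder \<omega> n))"
          using ln_of_scaled[OF p0[of n], of "- e * n" l] by (simp add: p_def)
      qed
    qed
  qed
qed

text \<open>Chebyshev's inequality centred at \<open>J * P(A)^l\<close>, the count expected under
  independence. The first term comes from the diagonal of the second moment, the second from the
  defect of independence.\<close>

lemma prob_no_hit_le:
  assumes w: "w \<noteq> []" and pos: "0 < measure P (cylinder w)" and g: "rate g \<le> 1"
    and s: "length w + g \<le> s" and J: "0 < J"
  shows "measure P (space P - (\<Union>j<J. multi_hit l d (cylinder w) ((d l + 1) * (s * J) + s * j)))
    \<le> 2 ^ l / (J * measure P (cylinder w) ^ l) + (4 ^ l + 2 * l) * rate g"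
proof -
  \<comment> \<open>Two times differ by a multiple t of \<open>s\<close> with
    \<open>t + s \<le> s * J\<close>. The offset \<open>(d l + 1) * (s * J)\<close> is thus at least
    \<open>d l * t + s\<close>, as \<open>separated_double\<close> requires.\<close>
  define k where "k j = (d l + 1) * (s * J) + s * j" for j
  let ?F = "\<lambda>j. multi_hit l d (cylinder w) (k j)"
  let ?q = "measure P (cylinder w) ^ l" and ?r = "rate g"
  have q0: "0 < ?q" using pos by simp
  have kge: "length w + g \<le> k j" for j
  proof -
    have "s \<le> (d l + 1) * (s * J)" using J by (cases J) auto
    then show ?thesis using s by (simp add: k_def)
  qed
  have pair: "measure P (?F i \<inter> ?F j) \<le> (1 + ?r) ^ (2 * l) * ?q\<^sup>2" if ij: "i < j" "j < J" for i j
  proof -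
    define t where "t = s * (j - i)"
    have kj: "k j = k i + t" using ij by (simp add: k_def t_def diff_mult_distrib2)
    have t: "length w + g \<le> t" using s ij by (cases "j - i") (auto simp: t_def)
    have "j - i + 1 \<le> J" using ij by simp
    then have "s * (j - i + 1) \<le> s * J" by (rule mult_left_mono) simp
    then have ts: "t + s \<le> s * J" by (simp add: t_def distrib_left)
    then have "d l * t + s \<le> d l * (s * J) + s * J" using J by (intro add_mono mult_left_mono) auto
    also have "\<dots> \<le> k i" by (simp add: k_def)
    finally have "d l * t + length w + g \<le> k i" using s by simp
    from prob_multi_hit_Int_le[OF w t this] show ?thesis
      by (simp add: kj power_mult[symmetric] mult.commute)
  qed
  have Jq: "0 < (real J * ?q)\<^sup>2" using pos J by simp
  have "(real J * ?q)\<^sup>2 * measure P (space P - (\<Union>j<J. ?F j))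
    \<le> real J * ((1 + ?r) ^ l * ?q) + (real J)\<^sup>2 * ((1 + ?r) ^ (2 * l) * ?q\<^sup>2)
      - 2 * (real J)\<^sup>2 * ?q * ((1 - ?r) ^ l * ?q) + (real J * ?q)\<^sup>2"
  proof (rule second_moment_bound[OF multi_hit_sets])
    show "measure P (?F j) \<le> (1 + ?r) ^ l * ?q" for j by (rule prob_multi_hit_le[OF w kge])
    show "(1 - ?r) ^ l * ?q \<le> measure P (?F j)" for j by (rule prob_multi_hit_ge[OF w kge g])
    show "measure P (?F i \<inter> ?F j) \<le> (1 + ?r) ^ (2 * l) * ?q\<^sup>2" if "i < J" "j < J" "i \<noteq> j" for i j
      using that pair[of i j] pair[of j i] by (cases "i < j") (auto simp: Int_commute)
  qed auto
  also have "\<dots> = (J * ?q)\<^sup>2 * ((1 + ?r) ^ l / (J * ?q) + (1 + ?r) ^ (2 * l) - 2 * (1 - ?r) ^ l + 1)"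
    using pos J by (simp add: power2_eq_square field_simps)
  finally have "measure P (space P - (\<Union>j<J. ?F j))
      \<le> (1 + ?r) ^ l / (J * ?q) + (1 + ?r) ^ (2 * l) - 2 * (1 - ?r) ^ l + 1"
    by (simp only: mult_le_cancel_left_pos[OF Jq])
  \<comment> \<open>The parts free of \<open>?r\<close> cancel, 1 - 2 + 1 = 0. The chord bound and
    Bernoulli's inequality leave a multiple of \<open>?r\<close>.\<close>
  also have "\<dots> \<le> 2 ^ l / (J * ?q) + (1 + (2 ^ (2 * l) - 1) * ?r) - 2 * (1 - l * ?r) + 1"
  proof -
    have "(1 + ?r) ^ l / (J * ?q) \<le> 2 ^ l / (J * ?q)"
      using g q0 by (intro divide_right_mono power_mono) auto
    moreover have "(1 + ?r) ^ (2 * l) \<le> 1 + (2 ^ (2 * l) - 1) * ?r"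
      using g by (intro one_plus_power_le) auto
    moreover have "1 - l * ?r \<le> (1 - ?r) ^ l"
      using Bernoulli_inequality[of "- ?r" l] g by simp
    moreover have "a + b - 2 * c + 1 \<le> a' + b' - 2 * c' + 1" if "a \<le> a'" "b \<le> b'" "c' \<le> c" for a a' b b' c c' :: real
      using that by linarith
    ultimately show ?thesis by blast
  qed
  also have "\<dots> \<le> 2 ^ l / (J * ?q) + (4 ^ l + 2 * l) * ?r"
  proof -
    have four: "(2 :: real) ^ (2 * l) = 4 ^ l" by (simp add: power_mult)
    show ?thesis unfolding four by (simp add: algebra_simps)
  qed
  finally show ?thesis by (simp add: k_def)
qed

text \<open>\<open>prob_no_hit_le\<close> is used with gap n and spacing \<open>2 * n\<close>, the
  word length plus the gap. Then the failure probability is an exponentially small term plus a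
  multiple of \<open>rate n\<close>, both summable.\<close>

lemma AE_hit_early:
  fixes e :: real
  assumes pos: "\<And>n. 0 < measure P (init_cylinder \<omega> n)" and e: "0 < e" and sum: "summable rate"
  shows "AE \<eta> in P. \<forall>\<^sub>F n in sequentially. \<exists>k\<ge>1. \<eta> \<in> multi_hit l d (init_cylinder \<omega> n) k \<and>
    ln k + l * ln (measure P (init_cylinder \<omega> n)) \<le> 2 * e * n"
proof -
  define p where "p n = measure P (init_cylinder \<omega> n)" for n
  have p0: "0 < p n" "p n \<le> 1" for n using pos by (auto simp: p_def)
  define x where "x n = exp (e * n) / p n ^ l" for n
  have x1: "1 \<le> x n" for n
  proof -
    have "p n ^ l \<le> 1" using p0[of n] by (intro power_le_one) auto
    also have "1 \<le> exp (e * n)" using e by simp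
    finally show ?thesis using p0[of n] by (simp add: x_def)
  qed
  \<comment> \<open>\<open>x n\<close> is chosen so that \<open>J n * p n ^ l\<close> is at least
    \<open>exp (e * n)\<close>. Since \<open>x n \<ge> 1\<close>, rounding up at most doubles
    it.\<close>
  define J where "J n = nat \<lceil>x n\<rceil>" for n
  have J: "x n \<le> J n" "J n \<le> 2 * x n" "0 < J n" for n
    using x1[of n] unfolding J_def by linarith+
  define k where "k n j = (d l + 1) * (2 * n * J n) + 2 * n * j" for n j
  define B where "B n = space P - (\<Union>j<J n. multi_hit l d (init_cylinder \<omega> n) (k n j))" for n
  have B: "B n \<in> sets P" for n
    unfolding B_def init_cylinder_def by (intro sets.Diff sets.top sets.finite_UN multi_hit_sets) auto
  obtain N0 where N0: "\<And>n. n \<ge> N0 \<Longrightarrow> rate n < 1"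
    using order_tendstoD(2)[OF rate_tendsto, of 1] by (auto simp: eventually_sequentially)
  have mB: "measure P (B n) \<le> 2 ^ l * exp (- e) ^ n + (4 ^ l + 2 * l) * rate n" if n: "max 1 N0 \<le> n" for n
  proof -
    have "map \<omega> [0..<n] \<noteq> []" using n by simp
    moreover have "0 < measure P (cylinder (map \<omega> [0..<n]))" using pos[of n] by (simp add: init_cylinder_def)
    moreover have "rate n \<le> 1" using N0[of n] n by simp
    ultimately have "measure P (B n) \<le> 2 ^ l / (J n * p n ^ l) + (4 ^ l + 2 * l) * rate n"
      using prob_no_hit_le[of "map \<omega> [0..<n]" n "2 * n" "J n"] J(3)[of n]
      by (simp add: B_def k_def p_def init_cylinder_def)
    also have "2 ^ l / (J n * p n ^ l) \<le> 2 ^ l / (x n * p n ^ l)"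
      using J(1)[of n] x1[of n] p0[of n] by (intro divide_left_mono mult_right_mono mult_pos_pos) auto
    also have "2 ^ l / (x n * p n ^ l) = 2 ^ l * exp (- e) ^ n"
      using p0[of n] by (simp add: x_def exp_minus exp_of_nat_mult[symmetric] field_simps power_inverse)
    finally show ?thesis by simp
  qed
  have "summable (\<lambda>n. 2 ^ l * exp (- e) ^ n + (4 ^ l + 2 * l) * rate n)"
    using e sum by (intro summable_add summable_mult summable_geometric) auto
  then have "summable (\<lambda>n. measure P (B n))"
    by (rule summable_comparison_test'[where N = "max 1 N0"]) (use mB in auto)
  then have AE: "AE \<eta> in P. \<forall>\<^sub>F n in sequentially. \<eta> \<in> space P - B n"
    using B by (intro borel_cantelli_AE1) (auto simp: emeasure_eq_measure)
  \<comment> \<open>All times tried are at most \<open>(d l + 2) * 2 * n * J n\<close>, and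
    \<open>J n \<le> 2 * x n\<close>; together this is \<open>C * n * x n\<close>.\<close>
  define C where "C = 4 * (real (d l) + 2)"
  have C: "1 \<le> C" by (simp add: C_def)
  have "(\<lambda>n. ln C * (1 / real n) + ln (real n) / real n) \<longlonglongrightarrow> ln C * 0 + 0"
    by (intro tendsto_intros lim_1_over_n lim_ln_over_n)
  then have small: "\<forall>\<^sub>F n in sequentially. ln C * (1 / real n) + ln (real n) / real n < e"
    using e by (auto dest: order_tendstoD(2))
  show ?thesis
    using AE
  proof eventually_elim
    case (elim \<eta>)
    then show ?case
      using small eventually_ge_at_top[of 1]
    proof eventually_elim
      case (elim n)
      then have n: "1 \<le> n" by simp
      from elim(1) obtain j where j: "j < J n" "\<eta> \<in> multi_hit l d (init_cylinder \<omega> n) (k n j)"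
        by (auto simp: B_def)
      have "1 \<le> 2 * n * J n" using n J(3)[of n] by simp
      also have "\<dots> \<le> k n j" by (simp add: k_def)
      finally have k1: "1 \<le> k n j" .
      have "k n j \<le> (d l + 1) * (2 * n * J n) + 2 * n * J n"
        unfolding k_def using j(1) by (intro add_left_mono mult_left_mono) auto
      also have "\<dots> = (d l + 2) * 2 * n * J n" by (simp add: algebra_simps)
      finally have "real (k n j) \<le> real ((d l + 2) * 2 * n * J n)" by (rule of_nat_mono)
      also have "\<dots> = (real (d l) + 2) * 2 * n * real (J n)" by (simp add: algebra_simps)
      also have "\<dots> \<le> (real (d l) + 2) * 2 * n * (2 * x n)"
        using J(2)[of n] by (intro mult_left_mono) auto
      also have "\<dots> = C * n * x n" by (simp add: C_def)
      finally have "ln (k n j) \<le> ln (C * n * x n)" using k1 by (intro ln_mono) auto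
      also have "\<dots> = ln C + ln n + ln (x n)"
        using C n x1[of n] by (simp add: ln_mult)
      also have "ln (x n) = e * n - l * ln (p n)"
        unfolding x_def by (rule ln_of_scaled[OF p0(1)])
      finally have 1: "ln (k n j) + l * ln (p n) \<le> ln C + ln n + e * n" by simp
      have "ln C + ln n = n * (ln C * (1 / real n) + ln (real n) / real n)"
        using n by (simp add: distrib_left)
      also have "\<dots> \<le> n * e" using elim(2) by (intro mult_left_mono) auto
      finally have "ln (k n j) + l * ln (p n) \<le> 2 * e * n" using 1 by (simp add: algebra_simps)
      with k1 j show ?case by (auto simp: p_def)
    qed
  qed
qed

text \<open>An early visit makes the hitting time finite and bounds it above; the first visit is
  itself a visit, so \<open>AE_hit_late\<close> bounds it below. Tolerances \<open>1 / Suc i\<close>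
  put the quantifier over \<open>e\<close> inside the almost sure statement.\<close>

lemma AE_hitting_time:
  assumes pos: "\<And>n. 0 < measure P (init_cylinder \<omega> n)" and sum: "summable rate"
  shows "AE \<eta> in P. \<forall>e::real. 0 < e \<longrightarrow> (\<forall>\<^sub>F n in sequentially. \<exists>k. hitting_time l d (init_cylinder \<omega> n) \<eta> = enat k \<and>
    \<bar>ln k + l * ln (measure P (init_cylinder \<omega> n))\<bar> \<le> e * n)"
proof -
  let ?L = "\<lambda>n. l * ln (measure P (init_cylinder \<omega> n))"
  have main: "AE \<eta> in P. \<forall>\<^sub>F n in sequentially. \<exists>k. hitting_time l d (init_cylinder \<omega> n) \<eta> = enat k \<and>
    \<bar>ln k + ?L n\<bar> \<le> e * n" if e: "0 < e" for e :: real
  proof -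
    from e have e2: "0 < e / 2" by simp
    show ?thesis
      using AE_hit_late[OF pos e] AE_hit_early[OF pos e2 sum]
    proof eventually_elim
      case (elim \<eta>)
      then show ?case
      proof eventually_elim
        case (elim n)
        then obtain k where k: "1 \<le> k" "\<eta> \<in> multi_hit l d (init_cylinder \<omega> n) k" "ln k + ?L n \<le> e * n" by auto
        from hitting_time_le[OF k(1,2)] obtain j
          where j: "hitting_time l d (init_cylinder \<omega> n) \<eta> = enat j" "1 \<le> j" "j \<le> k" "\<eta> \<in> multi_hit l d (init_cylinder \<omega> n) j" .
        have "ln j \<le> ln k" using j by (intro ln_mono) auto
        moreover have "- e * n \<le> ln j + ?L n" using elim(1) j by blast
        ultimately show ?case using j(1) k(3) by (intro exI[of _ j]) (auto simp: abs_le_iff)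
      qed
    qed
  qed
  have "AE \<eta> in P. \<forall>i. \<forall>\<^sub>F n in sequentially. \<exists>k. hitting_time l d (init_cylinder \<omega> n) \<eta> = enat k \<and>
    \<bar>ln k + ?L n\<bar> \<le> (1 / Suc i) * n"
    unfolding AE_all_countable by (intro allI main) simp
  then show ?thesis
  proof eventually_elim
    case (elim \<eta>)
    show ?case
    proof (intro allI impI)
      fix e :: real assume "0 < e"
      then obtain i where i: "1 / Suc i < e" using reals_Archimedean by (auto simp: inverse_eq_divide)
      from elim[rule_format, of i]
      show "\<forall>\<^sub>F n in sequentially. \<exists>k. hitting_time l d (init_cylinder \<omega> n) \<eta> = enat k \<and> \<bar>ln k + ?L n\<bar> \<le> e * n"
      proof eventually_elim
        case (elim n)
        then obtain k where k: "hitting_time l d (init_cylinder \<omega> n) \<eta> = enat k" "\<bar>ln k + ?L n\<bar> \<le> (1 / Suc i) * n" by blast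
        have "(1 / Suc i) * n \<le> e * n" using i by (intro mult_right_mono) auto
        with k show ?case by auto
      qed
    qed
  qed
qed

end


subsection \<open>Growth rate of the hitting times\<close>

context psi_mixing_shift
begin

lemma summable_rate:
  assumes "(\<Sum>n. psi P (Suc n) * ennreal (ln (real (Suc n)))) < \<infinity>"
  shows "summable rate"
proof -
  have "(\<Sum>n. ennreal (rate (Suc n) * ln (real (Suc n)))) < \<infinity>"
    using assms by (simp add: psi_eq_rate ennreal_mult' del: of_nat_Suc)
  then have sum: "summable (\<lambda>n. rate (Suc n) * ln (real (Suc n)))"
    by (intro summable_suminf_not_top) auto
  have "summable (\<lambda>n. rate (Suc n))"
  \<comment> \<open>From \<open>n = 2\<close> on, \<open>Suc n \<ge> 3 \<ge> exp 1\<close>, so the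
    logarithmic weight is at least 1.\<close>
  proof (rule summable_comparison_test'[OF sum, where N = 2])
    fix n :: nat assume n: "2 \<le> n"
    have "exp 1 \<le> real (Suc n)" using exp_le n by simp
    then have "1 \<le> ln (real (Suc n))" by (subst ln_ge_iff) auto
    from mult_left_mono[OF this rate_nonneg[of "Suc n"]]
    show "norm (rate (Suc n)) \<le> rate (Suc n) * ln (real (Suc n))"
      by (simp del: of_nat_Suc)
  qed
  then show ?thesis by (simp only: summable_Suc_iff)
qed

text \<open>On the cell of the letter \<open>a\<close> the information is \<open>f a / ?p a\<close>,
  so \<open>nn_integral_density_le\<close> bounds its integral by the entropy sum.\<close>

lemma integrable_letter_entropy:
  assumes "(\<Sum>\<^sub>\<infinity>a. ennreal (- (measure P (cylinder [a]) * ln (measure P (cylinder [a]))))) < \<infinity>"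
  shows "integrable P (info P letter)"
proof -
  let ?p = "\<lambda>a. measure P (cylinder [a])"
  define f where "f a = - (?p a * ln (?p a))" for a
  have cell: "letter -` {a} \<inter> space P = cylinder [a]" for a by (auto simp: cylinder_def)
  have ln: "ln (?p a) \<le> 0" for a using positive[of a] by simp
  have f0: "0 \<le> f a" for a using ln[of a] by (simp add: f_def mult_nonneg_nonpos)
  \<comment> \<open>Bounded finite partial sums transfer the unordered sum to an integral over
    \<open>count_space\<close>.\<close>
  have "bdd_above (sum f ` {F. F \<subseteq> UNIV \<and> finite F})"
  proof (rule bdd_aboveI)
    fix x assume "x \<in> sum f ` {F. F \<subseteq> UNIV \<and> finite F}"
    then obtain F where F: "finite F" "x = sum f F" by auto
    have "ennreal x = (\<Sum>a\<in>F. ennreal (f a))" using F f0 by simp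
    also have "\<dots> \<le> (\<Sum>\<^sub>\<infinity>a. ennreal (f a))"
      by (subst nonneg_infsum_complete) (use F in \<open>auto intro!: SUP_upper\<close>)
    finally have "ennreal x \<le> (\<Sum>\<^sub>\<infinity>a. ennreal (f a))" .
    then show "x \<le> enn2real (\<Sum>\<^sub>\<infinity>a. ennreal (f a))"
      using assms f0 F unfolding f_def[symmetric]
      by (metis enn2real_ennreal enn2real_mono infinity_ennreal_def sum_nonneg)
  qed
  then have "f summable_on UNIV" using f0 by (intro nonneg_bdd_above_summable_on) auto
  then have "Infinite_Sum.abs_summable_on f UNIV" using f0 by simp
  then have "integrable (count_space UNIV) f"
    unfolding abs_summable_equivalent by (simp add: abs_summable_on_def)
  then have fin: "(\<integral>\<^sup>+a. ennreal (f a) \<partial>count_space UNIV) < \<infinity>"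
    using f0 by (simp add: nn_integral_eq_integral)
  have "(\<integral>\<^sup>+x. ennreal (info P letter x) \<partial>P) = (\<integral>\<^sup>+x. ennreal (f (letter x)) / ennreal (?p (letter x)) \<partial>P)"
  proof (rule nn_integral_cong)
    fix x
    have "info P letter x = f (letter x) / ?p (letter x)"
      using positive[of "letter x"] unfolding info_def cell f_def by simp
    then show "ennreal (info P letter x) = ennreal (f (letter x)) / ennreal (?p (letter x))"
      using f0 positive[of "letter x"] by (simp add: divide_ennreal)
  qed
  also have "\<dots> \<le> (\<integral>\<^sup>+a. ennreal (f a) \<partial>count_space UNIV)"
    using nn_integral_density_le[OF measurable_letter, of "\<lambda>a. ennreal (f a)"] unfolding cell .
  also note fin
  finally show ?thesis
    by (intro integrableI_nonneg measurable_info measurable_letter AE_I2 info_nonneg) auto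
qed

end

text \<open>Serves both limits: with \<open>c = b\<close> and \<open>y = 0\<close> for the first,
  with \<open>c = 0\<close> for the second. \<open>\<tau>\<close> may be infinite for finitely many
  \<open>n\<close>, hence the detour through real numbers.\<close>

lemma ln_enat_scaled_tendsto:
  fixes \<tau> :: "nat \<Rightarrow> enat" and b c :: "nat \<Rightarrow> real"
  assumes \<tau>: "\<forall>e::real. 0 < e \<longrightarrow> (\<forall>\<^sub>F n in sequentially. \<exists>k. \<tau> n = enat k \<and> \<bar>ln (real k) + b n\<bar> \<le> e * n)"
    and y: "(\<lambda>n. c n / real n - b n / real n) \<longlonglongrightarrow> y"
  shows "(\<lambda>n. ereal (1 / real n) * (ln_enat (\<tau> n) + ereal (c n))) \<longlonglongrightarrow> ereal y"
proof -
  define x where "x n = (ln (real (the_enat (\<tau> n))) + b n) / real n" for n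
  have "x \<longlonglongrightarrow> 0"
  proof (rule tendstoI)
    fix e :: real assume "0 < e"
    then have "0 < e / 2" by simp
    with \<tau> have "\<forall>\<^sub>F n in sequentially. \<exists>k. \<tau> n = enat k \<and> \<bar>ln (real k) + b n\<bar> \<le> e / 2 * n" by blast
    then show "\<forall>\<^sub>F n in sequentially. dist (x n) 0 < e"
      using eventually_ge_at_top[of 1]
    proof eventually_elim
      case (elim n)
      then have "\<bar>x n\<bar> \<le> e / 2" by (auto simp: x_def divide_le_eq)
      with \<open>0 < e\<close> show ?case by simp
    qed
  qed
  then have "(\<lambda>n. x n + (c n / real n - b n / real n)) \<longlonglongrightarrow> 0 + y" by (intro tendsto_add y)
  then have lim: "(\<lambda>n. ereal (x n + (c n / real n - b n / real n))) \<longlonglongrightarrow> ereal y" by simp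
  from \<tau>[rule_format, OF zero_less_one] have "\<forall>\<^sub>F n in sequentially. \<exists>k. \<tau> n = enat k"
    by (rule eventually_mono) blast
  then have "\<forall>\<^sub>F n in sequentially. ereal (x n + (c n / real n - b n / real n))
      = ereal (1 / real n) * (ln_enat (\<tau> n) + ereal (c n))"
  proof eventually_elim
    case (elim n)
    then obtain k where "\<tau> n = enat k" by blast
    then show ?case by (simp add: x_def add_divide_distrib)
  qed
  with lim show ?thesis by (rule Lim_transform_eventually)
qed

theorem corollary2p7:
  fixes P :: "(nat \<Rightarrow> 'a::countable) measure"
    and l :: nat and d :: "nat \<Rightarrow> nat"
  assumes alphabet: "\<exists>a b :: 'a. a \<noteq> b"
    and prob: "prob_space P"
    and sets_P: "sets P = sets sequence_algebra"
    and invariant: "measure_preserving P shift"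
    and positive: "\<And>a. measure P (cylinder [a]) > 0"
    and l: "1 \<le> l"
    and d: "1 \<le> d 1" "strict_mono_on {1..l} d"
    and mixing: "psi_mixing P"
    and summable: "(\<Sum>n. psi P (Suc n) * ennreal (ln (real (Suc n)))) < \<infinity>"
  shows "(AE \<omega> in P. AE \<eta> in P.
            (\<lambda>n. ereal (1 / real n) *
                 (ln_enat (hitting_time l d (init_cylinder \<omega> n) \<eta>)
                  + ereal (real l * ln (measure P (init_cylinder \<omega> n))))) \<longlonglongrightarrow> 0)
       \<and> ((\<Sum>\<^sub>\<infinity>a. ennreal (- (measure P (cylinder [a]) * ln (measure P (cylinder [a]))))) < \<infinity> \<longrightarrow>
          (AE \<omega> in P. AE \<eta> in P.
            (\<lambda>n. ereal (1 / real n) * ln_enat (hitting_time l d (init_cylinder \<omega> n) \<eta>))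
              \<longlonglongrightarrow> ereal (real l) * KS_entropy P shift))"
proof -
  interpret multiple_hitting P l d
    by (intro multiple_hitting.intro psi_mixing_shift.intro multiple_hitting_axioms.intro assms)
  note \<tau> = AE_hitting_time[OF _ summable_rate[OF summable]]
  show ?thesis
  proof (intro conjI impI)
    show "AE \<omega> in P. AE \<eta> in P.
            (\<lambda>n. ereal (1 / real n) *
                 (ln_enat (hitting_time l d (init_cylinder \<omega> n) \<eta>)
                  + ereal (real l * ln (measure P (init_cylinder \<omega> n))))) \<longlonglongrightarrow> 0"
      using AE_init_cylinder_pos
    proof eventually_elim
      case (elim \<omega>)
      from \<tau>[OF elim[rule_format]] show ?case
      proof eventually_elim
        case (elim \<eta>)
        from ln_enat_scaled_tendsto[OF elim, of "\<lambda>n. l * ln (measure P (init_cylinder \<omega> n))" 0]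
        show ?case by (simp add: zero_ereal_def)
      qed
    qed
  next
    assume "(\<Sum>\<^sub>\<infinity>a. ennreal (- (measure P (cylinder [a]) * ln (measure P (cylinder [a]))))) < \<infinity>"
    then have int: "integrable P (info P letter)" by (rule integrable_letter_entropy)
    then obtain h where h: "(\<lambda>n. integral\<^sup>L P (letter_info n) / real n) \<longlonglongrightarrow> h"
      and lim: "AE \<omega> in P. (\<lambda>n. letter_info n \<omega> / real n) \<longlonglongrightarrow> h"
      by (rule shannon_mcmillan_breiman)
    have KS: "KS_entropy P shift = ereal h"
      by (rule KS_entropy_generator[OF measurable_letter int generating h])
    show "AE \<omega> in P. AE \<eta> in P.
            (\<lambda>n. ereal (1 / real n) * ln_enat (hitting_time l d (init_cylinder \<omega> n) \<eta>))
              \<longlonglongrightarrow> ereal (real l) * KS_entropy P shift"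
      using AE_init_cylinder_pos lim
    proof eventually_elim
      case (elim \<omega>)
      have "(\<lambda>n. l * (letter_info n \<omega> / real n)) \<longlonglongrightarrow> l * h"
        by (intro tendsto_mult tendsto_const elim(2))
      \<comment> \<open>The term \<open>0 / real n\<close> matches the choice \<open>c = 0\<close>
        in \<open>ln_enat_scaled_tendsto\<close>.\<close>
      then have lh: "(\<lambda>n. 0 / real n - l * ln (measure P (init_cylinder \<omega> n)) / real n) \<longlonglongrightarrow> l * h"
        by (simp add: letter_info_eq)
      from \<tau>[OF elim(1)[rule_format]] show ?case
      proof eventually_elim
        case (elim \<eta>)
        from ln_enat_scaled_tendsto[OF elim lh] show ?case by (simp add: KS flip: zero_ereal_def)
      qed
    qed
  qed
qed

end
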